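(* Let $n,k$ be integers with $k\in\{2,3,4,5\}$ and $n\ge \frac{12}{6-k}+1$. Then $$ex_{\mathcal{P}}(n,F_k)\le \frac{24k}{7k+6}(n-2),$$ with equality if $n\equiv \frac{12(k+2)}{6-k} \pmod{\frac{28k+24}{6-k}}$.
   Context: All graphs are undirected, finite and simple. For a positive integer $k$, the $k$-fan $F_k\cong K_1+P_{k+1}$ is the graph obtained by joining a new vertex to all the vertices of the path $P_{k+1}$ on $k+1$ vertices. A graph is $H$-free if it contains no copy of $H$ as a (not necessarily induced) subgraph. The planar Turán number $ex_{\mathcal{P}}(n,H)$ is the maximum number of edges over all $H$-free planar graphs on $n$ vertices. (For $k\in\{2,3,4,5\}$ the numbers $\frac{12(k+2)}{6-k}$ and $\frac{28k+24}{6-k}$ are integers.) *)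

theory Defs
  imports "HOL-Analysis.Analysis" "HOL-Number_Theory.Cong"
begin

type_synonym 'a graph = "'a set \<times> 'a set set"

abbreviation verts :: "'a graph \<Rightarrow> 'a set" where "verts \<equiv> fst"
abbreviation edges :: "'a graph \<Rightarrow> 'a set set" where "edges \<equiv> snd"

definition simple_graph :: "'a graph \<Rightarrow> bool" where
  "simple_graph G \<longleftrightarrow> finite (verts G) \<and> edges G \<subseteq> {e. e \<subseteq> verts G \<and> card e = 2}"

text \<open>The subgraph need not be induced: only edges of \<open>H\<close> have to be preserved.\<close>

definition contains_copy :: "'a graph \<Rightarrow> 'b graph \<Rightarrow> bool" where
  "contains_copy G H \<longleftrightarrow>
     (\<exists>\<phi>. inj_on \<phi> (verts H) \<and> \<phi> ` verts H \<subseteq> verts G \<and> (\<forall>e\<in>edges H. \<phi> ` e \<in> edges G))"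

text \<open>
  Planarity is topological: vertices are distinct points of the plane and edges are Jordan arcs
  (not necessarily polygonal or smooth) joining their ends. An arc meets the set of vertex points
  only in its own ends, and two distinct arcs meet only in common ends.
\<close>

definition planar_drawing :: "'a graph \<Rightarrow> ('a \<Rightarrow> complex) \<Rightarrow> ('a set \<Rightarrow> real \<Rightarrow> complex) \<Rightarrow> bool" where
  "planar_drawing G p \<gamma> \<longleftrightarrow>
     inj_on p (verts G) \<and>
     (\<forall>e\<in>edges G. arc (\<gamma> e) \<and> {pathstart (\<gamma> e), pathfinish (\<gamma> e)} = p ` e \<and>
                   path_image (\<gamma> e) \<inter> p ` verts G = p ` e) \<and>
     (\<forall>e\<in>edges G. \<forall>f\<in>edges G. e \<noteq> f \<longrightarrow> path_image (\<gamma> e) \<inter> path_image (\<gamma> f) = p ` (e \<inter> f))"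

definition planar :: "'a graph \<Rightarrow> bool" where
  "planar G \<longleftrightarrow> (\<exists>p \<gamma>. planar_drawing G p \<gamma>)"

text \<open>Every finite graph is isomorphic to one with vertices in \<^typ>\<open>nat\<close>.\<close>

definition free_planar_graphs :: "nat \<Rightarrow> 'b graph \<Rightarrow> nat graph set" where
  "free_planar_graphs n H =
     {G. simple_graph G \<and> card (verts G) = n \<and> planar G \<and> \<not> contains_copy G H}"

definition ex_planar :: "nat \<Rightarrow> 'b graph \<Rightarrow> nat" where
  "ex_planar n H = Max ((\<lambda>G. card (edges G)) ` free_planar_graphs n H)"

text \<open>The hub is \<open>0\<close> and the path runs through \<open>1, \<dots>, k + 1\<close>.\<close>

definition fan :: "nat \<Rightarrow> nat graph" where
  "fan k = ({0..k + 1}, {{0, i} | i. i \<in> {1..k + 1}} \<union> {{i, i + 1} | i. i \<in> {1..k}})"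

text \<open>The maximum defining \<^const>\<open>ex_planar\<close> is over a finite set, nonempty if \<open>H\<close> has an edge.\<close>

lemma finite_edge_counts: "finite ((\<lambda>G. card (edges G)) ` free_planar_graphs n H)"
proof (rule finite_subset)
  show "(\<lambda>G. card (edges G)) ` free_planar_graphs n H \<subseteq> {..2 ^ n}"
  proof clarsimp
    fix V E assume "(V, E) \<in> free_planar_graphs n H"
    then have *: "finite V" "card V = n" "E \<subseteq> Pow V"
      by (auto simp: free_planar_graphs_def simple_graph_def)
    then show "card E \<le> 2 ^ n"
      by (metis card_Pow card_mono finite_Pow_iff)
  qed
qed simp

lemma free_planar_graphs_nonempty:
  assumes "edges H \<noteq> {}"
  shows "free_planar_graphs n H \<noteq> {}"
proof -
  have "planar ({..<n}, {})"
    unfolding planar_def planar_drawing_def by (auto intro!: exI[of _ of_nat] inj_onI)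
  then have "({..<n}, {}) \<in> free_planar_graphs n H"
    using assms by (auto simp: free_planar_graphs_def simple_graph_def contains_copy_def)
  then show ?thesis by blast
qed

end

theory Submission imports Defs begin

text \<open>
  The upper bound comes from counting facial triangles. A plane graph with n >= 4 vertices, none of them isolated, e edges and t
  triangular faces satisfies 2 e + 8 <= 4 n + t, since all other faces have length at least four. So the
  bound follows once 6 k t <= (5 k - 6) e is known, in other words, once enough sides of edges lie on faces that are not
  triangles. If there is no fan with k triangles, then the triangular faces around a vertex u come in runs of at
  most k - 1 consecutive ones, unless all faces around u are triangles, in which case u has degree at most k and is
  called inner. The vertices that are not inner supply one non-triangular corner for every k of their edges.
  Inner vertices supply none, and it must be shown that they are not too many. This is done by an isoperimetric
  inequality: a set of w inner vertices meets at least 3 w edges (\<open>inner_isoperimetric\<close>), which is a consequence of Euler's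
  formula for the components of the subgraph of inner vertices. Together with the local estimate at outer
  vertices (\<open>outer_vertex_link\<close>) this gives \<open>fan_free_edge_bound\<close>. The exceptions, with only inner vertices, are the small
  triangulations that the lower bound on n excludes.

  Planarity is topological, with arbitrary Jordan arcs as edges, so there is no rotation system to start from. Faces are the
  components of the complement of the drawing, and the two halves of Euler's formula are proved separately. An arc that
  closes a curve creates a new face by the Jordan curve theorem (\<open>closing_arc_separates\<close>,
  \<open>euler_lower\<close>). That an arc splits a face into at most two parts is shown with continuous logarithms of quotients
  (x - p) / (x - q) (\<open>arc_splits_face_in_at_most_two\<close>); it also implies that an edge is on the boundary of at most two
  faces. Everything that is needed about the cyclic order of faces around a vertex is derived from this fact. In particular, a cycle of
  triangular faces around a vertex contains all its edges (\<open>closed_link_is_everything\<close>), so the graph of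
  triangular faces around a vertex is either one cycle or a disjoint union of paths.

  For equality one needs every vertex to be inner or to have runs of exactly k - 1 triangles separated by quadrilaterals. This is
  achieved by gluing copies of the k-regular triangulations (triangle, tetrahedron, octahedron, icosahedron)
  at the corners of their outer triangles, in the pattern of a tower of cuboctahedra: every edge of the pattern lies on one
  triangle and one quadrilateral. Each triangle of such a graph lies in a single copy, hence so does each fan, and the
  copies are k-regular (\<open>glued_fan_free\<close>). The drawing consists of straight-line drawings with integer coordinates, placed in a
  strip and wrapped around the origin by the exponential function (\<open>pattern_planar\<close>).
\<close>

section \<open>Continuous logarithms and the faces of a compact set\<close>

text \<open>Functions with a continuous logarithm represent the trivial class in the first cohomology of S. They detect
  faces: points p and q lie in the same component of the complement of a compact set S exactly when (x - p) / (x -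
  q) is trivial on S.\<close>

definition has_log_on :: "(complex \<Rightarrow> complex) \<Rightarrow> complex set \<Rightarrow> bool" where
  "has_log_on f S \<longleftrightarrow> (\<exists>g. continuous_on S g \<and> (\<forall>x\<in>S. f x = exp (g x)))"

lemma has_log_on_mult:
  assumes "has_log_on f S" "has_log_on g S"
  shows "has_log_on (\<lambda>x. f x * g x) S"
proof -
  obtain a b where "continuous_on S a" "\<forall>x\<in>S. f x = exp (a x)" "continuous_on S b" "\<forall>x\<in>S. g x = exp (b x)"
    using assms unfolding has_log_on_def by blast
  then show ?thesis unfolding has_log_on_def
    by (intro exI[of _ "\<lambda>x. a x + b x"]) (auto intro!: continuous_intros simp: exp_add)
qed

lemma has_log_on_inverse:
  assumes "has_log_on f S"
  shows "has_log_on (\<lambda>x. inverse (f x)) S"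
proof -
  obtain a where "continuous_on S a" "\<forall>x\<in>S. f x = exp (a x)"
    using assms unfolding has_log_on_def by blast
  then show ?thesis unfolding has_log_on_def
    by (intro exI[of _ "\<lambda>x. - a x"]) (auto intro!: continuous_intros simp: exp_minus)
qed

lemma has_log_on_cong:
  "has_log_on f S \<Longrightarrow> (\<And>x. x \<in> S \<Longrightarrow> f x = g x) \<Longrightarrow> has_log_on g S"
  unfolding has_log_on_def by metis

text \<open>The relation between p and q expressed by the conclusion is an equivalence relation with open classes on the
  complement of S, because for q close to p the quotient stays in the right half-plane, where the principal
  logarithm is continuous. So it is constant on components.\<close>

lemma has_log_on_quotient:
  assumes S: "compact S" and pq: "connected_component (- S) p q"
  shows "has_log_on (\<lambda>x. (x - p) / (x - q)) S"
proof -
  define R where "R = (\<lambda>p q. has_log_on (\<lambda>x. (x - p) / (x - q)) S)"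
  have "R p q"
  proof (rule connected_equivalence_relation[where S="connected_component_set (-S) p"])
    show "connected (connected_component_set (- S) p)" by simp
    show "p \<in> connected_component_set (- S) p" "q \<in> connected_component_set (- S) p"
      using pq connected_component_in[OF pq] by (auto simp: connected_component_refl_eq)
  next
    fix x y assume "R x y"
    then show "R y x" unfolding R_def
      by (rule has_log_on_cong[OF has_log_on_inverse]) (simp)
  next
    fix x y z assume "R x y" and "R y z" and x: "x \<in> connected_component_set (- S) p"
      and y: "y \<in> connected_component_set (- S) p" and z: "z \<in> connected_component_set (- S) p"
    have "y \<notin> S" using connected_component_in[of "-S" p y] y by auto
    have "has_log_on (\<lambda>w. (w - x) / (w - y) * ((w - y) / (w - z))) S"
      using \<open>R x y\<close> \<open>R y z\<close> unfolding R_def by (rule has_log_on_mult)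
    then show "R x z" unfolding R_def
    proof (rule has_log_on_cong)
      fix w assume "w \<in> S"
      with \<open>y \<notin> S\<close> have "w - y \<noteq> 0" by auto
      then show "(w - x) / (w - y) * ((w - y) / (w - z)) = (w - x) / (w - z)" by simp
    qed
  next
    fix a assume a: "a \<in> connected_component_set (- S) p"
    let ?C = "connected_component_set (- S) p"
    have aS: "a \<in> - S" using a connected_component_in by fastforce
    have op: "open (- S)" using S by (simp add: compact_imp_closed open_Compl)
    then obtain e where e: "e > 0" "ball a e \<subseteq> - S" using aS openE by blast
    have "R a b" if b: "b \<in> ball a (e/2)" for b
      unfolding R_def has_log_on_def
    proof (intro exI conjI ballI)
      have *: "(x - a) / (x - b) \<notin> \<real>\<^sub>\<le>\<^sub>0 \<and> x \<noteq> b \<and> x \<noteq> a" if x: "x \<in> S" for x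
      proof -
        have xa: "dist a x \<ge> e" using e x by (metis ComplD linorder_not_less mem_ball subsetD)
        have ab: "dist a b < e / 2" using b by simp
        have xb: "dist b x > e / 2" using xa ab dist_triangle[of a x b] by (simp add: dist_commute)
        then have ne: "x \<noteq> b" "x \<noteq> a" using e xa by auto
        have "1 - (x - a) / (x - b) = (a - b) / (x - b)" using ne by (simp add: field_simps)
        then have "cmod (1 - (x - a) / (x - b)) = cmod (a - b) / cmod (x - b)"
          by (simp add: norm_divide)
        also have "\<dots> < 1" using ab xb ne by (simp add: dist_norm norm_minus_commute divide_simps)
        finally have "\<bar>Re (1 - (x - a) / (x - b))\<bar> < 1" using abs_Re_le_cmod order_le_less_trans by blast
        then have "Re ((x - a) / (x - b)) > 0" by auto
        then show ?thesis using ne by (auto simp: complex_nonpos_Reals_iff)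
      qed
      show "continuous_on S (\<lambda>x. Ln ((x - a) / (x - b)))"
        using * by (intro continuous_intros) auto
      show "(x - a) / (x - b) = exp (Ln ((x - a) / (x - b)))" if "x \<in> S" for x
        using *[OF that] by simp
    qed
    moreover have "openin (top_of_set ?C) (?C \<inter> ball a (e/2))" by (auto simp: openin_open)
    ultimately show "\<exists>T. openin (top_of_set ?C) T \<and> a \<in> T \<and> (\<forall>x\<in>T. R a x)"
      using a e by (intro exI[of _ "?C \<inter> ball a (e/2)"]) auto
  qed
  then show ?thesis by (simp add: R_def)
qed

text \<open>Once around the circle a logarithm of the i-th power would grow by i periods, but it must return to its initial
  value.\<close>

lemma power_int_no_log_on_sphere:
  fixes p :: complex
  assumes "r > 0" and g: "continuous_on (sphere p r) g"
    and e: "\<And>x. x \<in> sphere p r \<Longrightarrow> (x - p) powi i = exp (g x)"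
  shows "i = 0"
proof -
  define c where "c = (\<lambda>t::real. p + of_real r * exp (\<i> * of_real t))"
  define h where "h = (\<lambda>t::real. g (c t) - of_int i * (of_real (ln r) + \<i> * of_real t))"
  have c: "c t \<in> sphere p r" for t
    using \<open>r > 0\<close> by (simp add: c_def dist_norm norm_mult)
  have exph: "exp (h t) = 1" for t
  proof -
    have "exp (of_int i * (of_real (ln r) + \<i> * of_real t)) = (c t - p) powi i"
      using \<open>r > 0\<close> by (simp add: c_def exp_power_int[symmetric] exp_add exp_of_real)
    then show ?thesis using e[OF c, of t] by (simp add: h_def exp_diff)
  qed
  have "continuous_on {0..2*pi} c"
    unfolding c_def by (intro continuous_intros)
  moreover have "c ` {0..2*pi} \<subseteq> sphere p r" using c by blast
  ultimately have "continuous_on {0..2*pi} (\<lambda>t. g (c t))"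
    by (rule continuous_on_compose2[OF g])
  then have cont: "continuous_on {0..2*pi} h"
    unfolding h_def by (intro continuous_intros)
  have "h constant_on {0..2*pi}"
  proof (rule continuous_discrete_range_constant[OF _ cont])
    fix x assume "x \<in> {0..2*pi}"
    show "\<exists>e>0. \<forall>y. y \<in> {0..2*pi} \<and> h y \<noteq> h x \<longrightarrow> e \<le> norm (h y - h x)"
    proof (intro exI[of _ 1] conjI allI impI)
      fix y assume y: "y \<in> {0..2*pi} \<and> h y \<noteq> h x"
      have "exp (h y) = exp (h x)" using exph by simp
      then obtain n where n: "h y = h x + of_real (of_int (2 * n) * pi) * \<i>" using exp_eq by blast
      with y have "n \<noteq> 0" by auto
      have "norm (h y - h x) = 2 * \<bar>of_int n\<bar> * pi" using n by (simp add: norm_mult abs_mult)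
      moreover have "\<bar>real_of_int n\<bar> \<ge> 1" using \<open>n \<noteq> 0\<close> by linarith
      then have "2 * \<bar>of_int n\<bar> * pi \<ge> 2 * 1 * pi" by (intro mult_mono) auto
      moreover have "pi > 3" by (rule pi_gt3)
      ultimately show "1 \<le> norm (h y - h x)" by linarith
    qed simp
  qed simp
  then have "h 0 = h (2 * pi)" unfolding constant_on_def by auto
  moreover have "c 0 = c (2 * pi)" by (simp add: c_def flip: cis_conv_exp)
  ultimately show ?thesis by (simp add: h_def algebra_simps)
qed

text \<open>Extend the logarithm to the whole plane and use its exponential, divided by g, inside C and the i-th power
  outside C. The two agree on the frontier of C, so the result is a continuous function without zeros on a large
  disc around C; it has a logarithm there, and on the bounding circle it is the i-th power.\<close>

lemma log_on_frontier_of_bounded_component: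
  assumes S: "compact S" and C: "C \<in> components (- S)" "bounded C" "p \<in> C"
    and g: "continuous_on (S \<union> C) g" "\<And>x. x \<in> S \<union> C \<Longrightarrow> g x \<noteq> 0"
    and lg: "has_log_on (\<lambda>x. (x - p) powi i * g x) S"
  shows "i = 0"
proof -
  obtain L where L: "continuous_on S L" "\<And>x. x \<in> S \<Longrightarrow> (x - p) powi i * g x = exp (L x)"
    using lg unfolding has_log_on_def by blast
  have clS: "closed S" using S compact_imp_closed by blast
  obtain L' where L': "continuous_on UNIV L'" "\<And>x. x \<in> S \<Longrightarrow> L' x = L x"
    using Tietze_unbounded[OF L(1) closed_subset[OF subset_UNIV clS]] by blast
  have opC: "open C" using C clS open_components by blast
  have CS: "C \<inter> S = {}" using C in_components_subset by fastforce
  have fr: "frontier C \<subseteq> S"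
    using frontier_of_components_subset[OF C(1)] frontier_subset_closed[OF clS] by (metis frontier_complement order_trans)
  have clC: "closure C \<subseteq> S \<union> C" using fr opC by (auto simp: frontier_def interior_open)
  define H where "H = (\<lambda>x. if x \<in> closure C then exp (L' x) / g x else (x - p) powi i)"
  have Heq: "H x = (x - p) powi i" if "x \<notin> C" for x
  proof (cases "x \<in> closure C")
    case True
    then have "x \<in> S" using clC that by auto
    then show ?thesis using L(2)[of x] L'(2)[of x] g(2)[of x] True by (simp add: H_def field_simps)
  qed (simp add: H_def)
  have "continuous_on (closure C \<union> (- C)) H"
  proof (rule continuous_on_closed_Un)
    have "continuous_on (closure C) (\<lambda>x. exp (L' x) / g x)"
      using g clC by (intro continuous_intros continuous_on_subset[OF L'(1)] continuous_on_subset[OF g(1)]) auto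
    then show "continuous_on (closure C) H"
      by (rule continuous_on_eq) (simp add: H_def)
    have "continuous_on (- C) (\<lambda>x. (x - p) powi i)"
      using C(3) by (intro continuous_intros) auto
    then show "continuous_on (- C) H"
      by (rule continuous_on_eq) (use Heq in auto)
  qed (use opC in auto)
  moreover have "closure C \<union> (- C) = UNIV" using closure_subset[of C] by auto
  ultimately have contH: "continuous_on UNIV H" by simp
  have nz: "H x \<noteq> 0" for x
  proof (cases "x \<in> C")
    case True then show ?thesis using g(2)[of x] closure_subset[of C] by (auto simp: H_def)
  next
    case False then show ?thesis using Heq C(3) by auto
  qed
  obtain r where r: "r > 0" "C \<subseteq> ball p r" using C(2) bounded_subset_ballD by blast
  obtain k where k: "continuous_on (cball p r) k" "\<And>x. x \<in> cball p r \<Longrightarrow> H x = exp (k x)"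
    using continuous_logarithm_on_cball[of p r H] contH nz continuous_on_subset by blast
  show "i = 0"
  proof (rule power_int_no_log_on_sphere[OF r(1)])
    show "continuous_on (sphere p r) k" using k(1) continuous_on_subset sphere_cball by blast
    fix x assume x: "x \<in> sphere p r"
    then have "x \<notin> C" using r by auto
    then show "(x - p) powi i = exp (k x)" using Heq k(2) x by (metis sphere_cball subsetD)
  qed
qed

lemma exponent_zero_of_bounded:
  assumes S: "compact S" and notin: "p \<notin> S" "q \<notin> S" "r \<notin> S"
    and sep: "\<not> connected_component (- S) p q" "\<not> connected_component (- S) p r"
    and bd: "bounded (connected_component_set (- S) p)"
    and lg: "has_log_on (\<lambda>x. (x - p) powi i * ((x - q) powi j * (x - r) powi l)) S"
  shows "i = 0"
proof (rule log_on_frontier_of_bounded_component[OF S _ bd _ _ _ lg])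
  let ?C = "connected_component_set (- S) p"
  show "?C \<in> components (- S)" using notin by (auto simp: components_iff)
  show "p \<in> ?C" using notin by (simp add: connected_component_refl_eq)
  have "q \<notin> S \<union> ?C" "r \<notin> S \<union> ?C" using sep notin by auto
  then have ne: "x - q \<noteq> 0 \<and> x - r \<noteq> 0" if "x \<in> S \<union> ?C" for x using that by auto
  show "continuous_on (S \<union> ?C) (\<lambda>x. (x - q) powi j * (x - r) powi l)"
    using ne by (intro continuous_intros) blast+
  show "(x - q) powi j * (x - r) powi l \<noteq> 0" if "x \<in> S \<union> ?C" for x
    using ne[OF that] by simp
qed

text \<open>At most one of the three components is unbounded, so two of the exponents vanish by the previous lemma and the
  third by the condition on the sum.\<close>

lemma three_components_log:
  assumes S: "compact S" and notin: "p \<notin> S" "q \<notin> S" "r \<notin> S"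
    and sep: "\<not> connected_component (- S) p q" "\<not> connected_component (- S) p r"
      "\<not> connected_component (- S) q r"
    and sum: "i + j + l = 0"
    and lg: "has_log_on (\<lambda>x. (x - p) powi i * ((x - q) powi j * (x - r) powi l)) S"
  shows "i = 0 \<and> j = 0 \<and> l = 0"
proof -
  let ?B = "\<lambda>p. bounded (connected_component_set (- S) p)"
  have sep': "\<not> connected_component (- S) q p" "\<not> connected_component (- S) r p"
      "\<not> connected_component (- S) r q" using sep connected_component_sym by blast+
  have unb: "?B p \<or> ?B q" if "p \<notin> S" "q \<notin> S" "\<not> connected_component (- S) p q" for p q
  proof (rule ccontr)
    assume "\<not> (?B p \<or> ?B q)"
    then have "connected_component_set (- S) p = connected_component_set (- S) q"
      using that S by (intro cobounded_unique_unbounded_component) (auto simp: compact_imp_bounded)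
    then have "q \<in> connected_component_set (- S) p" using that by (simp add: connected_component_refl_eq)
    then show False using that by simp
  qed
  have lq: "has_log_on (\<lambda>x. (x - q) powi j * ((x - p) powi i * (x - r) powi l)) S"
    by (rule has_log_on_cong[OF lg]) simp
  have lr: "has_log_on (\<lambda>x. (x - r) powi l * ((x - p) powi i * (x - q) powi j)) S"
    by (rule has_log_on_cong[OF lg]) simp
  have "?B p \<Longrightarrow> i = 0"
    using exponent_zero_of_bounded[OF S notin(1,2,3) sep(1,2) _ lg] by blast
  moreover have "?B q \<Longrightarrow> j = 0"
    using exponent_zero_of_bounded[OF S notin(2,1,3) sep'(1) sep(3) _ lq] by blast
  moreover have "?B r \<Longrightarrow> l = 0"
    using exponent_zero_of_bounded[OF S notin(3,1,2) sep'(2,3) _ lr] by blast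
  ultimately show ?thesis using unb[OF notin(1,2) sep(1)] unb[OF notin(1,3) sep(2)]
      unb[OF notin(2,3) sep(3)] sum by auto
qed

text \<open>This carries the half of Euler's formula that bounds the number of faces from above. A quotient for two points
  of the same face of X has a logarithm on X and one on the arc. After normalising at one end of the arc the only
  obstruction to a logarithm on the union is a single integer, the number of periods by which the two differ at
  the other end. For three points there are two such integers m1 and m2, and a nontrivial relation between them
  yields a nontrivial product of powers with a logarithm, which cannot exist if all three points are separated.\<close>

lemma arc_splits_face_in_at_most_two:
  fixes X :: "complex set"
  assumes X: "compact X" and \<alpha>: "arc \<alpha>"
    and int: "path_image \<alpha> \<inter> X = {pathstart \<alpha>, pathfinish \<alpha>}"
    and notin: "p \<notin> X \<union> path_image \<alpha>" "q \<notin> X \<union> path_image \<alpha>" "r \<notin> X \<union> path_image \<alpha>"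
    and con: "connected_component (- X) p q" "connected_component (- X) q r"
  shows "connected_component (- (X \<union> path_image \<alpha>)) p q \<or>
    connected_component (- (X \<union> path_image \<alpha>)) q r \<or> connected_component (- (X \<union> path_image \<alpha>)) p r"
proof (rule ccontr)
  assume neg: "\<not> ?thesis"
  let ?A = "path_image \<alpha>" and ?a = "pathstart \<alpha>" and ?b = "pathfinish \<alpha>"
  let ?S = "X \<union> ?A"
  have A: "compact ?A" using \<alpha> by (simp add: compact_arc_image)
  have S: "compact ?S" using X A by blast
  have clX: "closed X" using X by (rule compact_imp_closed)
  have clA: "closed ?A" using A by (rule compact_imp_closed)
  have conA: "connected_component (- ?A) u v" if "u \<notin> ?S" "v \<notin> ?S" for u v
  proof -
    have "connected (- ?A)" using connected_arc_complement[OF \<alpha>] by simp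
    then show ?thesis using that by (intro connected_componentI[of "- ?A"]) auto
  qed
  \<comment> \<open>On each piece the quotient has a logarithm; normalised to agree at one end of the arc, the two
    differ at the other end by a period.\<close>
  have logs: "\<exists>g h n. continuous_on X g \<and> (\<forall>x\<in>X. (x - u) / (x - v) = exp (g x)) \<and>
       continuous_on ?A h \<and> (\<forall>x\<in>?A. (x - u) / (x - v) = exp (h x)) \<and>
       h ?a = g ?a \<and> h ?b - g ?b = of_int n * (2 * of_real pi * \<i>)"
    if uv: "u \<notin> ?S" "v \<notin> ?S" "connected_component (- X) u v" for u v
  proof -
    obtain g where g: "continuous_on X g" "\<forall>x\<in>X. (x - u) / (x - v) = exp (g x)"
      using has_log_on_quotient[OF X uv(3)] unfolding has_log_on_def by blast
    obtain h where h: "continuous_on ?A h" "\<forall>x\<in>?A. (x - u) / (x - v) = exp (h x)"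
      using has_log_on_quotient[OF A conA[OF uv(1,2)]] unfolding has_log_on_def by blast
    have ab: "?a \<in> X" "?a \<in> ?A" "?b \<in> X" "?b \<in> ?A" using int by auto
    define h' where "h' = (\<lambda>x. h x + (g ?a - h ?a))"
    have "exp (g ?a) = exp (h ?a)" using g h ab by metis
    then have h': "\<forall>x\<in>?A. (x - u) / (x - v) = exp (h' x)"
      using h by (simp add: h'_def exp_add exp_diff)
    have "exp (h' ?b) = exp (g ?b)" using g h' ab by metis
    then obtain n where "h' ?b = g ?b + of_real (of_int (2 * n) * pi) * \<i>" using exp_eq by blast
    then have n: "h' ?b - g ?b = of_int n * (2 * of_real pi * \<i>)" by simp
    have c: "continuous_on ?A h'" unfolding h'_def by (intro continuous_intros h)
    have "h' ?a = g ?a" by (simp add: h'_def)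
    then show ?thesis using g h' c n by blast
  qed
  obtain g1 h1 m1 where 1: "continuous_on X g1" "\<forall>x\<in>X. (x - p) / (x - q) = exp (g1 x)"
       "continuous_on ?A h1" "\<forall>x\<in>?A. (x - p) / (x - q) = exp (h1 x)"
       "h1 ?a = g1 ?a" "h1 ?b - g1 ?b = of_int m1 * (2 * of_real pi * \<i>)"
    using logs[OF notin(1,2) con(1)] by blast
  obtain g2 h2 m2 where 2: "continuous_on X g2" "\<forall>x\<in>X. (x - q) / (x - r) = exp (g2 x)"
       "continuous_on ?A h2" "\<forall>x\<in>?A. (x - q) / (x - r) = exp (h2 x)"
       "h2 ?a = g2 ?a" "h2 ?b - g2 ?b = of_int m2 * (2 * of_real pi * \<i>)"
    using logs[OF notin(2,3) con(2)] by blast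
  have key: "c1 = 0 \<and> c2 = 0" if c: "c1 * m1 + c2 * m2 = 0" for c1 c2
  proof -
    define L where "L = (\<lambda>x. if x \<in> ?A then of_int c1 * h1 x + of_int c2 * h2 x
        else of_int c1 * g1 x + of_int c2 * g2 x)"
    have agb: "of_int c1 * h1 ?b + of_int c2 * h2 ?b = of_int c1 * g1 ?b + of_int c2 * g2 ?b"
    proof -
      have "of_int c1 * (h1 ?b - g1 ?b) + of_int c2 * (h2 ?b - g2 ?b)
          = of_int (c1 * m1 + c2 * m2) * (2 * of_real pi * \<i>)"
        unfolding 1(6) 2(6) by (simp add: algebra_simps)
      also have "\<dots> = 0" by (simp only: c) simp
      finally show ?thesis by (simp add: algebra_simps)
    qed
    have "continuous_on (?A \<union> X) L" unfolding L_def
    proof (rule continuous_on_cases[OF clA clX])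
      show "continuous_on ?A (\<lambda>x. of_int c1 * h1 x + of_int c2 * h2 x)"
        by (intro continuous_intros 1 2)
      show "continuous_on X (\<lambda>x. of_int c1 * g1 x + of_int c2 * g2 x)"
        by (intro continuous_intros 1 2)
      show "\<forall>x. x \<in> ?A \<and> x \<notin> ?A \<or> x \<in> X \<and> x \<in> ?A \<longrightarrow>
          of_int c1 * h1 x + of_int c2 * h2 x = of_int c1 * g1 x + of_int c2 * g2 x"
      proof (intro allI impI)
        fix x assume "x \<in> ?A \<and> x \<notin> ?A \<or> x \<in> X \<and> x \<in> ?A"
        then have "x \<in> ?A \<inter> X" by blast
        then have "x = ?a \<or> x = ?b" unfolding int by simp
        then show "of_int c1 * h1 x + of_int c2 * h2 x = of_int c1 * g1 x + of_int c2 * g2 x"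
          using agb 1(5) 2(5) by auto
      qed
    qed
    moreover have "(x - p) powi c1 * ((x - q) powi (c2 - c1) * (x - r) powi (- c2)) = exp (L x)"
      if "x \<in> ?A \<union> X" for x
    proof -
      have ne: "x - p \<noteq> 0" "x - q \<noteq> 0" "x - r \<noteq> 0" using that notin by auto
      have "exp (L x) = ((x - p) / (x - q)) powi c1 * ((x - q) / (x - r)) powi c2"
        using that 1(2,4) 2(2,4) by (auto simp: L_def exp_add exp_power_int)
      also have "\<dots> = (x - p) powi c1 * ((x - q) powi (c2 - c1) * (x - r) powi (- c2))"
        using ne by (simp add: power_int_divide_distrib power_int_diff power_int_minus field_simps)
      finally show ?thesis by simp
    qed
    ultimately have "has_log_on (\<lambda>x. (x - p) powi c1 * ((x - q) powi (c2 - c1) * (x - r) powi (- c2))) ?S"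
      unfolding has_log_on_def by (metis Un_commute)
    then have "c1 = 0 \<and> c2 - c1 = 0 \<and> - c2 = 0"
      using neg by (intro three_components_log[OF S notin]) auto
    then show ?thesis by auto
  qed
  have "m2 = 0" "m1 = 0" using key[of m2 "- m1"] by auto
  then show False using key[of 1 0] by simp
qed

text \<open>Points chosen from distinct faces. They replace the set of faces when edges are deleted, because a point stays
  where it is while faces merge.\<close>

definition face_reps :: "complex set \<Rightarrow> complex set \<Rightarrow> bool" where
  "face_reps X P \<longleftrightarrow> finite P \<and> P \<inter> X = {} \<and>
     (\<forall>p\<in>P. \<forall>q\<in>P. p \<noteq> q \<longrightarrow> \<not> connected_component (- X) p q)"

lemma open_arc_connected_in_complement:
  fixes X :: "complex set"
  assumes \<alpha>: "arc \<alpha>" and int: "path_image \<alpha> \<inter> X = {pathstart \<alpha>, pathfinish \<alpha>}"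
    and "z \<in> path_image \<alpha> - X" "z' \<in> path_image \<alpha> - X"
  shows "connected_component (- X) z z'"
proof (rule connected_componentI)
  show "connected (path_image \<alpha> - {pathstart \<alpha>, pathfinish \<alpha>})"
    using connected_simple_path_endless arc_imp_simple_path \<alpha> by blast
qed (use assms in auto)

text \<open>The open arc runs through a single face of X, and that face is cut into at most two, so at most one
  representative has to be given up.\<close>

lemma face_reps_remove_arc:
  assumes X: "compact X" and \<alpha>: "arc \<alpha>"
    and int: "path_image \<alpha> \<inter> X = {pathstart \<alpha>, pathfinish \<alpha>}"
    and P: "face_reps (X \<union> path_image \<alpha>) P"
  shows "\<exists>P'. face_reps X P' \<and> card P \<le> card P' + 1"
proof (cases "face_reps X P")
  case True then show ?thesis by (intro exI[of _ P]) auto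
next
  case False
  let ?A = "path_image \<alpha>"
  have finP: "finite P" and PX: "P \<inter> (X \<union> ?A) = {}" using P by (auto simp: face_reps_def)
  have sep: "\<not> connected_component (- (X \<union> ?A)) u v" if "u \<in> P" "v \<in> P" "u \<noteq> v" for u v
    using P that by (auto simp: face_reps_def)
  \<comment> \<open>Only the face containing the open arc can be split.\<close>
  have meets: "\<exists>z \<in> ?A - X. connected_component (- X) u z"
    if uv: "u \<in> P" "v \<in> P" "u \<noteq> v" "connected_component (- X) u v" for u v
  proof (rule ccontr)
    assume no: "\<not> ?thesis"
    let ?C = "connected_component_set (- X) u"
    have "?C \<subseteq> - X" by (simp add: connected_component_subset)
    then have "?C \<subseteq> - (X \<union> ?A)" using no by fastforce
    moreover have "u \<in> ?C" "v \<in> ?C" using uv PX by (auto simp: connected_component_refl_eq)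
    ultimately have "connected_component (- (X \<union> ?A)) u v"
      by (intro connected_componentI[of ?C]) auto
    then show False using sep uv by blast
  qed
  obtain p q where pq: "p \<in> P" "q \<in> P" "p \<noteq> q" "connected_component (- X) p q"
    using False finP PX by (auto simp: face_reps_def)
  have "face_reps X (P - {q})"
  proof (rule ccontr)
    assume "\<not> ?thesis"
    then obtain u v where uv: "u \<in> P - {q}" "v \<in> P - {q}" "u \<noteq> v" "connected_component (- X) u v"
      using finP PX by (auto simp: face_reps_def)
    obtain z z' where "z \<in> ?A - X" "connected_component (- X) p z" "z' \<in> ?A - X" "connected_component (- X) u z'"
      using meets[of p q] meets[of u v] pq uv by blast
    moreover then have "connected_component (- X) z z'"
      using open_arc_connected_in_complement[OF \<alpha> int] by blast
    ultimately have pu: "connected_component (- X) p u"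
      by (meson connected_component_sym connected_component_trans)
    \<comment> \<open>One of u and v differs from p and gives a third point in the face of p and q.\<close>
    obtain w where w: "w \<in> P" "w \<noteq> p" "w \<noteq> q" "connected_component (- X) p w"
      using uv pu connected_component_trans by blast
    have n: "p \<notin> X \<union> ?A" "q \<notin> X \<union> ?A" "w \<notin> X \<union> ?A" using pq w PX by auto
    have "connected_component (- X) q w"
      using pq(4) w(4) by (meson connected_component_sym connected_component_trans)
    then show False
      using arc_splits_face_in_at_most_two[OF X \<alpha> int n pq(4)] sep pq w by blast
  qed
  then show ?thesis using finP pq(2)
    by (intro exI[of _ "P - {q}"]) (auto simp: card_Diff_singleton)
qed

text \<open>An open piece of the plane inside an arc would embed into the line, against invariance of dimension.\<close>

lemma interior_arc_empty:
  fixes \<alpha> :: "real \<Rightarrow> complex"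
  assumes "arc \<alpha>" shows "interior (path_image \<alpha>) = {}"
proof (rule ccontr)
  assume ne: "interior (path_image \<alpha>) \<noteq> {}"
  obtain h where h: "homeomorphism {0..1} (path_image \<alpha>) \<alpha> h" using homeomorphism_arc[OF assms] by blast
  have "inj_on h (path_image \<alpha>)" using h by (metis homeomorphism_def inj_on_inverseI)
  moreover have "continuous_on (path_image \<alpha>) h" using h homeomorphism_cont2 by blast
  ultimately have "DIM(complex) \<le> DIM(real)"
    using ne interior_subset
    by (intro invariance_of_dimension[of "interior (path_image \<alpha>)" h])
      (blast intro: continuous_on_subset inj_on_subset)+
  then show False by simp
qed

text \<open>A path in X between the ends completes the arc to a Jordan curve. A point of the open arc is on the frontier of
  both sides of the curve, so there are points of both sides in a small disc that avoids X.\<close>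

lemma closing_arc_separates:
  fixes X :: "complex set"
  assumes X: "compact X" and \<alpha>: "arc \<alpha>"
    and int: "path_image \<alpha> \<inter> X = {pathstart \<alpha>, pathfinish \<alpha>}"
    and con: "path_component X (pathstart \<alpha>) (pathfinish \<alpha>)"
  shows "\<exists>p q. p \<notin> X \<union> path_image \<alpha> \<and> q \<notin> X \<union> path_image \<alpha> \<and> connected_component (- X) p q \<and>
    \<not> connected_component (- (X \<union> path_image \<alpha>)) p q"
proof -
  let ?A = "path_image \<alpha>" and ?a = "pathstart \<alpha>" and ?b = "pathfinish \<alpha>"
  have ab: "?a \<noteq> ?b" using arc_distinct_ends[OF \<alpha>] by metis
  obtain g where "path g" "path_image g \<subseteq> X" "pathstart g = ?b" "pathfinish g = ?a"
    using path_component_sym[OF con] unfolding path_component_def by auto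
  then obtain \<beta> where \<beta>: "arc \<beta>" "path_image \<beta> \<subseteq> X" "pathstart \<beta> = ?b" "pathfinish \<beta> = ?a"
    using ab by (metis path_contains_arc order_trans)
  define J where "J = path_image (\<alpha> +++ \<beta>)"
  have J: "J = ?A \<union> path_image \<beta>" using \<beta> by (simp add: J_def path_image_join)
  have "simple_path (\<alpha> +++ \<beta>)"
  proof (rule simple_path_join_loop[OF \<alpha> \<beta>(1)])
    show "pathfinish \<alpha> = pathstart \<beta>" "pathfinish \<beta> = pathstart \<alpha>" using \<beta> by simp_all
    have "?A \<inter> path_image \<beta> \<subseteq> ?A \<inter> X" using \<beta>(2) by blast
    then show "?A \<inter> path_image \<beta> \<subseteq> {pathstart \<alpha>, pathstart \<beta>}" unfolding int \<beta>(3) .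
  qed
  moreover have "pathfinish (\<alpha> +++ \<beta>) = pathstart (\<alpha> +++ \<beta>)" using \<beta> by simp
  ultimately have jordan: "open (inside J)" "open (outside J)" "inside J \<union> outside J = - J"
      "frontier (inside J) = J" "frontier (outside J) = J" "inside J \<inter> outside J = {}"
    using Jordan_inside_outside[of "\<alpha> +++ \<beta>"] unfolding J_def by blast+
  obtain z where z: "z \<in> ?A" "z \<notin> X"
    using nonempty_simple_path_endless[OF arc_imp_simple_path[OF \<alpha>]] int by blast
  obtain e where e: "e > 0" "ball z e \<subseteq> - X"
    using X z by (metis ComplI compact_imp_closed open_Compl openE)
  have zJ: "z \<in> frontier (inside J)" "z \<in> frontier (outside J)" using z J jordan by auto
  obtain p where p: "p \<in> inside J" "p \<in> ball z e"
    using zJ(1) e(1) by (metis frontier_straddle dist_commute mem_ball)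
  obtain q where q: "q \<in> outside J" "q \<in> ball z e"
    using zJ(2) e(1) by (metis frontier_straddle dist_commute mem_ball)
  have "p \<in> - J" "q \<in> - J" using p(1) q(1) jordan(3) by blast+
  then have "p \<notin> X \<union> ?A" "q \<notin> X \<union> ?A" using p(2) q(2) e(2) J by blast+
  moreover have "connected_component (- X) p q"
    using p q e by (intro connected_componentI[of "ball z e"]) auto
  moreover have "\<not> connected_component (- (X \<union> ?A)) p q"
  proof
    assume "connected_component (- (X \<union> ?A)) p q"
    then have "connected_component (- J) p q"
      by (rule connected_component_of_subset) (use J \<beta> in auto)
    then show False using inside_same_component p q jordan by blast
  qed
  ultimately show ?thesis by blast
qed

text \<open>Each face of Y lies in a face of X, and every face of X is hit since Y has no interior. Two faces of Y inside
  one face of X make the inequality strict.\<close>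

lemma card_components_mono:
  fixes X :: "complex set"
  assumes fin: "finite (components (- Y))" and XY: "X \<subseteq> Y" and X: "closed X" and i: "interior Y = {}"
  shows "card (components (- X)) \<le> card (components (- Y))" "finite (components (- X))"
    "\<lbrakk>p \<notin> Y; q \<notin> Y; connected_component (- X) p q; \<not> connected_component (- Y) p q\<rbrakk>
      \<Longrightarrow> card (components (- X)) < card (components (- Y))"
proof -
  define \<pi> where "\<pi> = (\<lambda>C. connected_component_set (- X) (SOME x. x \<in> C))"
  have \<pi>: "\<pi> (connected_component_set (- Y) x) = connected_component_set (- X) x" if "x \<notin> Y" for x
  proof -
    have "x \<in> connected_component_set (- Y) x" using that by (simp add: connected_component_refl_eq)
    then have "connected_component (- Y) x (SOME u. u \<in> connected_component_set (- Y) x)"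
      by (metis mem_Collect_eq someI)
    then have "connected_component (- X) x (SOME u. u \<in> connected_component_set (- Y) x)"
      by (rule connected_component_of_subset) (use XY in auto)
    then show ?thesis unfolding \<pi>_def by (metis connected_component_eq mem_Collect_eq)
  qed
  have sub: "components (- X) \<subseteq> \<pi> ` components (- Y)"
  proof
    fix D assume D: "D \<in> components (- X)"
    have "open (- X)" using X by (rule open_Compl)
    then have "open D" using D by (rule open_components)
    have "D \<noteq> {}" using D by (rule in_components_nonempty)
    then obtain x where x: "x \<in> D" "x \<notin> Y" using i \<open>open D\<close> by (metis interior_maximal subsetI subset_empty)
    obtain y where y: "D = connected_component_set (- X) y" using D by (auto simp: components_iff)
    then have "x \<in> connected_component_set (- X) y" using x by simp
    then have "D = connected_component_set (- X) x" unfolding y by (rule connected_component_eq[symmetric])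
    then show "D \<in> \<pi> ` components (- Y)" using \<pi>[OF x(2)] x(2)
      by (metis ComplI components_iff image_eqI)
  qed
  show "card (components (- X)) \<le> card (components (- Y))" "finite (components (- X))"
    using surj_card_le[OF fin sub] finite_surj[OF fin sub] by simp_all
  assume pq: "p \<notin> Y" "q \<notin> Y" "connected_component (- X) p q" "\<not> connected_component (- Y) p q"
  let ?P = "connected_component_set (- Y) p" and ?Q = "connected_component_set (- Y) q"
  have PQ: "?P \<in> components (- Y)" "?Q \<in> components (- Y)" using pq by (auto simp: components_iff)
  have "?P \<noteq> ?Q" using pq by (metis ComplI connected_component_refl mem_Collect_eq)
  moreover have "\<pi> ?P = \<pi> ?Q" using \<pi> pq connected_component_eq by (metis mem_Collect_eq)
  ultimately have "\<not> inj_on \<pi> (components (- Y))" using PQ by (meson inj_onD)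
  then have "card (\<pi> ` components (- Y)) < card (components (- Y))"
    using fin by (metis card_image_le eq_card_imp_inj_on order_le_less)
  moreover have "card (components (- X)) \<le> card (\<pi> ` components (- Y))"
    using sub fin by (intro card_mono) auto
  ultimately show "card (components (- X)) < card (components (- Y))" by linarith
qed

lemma face_reps_of_components:
  assumes "finite \<C>" "\<C> \<subseteq> components (- X)"
  shows "\<exists>P. face_reps X P \<and> card P = card \<C>"
proof -
  define P where "P = (\<lambda>C. SOME x. x \<in> C) ` \<C>"
  have in_: "(SOME x. x \<in> C) \<in> C" if "C \<in> \<C>" for C
    using assms that in_components_nonempty by (metis some_in_eq subsetD)
  have uniq: "C = D" if "C \<in> \<C>" "D \<in> \<C>" "x \<in> C" "y \<in> D" "connected_component (- X) x y" for C D x y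
  proof -
    have "C = connected_component_set (- X) x" "D = connected_component_set (- X) y"
      using that assms by (metis components_iff connected_component_eq subsetD)+
    then show ?thesis using that(5) connected_component_eq by (metis mem_Collect_eq)
  qed
  have "inj_on (\<lambda>C. SOME x. x \<in> C) \<C>"
  proof (rule inj_onI)
    fix C D assume *: "C \<in> \<C>" "D \<in> \<C>" "(SOME x. x \<in> C) = (SOME x. x \<in> D)"
    then have "connected_component (- X) (SOME x. x \<in> C) (SOME x. x \<in> D)"
      using in_ assms in_components_subset by (metis connected_component_refl subsetD)
    then show "C = D" using uniq in_ * by blast
  qed
  then have "card P = card \<C>" by (simp add: P_def card_image)
  moreover have "face_reps X P"
    unfolding face_reps_def
  proof (intro conjI ballI impI notI)
    show "finite P" using assms by (simp add: P_def)
    show "P \<inter> X = {}" using in_ assms in_components_subset unfolding P_def by fastforce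
    fix p q assume "p \<in> P" "q \<in> P" "p \<noteq> q" "connected_component (- X) p q"
    then show False using uniq in_ unfolding P_def by blast
  qed
  ultimately show ?thesis by blast
qed

lemma card_image_coarser:
  assumes "finite V" and c: "\<And>u v. u \<in> V \<Longrightarrow> v \<in> V \<Longrightarrow> g u = g v \<Longrightarrow> f u = f v"
  shows "card (f ` V) \<le> card (g ` V)"
    "\<lbrakk>a \<in> V; b \<in> V; f a = f b; g a \<noteq> g b\<rbrakk> \<Longrightarrow> card (f ` V) < card (g ` V)"
proof -
  define h where "h = (\<lambda>K. f (SOME v. v \<in> V \<and> g v = K))"
  have h: "h (g v) = f v" if "v \<in> V" for v
  proof -
    have "(SOME u. u \<in> V \<and> g u = g v) \<in> V \<and> g (SOME u. u \<in> V \<and> g u = g v) = g v"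
      by (rule someI[of _ v]) (use that in simp)
    then show ?thesis unfolding h_def using c that by blast
  qed
  then have eq: "f ` V = h ` (g ` V)" by (auto simp: image_image)
  show "card (f ` V) \<le> card (g ` V)" unfolding eq using assms(1) by (intro card_image_le) simp
  assume ab: "a \<in> V" "b \<in> V" "f a = f b" "g a \<noteq> g b"
  then have "h (g a) = h (g b)" using h by simp
  then have "\<not> inj_on h (g ` V)" using ab by (meson imageI inj_onD)
  then have "card (h ` (g ` V)) \<noteq> card (g ` V)" using assms(1) eq_card_imp_inj_on by blast
  then show "card (f ` V) < card (g ` V)" unfolding eq
    using assms(1) card_image_le[of "g ` V" h] by simp
qed

lemma face_reps_connected:
  assumes "connected (- X)" "face_reps X P" shows "card P \<le> 1"
proof -
  have "p = q" if "p \<in> P" "q \<in> P" for p q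
  proof (rule ccontr)
    assume "p \<noteq> q"
    then have "\<not> connected_component (- X) p q" using assms(2) that by (auto simp: face_reps_def)
    moreover have "p \<in> - X" "q \<in> - X" using assms(2) that by (auto simp: face_reps_def)
    ultimately show False using connected_componentI[OF assms(1) subset_refl] by blast
  qed
  moreover have "finite P" using assms(2) by (simp add: face_reps_def)
  ultimately show ?thesis by (metis card_le_Suc0_iff_eq One_nat_def)
qed

text \<open>The punctured disc is connected, meets F and misses the frontier of F.\<close>

lemma punctured_ball_subset:
  fixes F :: "complex set"
  assumes "open F" "z \<in> closure F" "e > 0" and fr: "frontier F \<inter> ball z e \<subseteq> {z}"
  shows "ball z e - {z} \<subseteq> F"
proof -
  let ?B = "ball z e - {z}"
  have con: "connected ?B" by (rule connected_punctured_ball) simp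
  have "F \<inter> ball z e \<noteq> {}" using assms(2,3) by (metis centre_in_ball closure_iff_nhds_not_empty disjoint_iff open_ball subset_refl)
  then have "open (F \<inter> ball z e)" "F \<inter> ball z e \<noteq> {}" using assms(1) by auto
  then have "\<not> F \<inter> ball z e \<subseteq> {z}" by (metis finite.emptyI finite_insert finite_subset not_open_singleton subset_singletonD)
  then have "?B \<inter> F \<noteq> {}" by blast
  moreover have "?B \<inter> frontier F = {}" using fr by blast
  ultimately show ?thesis using connected_Int_frontier[OF con, of F] by blast
qed

section \<open>Plane graphs and Euler's formula\<close>

locale plane_graph =
  fixes V :: "'a set" and E :: "'a set set" and p :: "'a \<Rightarrow> complex"
    and \<gamma> :: "'a set \<Rightarrow> real \<Rightarrow> complex"
  assumes finite_V: "finite V" and E_sub: "E \<subseteq> {e. e \<subseteq> V \<and> card e = 2}"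
    and drawing: "planar_drawing (V, E) p \<gamma>"
begin

definition arcs :: "'a set set \<Rightarrow> complex set" where "arcs D = (\<Union>e\<in>D. path_image (\<gamma> e))"
text \<open>Subgraphs are given by their edge sets D; the points of all vertices of V stay in the drawing, which makes
  adding an edge the same as adding an arc with both ends in the drawing.\<close>

definition drawn :: "'a set set \<Rightarrow> complex set" where "drawn D = p ` V \<union> arcs D"

lemma finite_E: "finite E"
  using E_sub finite_V by (metis (no_types, lifting) Collect_mono finite_Collect_subsets finite_subset subset_trans)

lemma finite_sub_E: "D \<subseteq> E \<Longrightarrow> finite D"
  using finite_E finite_subset by blast

lemma inj_p: "inj_on p V" using drawing by (simp add: planar_drawing_def)

lemma edge_arc: "e \<in> E \<Longrightarrow> arc (\<gamma> e)"
  and edge_ends: "e \<in> E \<Longrightarrow> {pathstart (\<gamma> e), pathfinish (\<gamma> e)} = p ` e"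
  and edge_verts: "e \<in> E \<Longrightarrow> path_image (\<gamma> e) \<inter> p ` V = p ` e"
  and edge_edge: "e \<in> E \<Longrightarrow> f \<in> E \<Longrightarrow> e \<noteq> f \<Longrightarrow> path_image (\<gamma> e) \<inter> path_image (\<gamma> f) = p ` (e \<inter> f)"
  using drawing by (simp_all add: planar_drawing_def)

lemma edge_sub: "e \<in> E \<Longrightarrow> e \<subseteq> V" and edge_card: "e \<in> E \<Longrightarrow> card e = 2"
  using E_sub by auto

lemma p_in_arc_iff: "e \<in> E \<Longrightarrow> v \<in> V \<Longrightarrow> p v \<in> path_image (\<gamma> e) \<longleftrightarrow> v \<in> e"
proof -
  assume e: "e \<in> E" and v: "v \<in> V"
  have "p v \<in> path_image (\<gamma> e) \<longleftrightarrow> p v \<in> path_image (\<gamma> e) \<inter> p ` V" using v by blast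
  also have "\<dots> \<longleftrightarrow> v \<in> e"
    unfolding edge_verts[OF e] using inj_on_image_mem_iff[OF inj_p v edge_sub[OF e]] .
  finally show ?thesis .
qed

lemma compact_arcs: "D \<subseteq> E \<Longrightarrow> compact (arcs D)"
  unfolding arcs_def using finite_sub_E edge_arc compact_arc_image by (intro compact_UN) blast+

lemma compact_drawn: "D \<subseteq> E \<Longrightarrow> compact (drawn D)"
  unfolding drawn_def using compact_arcs[of D] finite_V finite_imp_compact[of "p ` V"] by (intro compact_Un) simp_all

lemma drawn_insert: "drawn (insert e D) = drawn D \<union> path_image (\<gamma> e)"
  by (auto simp: drawn_def arcs_def)

lemma drawn_mono: "D \<subseteq> D' \<Longrightarrow> drawn D \<subseteq> drawn D'"
  by (auto simp: drawn_def arcs_def)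

lemma arc_Int_arcs:
  assumes "e \<in> E" "D \<subseteq> E" "e \<notin> D" shows "path_image (\<gamma> e) \<inter> arcs D = p ` (e \<inter> \<Union>D)"
proof -
  have "path_image (\<gamma> e) \<inter> path_image (\<gamma> f) = p ` (e \<inter> f)" if "f \<in> D" for f
    using edge_edge[of e f] assms that by blast
  then have "(\<Union>f\<in>D. path_image (\<gamma> e) \<inter> path_image (\<gamma> f)) = (\<Union>f\<in>D. p ` (e \<inter> f))" by simp
  then show ?thesis unfolding arcs_def by blast
qed

lemma arc_Int_drawn:
  assumes "e \<in> E" "D \<subseteq> E" "e \<notin> D" shows "path_image (\<gamma> e) \<inter> drawn D = p ` e"
proof -
  have "path_image (\<gamma> e) \<inter> drawn D = p ` e \<union> p ` (e \<inter> \<Union>D)"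
    unfolding drawn_def Int_Un_distrib arc_Int_arcs[OF assms] edge_verts[OF assms(1)] ..
  then show ?thesis by blast
qed

lemma arc_Int_drawn_ends:
  assumes "e \<in> E" "D \<subseteq> E" "e \<notin> D"
  shows "path_image (\<gamma> e) \<inter> drawn D = {pathstart (\<gamma> e), pathfinish (\<gamma> e)}"
  using arc_Int_drawn[OF assms] edge_ends[OF assms(1)] by simp

lemma open_arc_nonempty: "e \<in> E \<Longrightarrow> path_image (\<gamma> e) - p ` e \<noteq> {}"
  using nonempty_simple_path_endless[OF arc_imp_simple_path[OF edge_arc]] edge_ends by metis

lemma connected_Compl_vertices: "connected (- (p ` V))"
  by (rule connected_open_diff_countable[of UNIV, simplified Compl_eq_Diff_UNIV[symmetric]])
    (auto simp: finite_V countable_finite)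

text \<open>Only interior points of the arc count, since a face may reach the end of an edge without running along it.\<close>

definition touches :: "complex set \<Rightarrow> 'a set \<Rightarrow> bool" where
  "touches F e \<longleftrightarrow> closure F \<inter> (path_image (\<gamma> e) - p ` e) \<noteq> {}"

lemma components_eq_if_connected:
  "F \<in> components S \<Longrightarrow> G \<in> components S \<Longrightarrow> x \<in> F \<Longrightarrow> y \<in> G \<Longrightarrow> connected_component S x y \<Longrightarrow> F = G"
  by (metis components_iff connected_component_eq mem_Collect_eq)

text \<open>Without the edge, all faces that touch it are parts of the one face that contains the open arc.\<close>

lemma edge_touches_at_most_two_faces:
  assumes D: "D \<subseteq> E" "e \<in> D"
    and F: "F1 \<in> components (- drawn D)" "F2 \<in> components (- drawn D)" "F3 \<in> components (- drawn D)"
    and t: "touches F1 e" "touches F2 e" "touches F3 e"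
  shows "F1 = F2 \<or> F2 = F3 \<or> F1 = F3"
proof -
  let ?X = "drawn (D - {e})" and ?A = "path_image (\<gamma> e)"
  have e: "e \<in> E" "D - {e} \<subseteq> E" "e \<notin> D - {e}" using D by auto
  have X: "compact ?X" using compact_drawn e by blast
  have XA: "drawn D = ?X \<union> ?A" using drawn_insert[of e "D - {e}"] D by (simp add: insert_absorb)
  have int: "?A \<inter> ?X = {pathstart (\<gamma> e), pathfinish (\<gamma> e)}" using arc_Int_drawn_ends[OF e] .
  have near: "\<exists>x z. x \<in> F \<and> x \<notin> drawn D \<and> z \<in> ?A - ?X \<and> connected_component (- ?X) x z"
    if F: "F \<in> components (- drawn D)" "touches F e" for F
  proof -
    obtain z where z: "z \<in> closure F" "z \<in> ?A" "z \<notin> p ` e" using F by (auto simp: touches_def)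
    then have "z \<notin> ?X" using arc_Int_drawn[OF e] by blast
    then obtain r where r: "r > 0" "ball z r \<subseteq> - ?X"
      using X by (metis ComplI compact_imp_closed open_Compl openE)
    obtain x where x: "x \<in> F" "x \<in> ball z r"
      using z(1) r(1) by (metis closure_approachable dist_commute mem_ball)
    have "connected_component (- ?X) x z"
      using x r by (intro connected_componentI[of "ball z r"]) auto
    moreover have "x \<notin> drawn D" using x F in_components_subset by blast
    ultimately show ?thesis using x z \<open>z \<notin> ?X\<close> by blast
  qed
  obtain x1 z1 where 1: "x1 \<in> F1" "x1 \<notin> drawn D" "z1 \<in> ?A - ?X" "connected_component (- ?X) x1 z1"
    using near F t by blast
  obtain x2 z2 where 2: "x2 \<in> F2" "x2 \<notin> drawn D" "z2 \<in> ?A - ?X" "connected_component (- ?X) x2 z2"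
    using near F t by blast
  obtain x3 z3 where 3: "x3 \<in> F3" "x3 \<notin> drawn D" "z3 \<in> ?A - ?X" "connected_component (- ?X) x3 z3"
    using near F t by blast
  note zz = open_arc_connected_in_complement[OF edge_arc[OF e(1)] int]
  have c: "connected_component (- ?X) x1 x2" "connected_component (- ?X) x2 x3"
    using 1 2 3 zz[OF 1(3) 2(3)] zz[OF 2(3) 3(3)]
    by (meson connected_component_sym connected_component_trans)+
  have "connected_component (- drawn D) x1 x2 \<or> connected_component (- drawn D) x2 x3 \<or> connected_component (- drawn D) x1 x3"
    unfolding XA
    by (rule arc_splits_face_in_at_most_two[OF X edge_arc[OF e(1)] int _ _ _ c]) (use 1 2 3 XA in auto)
  then show ?thesis using components_eq_if_connected 1(1) 2(1) 3(1) F by metis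
qed

lemma face_reps_remove_edges:
  assumes "face_reps (drawn D) P" "D \<subseteq> E" "D' \<subseteq> D"
  shows "\<exists>P'. face_reps (drawn D') P' \<and> card P \<le> card P' + card (D - D')"
proof -
  have "finite (D - D')" using assms finite_sub_E by blast
  moreover have "\<exists>P'. face_reps (drawn D') P' \<and> card P \<le> card P' + card S"
    if "finite S" "face_reps (drawn (D' \<union> S)) P" "S \<subseteq> E" "S \<inter> D' = {}" for S P
    using that
  proof (induction S arbitrary: P rule: finite_induct)
    case empty then show ?case by auto
  next
    case (insert e S)
    have e: "e \<in> E" "D' \<union> S \<subseteq> E" "e \<notin> D' \<union> S" using insert assms by auto
    have "face_reps (drawn (D' \<union> S) \<union> path_image (\<gamma> e)) P"
      using insert.prems(1) by (simp add: drawn_insert)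
    then obtain Q where Q: "face_reps (drawn (D' \<union> S)) Q" "card P \<le> card Q + 1"
      using face_reps_remove_arc[OF compact_drawn[OF e(2)] edge_arc[OF e(1)] arc_Int_drawn_ends[OF e]] by blast
    then obtain P' where "face_reps (drawn D') P'" "card Q \<le> card P' + card S"
      using insert by blast
    then show ?case using Q insert by (intro exI[of _ P']) auto
  qed
  ultimately show ?thesis using assms by (metis Diff_disjoint Diff_partition Int_commute Diff_subset subset_trans)
qed

lemma finite_faces:
  assumes "D \<subseteq> E" shows "finite (components (- drawn D))"
proof (rule finite_if_finite_subsets_card_bdd[of _ "1 + card D", THEN conjunct1])
  fix \<C> assume \<C>: "\<C> \<subseteq> components (- drawn D)" "finite \<C>"
  obtain P where P: "face_reps (drawn D) P" "card P = card \<C>" using face_reps_of_components \<C> by blast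
  obtain P' where P': "face_reps (drawn {}) P'" "card P \<le> card P' + card D"
    using face_reps_remove_edges[OF P(1) assms, of "{}"] by auto
  have "drawn {} = p ` V" by (simp add: drawn_def arcs_def)
  then have "card P' \<le> 1" using face_reps_connected connected_Compl_vertices P' by metis
  then show "card \<C> \<le> 1 + card D" using P P' \<C> by linarith
qed

lemma interior_drawn_empty: "D \<subseteq> E \<Longrightarrow> interior (drawn D) = {}"
proof -
  assume D: "D \<subseteq> E"
  have "finite D" using D finite_sub_E by blast
  then show ?thesis using D
  proof (induction D rule: finite_induct)
    case empty
    then show ?case by (simp add: drawn_def arcs_def finite_V empty_interior_finite)
  next
    case (insert e D)
    then show ?case
      using interior_arc_empty[OF edge_arc, of e] compact_drawn[of D]
      by (simp add: drawn_insert interior_closed_Un_empty_interior compact_imp_closed)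
  qed
qed

text \<open>Induction on the number of edges, with the number c of path components of the drawing as a third quantity. An
  edge between two components lowers c; an edge inside a component closes a curve and so creates a face. In the
  end only the fact that c is positive is used.\<close>

lemma euler_lower:
  assumes "D \<subseteq> E" "V \<noteq> {}"
  shows "card D + 2 \<le> card (components (- drawn D)) + card V"
proof -
  define c where "c = (\<lambda>D. card ((\<lambda>v. path_component_set (drawn D) (p v)) ` V))"
  have "finite D" using assms finite_sub_E by blast
  then have "1 + card D + c D \<le> card (components (- drawn D)) + card V" using assms(1)
  proof (induction D rule: finite_induct)
    case empty
    have "drawn {} = p ` V" by (simp add: drawn_def arcs_def)
    moreover have "- (p ` V) \<noteq> {}" using finite_V by (metis Compl_UNIV_eq double_compl finite_imageI infinite_UNIV_char_0)
    ultimately have "components (- drawn {}) = {- (p ` V)}"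
      using connected_Compl_vertices by (simp add: components_eq_sing_iff)
    moreover have "c {} \<le> card V" unfolding c_def using finite_V card_image_le by blast
    ultimately show ?case by simp
  next
    case (insert e D)
    have e: "e \<in> E" "D \<subseteq> E" "e \<notin> D" using insert by auto
    let ?f = "\<lambda>D. card (components (- drawn D))"
    let ?a = "pathstart (\<gamma> e)" and ?b = "pathfinish (\<gamma> e)"
    have dr: "drawn (insert e D) = drawn D \<union> path_image (\<gamma> e)" by (rule drawn_insert)
    have fin: "finite (components (- drawn (insert e D)))" using finite_faces insert by blast
    have int: "interior (drawn (insert e D)) = {}" using interior_drawn_empty insert by blast
    have sub: "drawn D \<subseteq> drawn (insert e D)" by (simp add: dr)
    have cl: "closed (drawn D)" using compact_drawn e compact_imp_closed by blast
    note f = card_components_mono[OF fin sub cl int]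
    have coarse: "path_component_set (drawn (insert e D)) (p u) = path_component_set (drawn (insert e D)) (p v)"
      if "u \<in> V" "v \<in> V" "path_component_set (drawn D) (p u) = path_component_set (drawn D) (p v)" for u v
    proof -
      have "p v \<in> drawn D" using that by (simp add: drawn_def)
      then have "path_component (drawn D) (p u) (p v)" using that(3) by (metis mem_Collect_eq path_component_refl)
      then have "path_component (drawn (insert e D)) (p u) (p v)" using sub path_component_of_subset by blast
      then show ?thesis by (simp add: path_component_eq)
    qed
    have "?a \<in> p ` e" "?b \<in> p ` e" using edge_ends[OF e(1)] by blast+
    then obtain u v where uv: "u \<in> V" "v \<in> V" "?a = p u" "?b = p v"
      using edge_sub[OF e(1)] by blast
    show ?case
    proof (cases "path_component (drawn D) ?a ?b")
      case True
      have "?f D < ?f (insert e D)"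
        using closing_arc_separates[OF compact_drawn[OF e(2)] edge_arc[OF e(1)] arc_Int_drawn_ends[OF e] True] f(3)
        unfolding dr by blast
      moreover have "c (insert e D) \<le> c D" unfolding c_def using card_image_coarser(1)[OF finite_V coarse] .
      ultimately show ?thesis using insert by simp
    next
      case False
      have ne: "path_component_set (drawn D) (p u) \<noteq> path_component_set (drawn D) (p v)"
      proof
        assume "path_component_set (drawn D) (p u) = path_component_set (drawn D) (p v)"
        moreover have "p v \<in> drawn D" using uv by (simp add: drawn_def)
        ultimately have "path_component (drawn D) (p u) (p v)" by (metis mem_Collect_eq path_component_refl)
        then show False using False uv by simp
      qed
      have "path_component (drawn (insert e D)) ?a ?b"
        unfolding path_component_def using edge_arc[OF e(1)] arc_imp_path by (intro exI[of _ "\<gamma> e"]) (auto simp: dr)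
      then have eq: "path_component_set (drawn (insert e D)) (p u) = path_component_set (drawn (insert e D)) (p v)"
        using uv by (simp add: path_component_eq)
      have "c (insert e D) < c D" unfolding c_def
        using card_image_coarser(2)[where g = "\<lambda>v. path_component_set (drawn D) (p v)"
          and f = "\<lambda>v. path_component_set (drawn (insert e D)) (p v)", OF finite_V coarse uv(1,2) eq ne] .
      then show ?thesis using insert f(1) by simp
    qed
  qed
  moreover have "c D \<ge> 1" unfolding c_def using assms finite_V by (simp add: Suc_le_eq card_gt_0_iff)
  ultimately show ?thesis by linarith
qed

text \<open>By Janiszewski's theorem two compact sets that do not separate the plane have a union that does not separate it
  either, provided that they meet in a connected set; here they meet in at most one point. So forests do not
  separate the plane.\<close>

lemma connected_Compl_arcs_insert:
  assumes "e \<in> E" "D \<subseteq> E" "e \<notin> D" "card (e \<inter> \<Union>D) \<le> 1" "connected (- arcs D)"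
  shows "connected (- arcs (insert e D))"
proof -
  have "finite (e \<inter> \<Union>D)" using edge_sub[OF assms(1)] finite_V by (meson finite_Int finite_subset)
  then have "e \<inter> \<Union>D = {} \<or> (\<exists>x. e \<inter> \<Union>D = {x})"
    using assms(4) by (metis One_nat_def card_0_eq card_1_singletonE le_Suc_eq le_zero_eq)
  then have "connected (arcs D \<inter> path_image (\<gamma> e))"
    using arc_Int_arcs[OF assms(1-3)] by (metis Int_commute connected_empty connected_sing image_empty image_insert)
  then have "connected (- (arcs D \<union> path_image (\<gamma> e)))"
    using assms(5) connected_arc_complement[OF edge_arc[OF assms(1)]]
      compact_imp_closed[OF compact_arc_image[OF edge_arc[OF assms(1)]]]
    by (intro Janiszewski_connected compact_arcs assms) auto
  moreover have "arcs (insert e D) = arcs D \<union> path_image (\<gamma> e)" by (auto simp: arcs_def)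
  ultimately show ?thesis by simp
qed

lemma connected_Compl_arcs_empty: "connected (- arcs {})"
  by (simp add: arcs_def convex_connected)

lemma distinct_edges_Int: "e \<in> E \<Longrightarrow> f \<in> E \<Longrightarrow> e \<noteq> f \<Longrightarrow> card (e \<inter> f) \<le> 1"
proof (rule ccontr)
  assume a: "e \<in> E" "f \<in> E" "e \<noteq> f" "\<not> card (e \<inter> f) \<le> 1"
  have fin: "finite e" "finite f" using a edge_card by (metis card.infinite zero_neq_numeral)+
  have "card (e \<inter> f) = 2" using a edge_card[of e] card_mono[OF fin(1), of "e \<inter> f"] by simp
  then have "e \<inter> f = e" "e \<inter> f = f" using a edge_card fin
    by (metis Int_lower1 card_subset_eq, metis Int_lower2 card_subset_eq a(2) edge_card)
  then show False using a by simp
qed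

lemma connected_Compl_arcs_le2:
  assumes "D \<subseteq> E" "card D \<le> 2" shows "connected (- arcs D)"
proof -
  consider "D = {}" | e where "D = {e}" | e f where "D = {e, f}" "e \<noteq> f"
  proof -
    have "finite D" using finite_sub_E assms by blast
    then show ?thesis using that assms(2)
      by (metis card_0_eq card_1_singletonE card_2_iff le_Suc_eq le_zero_eq numeral_2_eq_2 One_nat_def)
  qed
  then show ?thesis
  proof cases
    case 1 then show ?thesis using connected_Compl_arcs_empty by simp
  next
    case 2 then show ?thesis using connected_Compl_arcs_insert[of e "{}"] connected_Compl_arcs_empty assms by simp
  next
    case 3
    then have "connected (- arcs {f})"
      using connected_Compl_arcs_insert[of f "{}"] connected_Compl_arcs_empty assms by simp
    then show ?thesis using connected_Compl_arcs_insert[of e "{f}"] distinct_edges_Int[of e f] assms 3 by simp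
  qed
qed

text \<open>If three edges separate the plane, none of them can be added last to the other two as in the previous lemmas. So
  both ends of each edge are covered by the other two.\<close>

lemma connected_Compl_arcs_3_or_triangle:
  assumes "D \<subseteq> E" "card D = 3" "\<not> connected (- arcs D)"
  obtains x y z where "x \<noteq> y" "y \<noteq> z" "x \<noteq> z" "D = {{x, y}, {y, z}, {x, z}}"
proof -
  have fin: "finite D" using finite_sub_E assms by blast
  have cov: "e \<subseteq> \<Union>(D - {e})" if e: "e \<in> D" for e
  proof (rule ccontr)
    assume ns: "\<not> ?thesis"
    have "card (D - {e}) \<le> 2" using e assms fin by simp
    then have c: "connected (- arcs (D - {e}))" using connected_Compl_arcs_le2 assms by blast
    have "card e = 2" "finite e" using e assms edge_card by (auto, metis card.infinite edge_card subsetD zero_neq_numeral)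
    moreover have "e \<inter> \<Union>(D - {e}) \<subset> e" using ns by blast
    ultimately have "card (e \<inter> \<Union>(D - {e})) < 2" by (metis psubset_card_mono)
    then have "card (e \<inter> \<Union>(D - {e})) \<le> 1" by simp
    then have "connected (- arcs (insert e (D - {e})))"
      using connected_Compl_arcs_insert[of e "D - {e}"] c e assms by blast
    then show False using assms(3) e by (simp add: insert_absorb)
  qed
  obtain e f g where D: "D = {e, f, g}" "e \<noteq> f" "f \<noteq> g" "e \<noteq> g" using assms(2) card_3_iff by metis
  have c2: "card e = 2" "card f = 2" "card g = 2" using D assms edge_card by auto
  have "e \<subseteq> f \<union> g" "f \<subseteq> e \<union> g" "g \<subseteq> e \<union> f" 
  proof -
    have "D - {e} = {f, g}" "D - {f} = {e, g}" "D - {g} = {e, f}" using D by auto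
    then have "\<Union>(D - {e}) = f \<union> g" "\<Union>(D - {f}) = e \<union> g" "\<Union>(D - {g}) = e \<union> f" by simp_all
    then show "e \<subseteq> f \<union> g" "f \<subseteq> e \<union> g" "g \<subseteq> e \<union> f"
      using cov[of e] cov[of f] cov[of g] D(1) by simp_all
  qed
  note cover = this
  have two: "s = {a, b}" if "card s = 2" "a \<in> s" "b \<in> s" "a \<noteq> b" for s :: "'a set" and a b
  proof -
    have "finite s" using that(1) by (metis card.infinite zero_neq_numeral)
    then show ?thesis using card_subset_eq[of s "{a, b}"] that by simp
  qed
  obtain x y where xy: "e = {x, y}" "x \<noteq> y" using c2(1) card_2_iff by metis
  have "\<exists>x y z. x \<noteq> y \<and> y \<noteq> z \<and> x \<noteq> z \<and> D = {{x, y}, {y, z}, {x, z}}"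
    if h: "e = {x, y}" "x \<noteq> y" "x \<in> f" for x y
  proof -
    have "y \<notin> f" using two[OF c2(2) h(3)] h D(2) by blast
    then have "y \<in> g" using cover(1) h by blast
    then have "x \<notin> g" using two[OF c2(3), of x y] h D(4) by blast
    obtain w where w: "f = {x, w}" "x \<noteq> w" using c2(2) h(3) by (metis card_2_iff insertE insert_commute singletonD)
    have wy: "w \<noteq> y" using w \<open>y \<notin> f\<close> by blast
    then have "w \<in> g" using cover(2) w h by blast
    then have "g = {y, w}" using two[OF c2(3) \<open>y \<in> g\<close>] wy by blast
    then have "D = {{x, y}, {y, w}, {x, w}}" using D(1) h w by blast
    then show ?thesis using h w wy by blast
  qed
  note case_x = this
  have "x \<in> f \<or> y \<in> f" using cover(1) two[OF c2(3), of x y] xy D(4) by blast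
  then have "\<exists>x y z. x \<noteq> y \<and> y \<noteq> z \<and> x \<noteq> z \<and> D = {{x, y}, {y, z}, {x, z}}"
  proof
    assume "x \<in> f" show ?thesis using case_x[OF xy \<open>x \<in> f\<close>] .
  next
    have "e = {y, x}" using xy(1) by (simp add: insert_commute)
    moreover assume "y \<in> f"
    ultimately show ?thesis using case_x[of y x] xy(2) by simp
  qed
  then show ?thesis using that by blast
qed

end

section \<open>Facial triangles\<close>

definition pairs_in :: "'a set \<Rightarrow> 'a set set" where
  "pairs_in t = {e. e \<subseteq> t \<and> card e = 2}"

lemma pairs_in_triple:
  assumes "x \<noteq> y" "y \<noteq> z" "x \<noteq> z"
  shows "pairs_in {x, y, z} = {{x, y}, {y, z}, {x, z}}"
proof
  show "pairs_in {x, y, z} \<subseteq> {{x, y}, {y, z}, {x, z}}"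
  proof
    fix e assume "e \<in> pairs_in {x, y, z}"
    then obtain a b where e: "e = {a, b}" "a \<noteq> b" "a \<in> {x, y, z}" "b \<in> {x, y, z}"
      unfolding pairs_in_def by (auto simp: card_2_iff)
    show "e \<in> {{x, y}, {y, z}, {x, z}}" using e by (elim insertE) (simp_all add: insert_commute)
  qed
  show "{{x, y}, {y, z}, {x, z}} \<subseteq> pairs_in {x, y, z}" using assms by (simp add: pairs_in_def)
qed

context plane_graph
begin

lemma end_islimpt_open_arc:
  assumes "e \<in> E" "v \<in> e" shows "p v islimpt (path_image (\<gamma> e) - p ` e)"
proof -
  let ?A = "path_image (\<gamma> e)"
  have con: "connected ?A" using edge_arc[OF assms(1)] by (simp add: arc_imp_path connected_path_image)
  have pv: "p v \<in> ?A" using edge_verts[OF assms(1)] assms(2) by blast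
  have fin: "finite (p ` e)" using edge_sub[OF assms(1)] finite_V finite_subset by blast
  have "?A \<noteq> {x}" for x
    using arc_distinct_ends[OF edge_arc[OF assms(1)]] pathstart_in_path_image[of "\<gamma> e"] pathfinish_in_path_image[of "\<gamma> e"]
    by auto
  then have "p v islimpt ?A" using connected_imp_perfect[OF con pv] by blast
  moreover have "?A \<subseteq> (?A - p ` e) \<union> p ` e" by blast
  ultimately have "p v islimpt ((?A - p ` e) \<union> p ` e)" by (rule islimpt_subset)
  then show ?thesis using islimpt_finite[OF fin] unfolding islimpt_Un by blast
qed

lemma face_open: "D \<subseteq> E \<Longrightarrow> F \<in> components (- drawn D) \<Longrightarrow> open F"
  by (rule open_components[OF open_Compl[OF compact_imp_closed[OF compact_drawn]]])

lemma face_disjoint: "F \<in> components (- drawn D) \<Longrightarrow> F \<inter> drawn D = {}"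
  using in_components_subset by blast

lemma face_frontier: "D \<subseteq> E \<Longrightarrow> F \<in> components (- drawn D) \<Longrightarrow> frontier F \<subseteq> drawn D"
  using frontier_of_components_subset[of F "- drawn D"]
    frontier_subset_closed[OF compact_imp_closed[OF compact_drawn]] by (metis frontier_complement order_trans)

lemma frontier_subset_closure: "frontier F \<subseteq> closure F"
  by (simp add: frontier_def)

lemma connected_subset_face:
  assumes "open F" "connected S" "S \<inter> F \<noteq> {}" "S \<inter> frontier F = {}"
  shows "S \<subseteq> F"
  using connected_Int_frontier[OF assms(2,3)] assms(4) by blast

lemma on_frontier_touches:
  assumes "e \<in> D" "z \<in> frontier F" "z \<in> path_image (\<gamma> e)" "z \<notin> p ` e" shows "touches F e"
  using assms frontier_subset_closure unfolding touches_def by blast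

text \<open>Otherwise a punctured disc around the vertex belongs to F, but it contains points of the edge e.\<close>

lemma frontier_at_vertex:
  assumes D: "D \<subseteq> E" and F: "F \<in> components (- drawn D)" and v: "v \<in> V" "p v \<in> closure F"
    and e: "e \<in> D" "v \<in> e"
  shows "\<exists>f\<in>D. v \<in> f \<and> touches F f"
proof (rule ccontr)
  assume no: "\<not> ?thesis"
  let ?K = "p ` (V - {v}) \<union> arcs {f \<in> D. v \<notin> f}"
  have cK: "compact ?K" using D finite_V by (intro compact_Un finite_imp_compact compact_arcs) auto
  have "p v \<notin> ?K"
  proof
    assume "p v \<in> ?K"
    then consider w where "w \<in> V" "w \<noteq> v" "p v = p w" | f where "f \<in> D" "v \<notin> f" "p v \<in> path_image (\<gamma> f)"
      unfolding arcs_def by blast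
    then show False
    proof cases
      case 1 then show False using inj_p v(1) by (metis inj_onD)
    next
      case 2 then show False using p_in_arc_iff[of f v] v(1) D by blast
    qed
  qed
  moreover from cK have "open (- ?K)" by (intro open_Compl compact_imp_closed)
  ultimately have "open (- ?K)" "p v \<in> - ?K" by blast+
  then obtain r where r: "r > 0" "ball (p v) r \<subseteq> - ?K" by (rule openE)
  have "frontier F \<inter> ball (p v) r \<subseteq> {p v}"
  proof
    fix z assume z: "z \<in> frontier F \<inter> ball (p v) r"
    then have "z \<in> drawn D" "z \<notin> ?K" using face_frontier[OF D F] r by blast+
    show "z \<in> {p v}"
    proof (rule ccontr)
      assume zv: "z \<notin> {p v}"
      then have "z \<notin> p ` V" using \<open>z \<notin> ?K\<close> by blast
      then obtain f where f: "f \<in> D" "z \<in> path_image (\<gamma> f)" using \<open>z \<in> drawn D\<close> unfolding drawn_def arcs_def by blast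
      then have "v \<in> f" using \<open>z \<notin> ?K\<close> unfolding arcs_def by blast
      moreover have "z \<notin> p ` f" using \<open>z \<notin> p ` V\<close> edge_sub[of f] f D by blast
      then have "touches F f" using on_frontier_touches f z by blast
      ultimately show False using no f by blast
    qed
  qed
  then have "ball (p v) r - {p v} \<subseteq> F"
    using punctured_ball_subset[OF face_open[OF D F] v(2) r(1)] by blast
  moreover obtain y where "y \<in> path_image (\<gamma> e) - p ` e" "y \<in> ball (p v) r" "y \<noteq> p v"
  proof -
    have "e \<in> E" using e(1) D by blast
    then show ?thesis using islimptE[OF end_islimpt_open_arc[OF _ e(2)], of "ball (p v) r"] that r(1) by auto
  qed
  ultimately have "y \<in> F" "y \<in> drawn D" using e unfolding drawn_def arcs_def by blast+
  then show False using face_disjoint[OF F] by blast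
qed

lemma frontier_subset_touched:
  assumes D: "D \<subseteq> E" and F: "F \<in> components (- drawn D)"
    and noiso: "\<And>v. v \<in> V \<Longrightarrow> \<exists>e\<in>D. v \<in> e"
  shows "frontier F \<subseteq> arcs {e \<in> D. touches F e}"
proof
  fix z assume z: "z \<in> frontier F"
  show "z \<in> arcs {e \<in> D. touches F e}"
  proof (cases "z \<in> p ` V")
    case True
    then obtain v where v: "v \<in> V" "z = p v" by blast
    obtain e where "e \<in> D" "v \<in> e" using noiso v by blast
    then obtain f where f: "f \<in> D" "v \<in> f" "touches F f"
      using frontier_at_vertex[OF D F v(1)] z v frontier_subset_closure by blast
    then have "z \<in> path_image (\<gamma> f)" using p_in_arc_iff[of f v] v D by blast
    then show ?thesis using f unfolding arcs_def by blast
  next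
    case False
    then obtain e where e: "e \<in> D" "z \<in> path_image (\<gamma> e)"
      using face_frontier[OF D F] z unfolding drawn_def arcs_def by blast
    moreover have "z \<notin> p ` e" using False edge_sub[of e] e D by blast
    ultimately have "touches F e" using on_frontier_touches z by blast
    then show ?thesis using e unfolding arcs_def by blast
  qed
qed

definition is_triangle :: "'a set \<Rightarrow> bool" where
  "is_triangle t \<longleftrightarrow> card t = 3 \<and> pairs_in t \<subseteq> E"

text \<open>The frontier condition makes F one of the two sides of the triangle, so nothing of the graph is drawn on that
  side.\<close>

definition facial :: "'a set \<Rightarrow> complex set \<Rightarrow> bool" where
  "facial t F \<longleftrightarrow> is_triangle t \<and> F \<in> components (- drawn E) \<and> frontier F \<subseteq> arcs (pairs_in t)"

definition facial_triangles :: "'a set set" where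
  "facial_triangles = {t. \<exists>F. facial t F}"

lemma edge_path_from_to:
  assumes "{x, y} \<in> E"
  obtains g where "arc g" "path_image g = path_image (\<gamma> {x, y})" "pathstart g = p x" "pathfinish g = p y"
proof -
  let ?g = "\<gamma> {x, y}"
  have "{pathstart ?g, pathfinish ?g} = {p x, p y}" using edge_ends[OF assms] by simp
  then consider "pathstart ?g = p x" "pathfinish ?g = p y" | "pathstart ?g = p y" "pathfinish ?g = p x"
    by (auto simp: doubleton_eq_iff)
  then show ?thesis
  proof cases
    case 1 then show ?thesis using that[of ?g] edge_arc[OF assms] by simp
  next
    case 2 then show ?thesis using that[of "reversepath ?g"] edge_arc[OF assms] by (simp add: arc_reversepath)
  qed
qed

lemma triangle_curve:
  assumes "is_triangle t"
  obtains c where "simple_path c" "pathfinish c = pathstart c" "path_image c = arcs (pairs_in t)"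
proof -
  obtain x y z where t: "t = {x, y, z}" "x \<noteq> y" "y \<noteq> z" "x \<noteq> z"
    using assms by (metis is_triangle_def card_3_iff)
  have pt: "pairs_in t = {{x, y}, {y, z}, {x, z}}" using pairs_in_triple t by simp
  have E: "{x, y} \<in> E" "{y, z} \<in> E" "{z, x} \<in> E" using assms pt by (auto simp: is_triangle_def insert_commute)
  have ne: "{x, y} \<noteq> {y, z}" "{y, z} \<noteq> {z, x}" "{x, y} \<noteq> {z, x}" using t by (auto simp: doubleton_eq_iff)
  obtain a where a: "arc a" "path_image a = path_image (\<gamma> {x, y})" "pathstart a = p x" "pathfinish a = p y"
    using edge_path_from_to[OF E(1)] .
  obtain b where b: "arc b" "path_image b = path_image (\<gamma> {y, z})" "pathstart b = p y" "pathfinish b = p z"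
    using edge_path_from_to[OF E(2)] .
  obtain c where c: "arc c" "path_image c = path_image (\<gamma> {z, x})" "pathstart c = p z" "pathfinish c = p x"
    using edge_path_from_to[OF E(3)] .
  have i: "{x, y} \<inter> {y, z} = {y}" "{y, z} \<inter> {z, x} = {z}" "{x, y} \<inter> {z, x} = {x}" using t by auto
  have ab: "path_image a \<inter> path_image b \<subseteq> {p y}" unfolding a b edge_edge[OF E(1,2) ne(1)] i by simp
  have bc: "path_image b \<inter> path_image c \<subseteq> {p z}" unfolding c b edge_edge[OF E(2,3) ne(2)] i by simp
  have ac: "path_image a \<inter> path_image c \<subseteq> {p x}" unfolding a c edge_edge[OF E(1,3) ne(3)] i by simp
  have "simple_path (a +++ b +++ c)"
    using a b c ab bc ac by (intro simple_path_join3I) simp_all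
  moreover have "path_image (a +++ b +++ c) = arcs (pairs_in t)"
    unfolding pt arcs_def using a b c by (simp add: path_image_join insert_commute[of z x] Un_commute Un_left_commute)
  ultimately show ?thesis using that[of "a +++ b +++ c"] a c by simp
qed

text \<open>F is connected and open and its frontier lies on the Jordan curve of the triangle; so F is a whole side of that
  curve.\<close>

lemma facial_frontier:
  assumes "facial t F" shows "frontier F = arcs (pairs_in t)"
    and "F = inside (arcs (pairs_in t)) \<or> F = outside (arcs (pairs_in t))"
proof -
  let ?J = "arcs (pairs_in t)"
  have t: "is_triangle t" and F: "F \<in> components (- drawn E)" and fr: "frontier F \<subseteq> ?J"
    using assms by (auto simp: facial_def)
  obtain c where c: "simple_path c" "pathfinish c = pathstart c" "path_image c = ?J" using triangle_curve[OF t] .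
  note J = Jordan_inside_outside[OF c(1,2), unfolded c(3)]
  have op: "open F" using face_open[OF _ F] by simp
  have JE: "?J \<subseteq> drawn E" using t unfolding is_triangle_def drawn_def arcs_def by blast
  then have FJ: "F \<subseteq> - ?J" using face_disjoint[OF F] by blast
  have sub: "S \<subseteq> F" if "connected S" "S \<inter> ?J = {}" "S \<inter> F \<noteq> {}" for S
    using connected_subset_face[OF op that(1,3)] fr that(2) by blast
  have conF: "connected F" using F in_components_connected by blast
  have ne: "F \<noteq> {}" using F in_components_nonempty by blast
  have io: "inside ?J \<union> outside ?J = - ?J" "inside ?J \<inter> outside ?J = {}" using J by blast+
  have conn: "connected (inside ?J)" "connected (outside ?J)" using J by blast+
  have disj: "inside ?J \<inter> ?J = {}" "outside ?J \<inter> ?J = {}" using io by blast+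
  obtain x where x: "x \<in> F" using ne by blast
  have opio: "open (inside ?J)" "open (outside ?J)" using J by blast+
  have "F \<subseteq> inside ?J \<or> F \<subseteq> outside ?J"
    using connectedD[OF conF opio] FJ io by blast
  moreover have "F \<subseteq> inside ?J \<Longrightarrow> inside ?J \<subseteq> F" using sub[OF conn(1) disj(1)] x by blast
  moreover have "F \<subseteq> outside ?J \<Longrightarrow> outside ?J \<subseteq> F" using sub[OF conn(2) disj(2)] x by blast
  ultimately show *: "F = inside ?J \<or> F = outside ?J" by blast
  have "frontier (inside ?J) = ?J" "frontier (outside ?J) = ?J" using J by blast+
  with * show "frontier F = ?J" by auto
qed

lemma vertex_on_triangle:
  assumes "is_triangle t" "v \<in> V" shows "p v \<in> arcs (pairs_in t) \<longleftrightarrow> v \<in> t"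
proof -
  have "p v \<in> arcs (pairs_in t) \<longleftrightarrow> (\<exists>e\<in>pairs_in t. v \<in> e)"
    unfolding arcs_def using p_in_arc_iff[OF _ assms(2)] assms(1) unfolding is_triangle_def by blast
  also have "\<dots> \<longleftrightarrow> v \<in> t"
  proof -
    obtain x y z where "t = {x, y, z}" "x \<noteq> y" "y \<noteq> z" "x \<noteq> z"
      using assms by (metis is_triangle_def card_3_iff)
    then show ?thesis using pairs_in_triple[of x y z] by auto
  qed
  finally show ?thesis .
qed

lemma triangle_sub: "is_triangle t \<Longrightarrow> t \<subseteq> V"
proof -
  assume t: "is_triangle t"
  obtain x y z where "t = {x, y, z}" "x \<noteq> y" "y \<noteq> z" "x \<noteq> z" using t by (metis is_triangle_def card_3_iff)
  then show ?thesis using pairs_in_triple[of x y z] t edge_sub[of "{x, y}"] edge_sub[of "{y, z}"] by (auto simp: is_triangle_def)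
qed

lemma facial_inj:
  assumes "facial t F" "facial t' F" shows "t = t'"
proof -
  have tt: "is_triangle t" "is_triangle t'" using assms by (auto simp: facial_def)
  have "arcs (pairs_in t) = arcs (pairs_in t')" using assms facial_frontier(1) by metis
  then have "v \<in> t \<longleftrightarrow> v \<in> t'" if "v \<in> V" for v using vertex_on_triangle[OF tt(1) that] vertex_on_triangle[OF tt(2) that] by metis
  then show ?thesis using triangle_sub tt by blast
qed

text \<open>If both sides of the triangle were faces, the triangle would carry the whole drawing. A fourth vertex excludes
  this.\<close>

lemma facial_unique:
  assumes "card V \<ge> 4" "facial t F" "facial t F'" shows "F = F'"
proof (rule ccontr)
  assume ne: "F \<noteq> F'"
  let ?J = "arcs (pairs_in t)"
  have t: "is_triangle t" using assms by (simp add: facial_def)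
  then have "card t = 3" "finite t" by (auto simp: is_triangle_def card_ge_0_finite)
  then have "\<not> V \<subseteq> t" using assms(1) card_mono[of t V] by linarith
  then obtain v where v: "v \<in> V" "v \<notin> t" by blast
  have "{F, F'} = {inside ?J, outside ?J}"
    using facial_frontier(2)[OF assms(2)] facial_frontier(2)[OF assms(3)] ne by blast
  then have "F \<union> F' = inside ?J \<union> outside ?J" by blast
  then have "- ?J \<subseteq> F \<union> F'" by (simp add: inside_Un_outside)
  moreover have "p v \<in> - ?J" using vertex_on_triangle[OF t v(1)] v(2) by blast
  moreover have "p v \<in> drawn E" using v by (simp add: drawn_def)
  ultimately show False using assms face_disjoint unfolding facial_def by blast
qed

lemma facial_touches:
  assumes "facial t F" "e \<in> pairs_in t" shows "touches F e"
proof -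
  have "e \<in> E" using assms by (auto simp: facial_def is_triangle_def)
  then obtain z where z: "z \<in> path_image (\<gamma> e) - p ` e" using open_arc_nonempty by blast
  then have "z \<in> frontier F" using facial_frontier(1)[OF assms(1)] assms(2) unfolding arcs_def by blast
  then show ?thesis using on_frontier_touches[OF assms(2)] z by blast
qed

text \<open>The frontier of F is still drawn in the subgraph, so F does not merge with anything.\<close>

lemma facial_face_of_subgraph:
  assumes "facial t F" "D \<subseteq> E" "pairs_in t \<subseteq> D" shows "F \<in> components (- drawn D)"
proof -
  have F: "F \<in> components (- drawn E)" using assms by (simp add: facial_def)
  have FD: "F \<subseteq> - drawn D" using face_disjoint[OF F] drawn_mono[OF assms(2)] by blast
  have JD: "arcs (pairs_in t) \<subseteq> drawn D" using assms(3) unfolding drawn_def arcs_def by blast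
  have ne: "F \<noteq> {}" and con: "connected F" using F in_components_nonempty in_components_connected by blast+
  have "S = F" if S: "F \<subseteq> S" "S \<subseteq> - drawn D" "connected S" for S
  proof
    have "S \<inter> frontier F = {}" using facial_frontier(1)[OF assms(1)] JD S(2) by blast
    then show "S \<subseteq> F" using connected_subset_face[OF face_open[OF _ F] S(3)] ne S(1) by blast
  qed (rule S(1))
  then show ?thesis using ne con FD unfolding in_components_maximal by blast
qed

text \<open>An edge that already has a facial triangle on both sides touches no further face.\<close>

lemma facial_triangle_faces_exhaust:
  assumes n: "card V \<ge> 4" and D: "D \<subseteq> E" "e \<in> D"
    and t: "facial t1 F1" "facial t2 F2" "t1 \<noteq> t2" "e \<in> pairs_in t1" "e \<in> pairs_in t2"
      "pairs_in t1 \<subseteq> D" "pairs_in t2 \<subseteq> D"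
    and F: "F \<in> components (- drawn D)" "touches F e"
  shows "F = F1 \<or> F = F2"
proof -
  have "F1 \<noteq> F2" using facial_inj t by blast
  then show ?thesis
    using edge_touches_at_most_two_faces[OF D facial_face_of_subgraph[OF t(1) D(1) t(6)]
        facial_face_of_subgraph[OF t(2) D(1) t(7)] F(1) facial_touches[OF t(1,4)] facial_touches[OF t(2,5)] F(2)]
    by blast
qed

lemma edge_in_at_most_two_facial:
  assumes n: "card V \<ge> 4" and "t1 \<in> facial_triangles" "t2 \<in> facial_triangles" "t3 \<in> facial_triangles"
    and e: "e \<in> pairs_in t1" "e \<in> pairs_in t2" "e \<in> pairs_in t3"
  shows "t1 = t2 \<or> t2 = t3 \<or> t1 = t3"
proof (rule ccontr)
  assume ne: "\<not> ?thesis"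
  obtain F1 F2 F3 where F: "facial t1 F1" "facial t2 F2" "facial t3 F3"
    using assms by (auto simp: facial_triangles_def)
  have sub: "pairs_in t1 \<subseteq> E" "pairs_in t2 \<subseteq> E" "e \<in> E" "F3 \<in> components (- drawn E)"
    using F e by (auto simp: facial_def is_triangle_def)
  have "F3 = F1 \<or> F3 = F2"
    using facial_triangle_faces_exhaust[OF n subset_refl sub(3) F(1,2) _ e(1,2) sub(1,2,4) facial_touches[OF F(3) e(3)]] ne by blast
  then show False using facial_inj F ne by blast
qed

text \<open>The frontier of F is covered by the edges that F touches. If these edges did not separate the plane, F would be
  the only face. At most two edges never separate, and three edges only do if they form a triangle.\<close>

lemma face_with_three_edges:
  assumes noiso: "\<And>v. v \<in> V \<Longrightarrow> \<exists>e\<in>E. v \<in> e"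
    and F: "F \<in> components (- drawn E)" and two: "components (- drawn E) \<noteq> {F}"
  shows "3 \<le> card {e \<in> E. touches F e} \<and> (card {e \<in> E. touches F e} = 3 \<longrightarrow> (\<exists>t. facial t F))"
proof -
  let ?D = "{e \<in> E. touches F e}"
  have D: "?D \<subseteq> E" by blast
  have fr: "frontier F \<subseteq> arcs ?D" using frontier_subset_touched[OF subset_refl F noiso] .
  have "\<not> connected (- arcs ?D)"
  proof
    assume con: "connected (- arcs ?D)"
    have ne: "F \<noteq> {}" using F in_components_nonempty by blast
    have sub: "- drawn E \<subseteq> - arcs ?D" unfolding drawn_def arcs_def by blast
    then have "F \<subseteq> - arcs ?D" using in_components_subset[OF F] by blast
    then have "- arcs ?D \<subseteq> F"
      using connected_subset_face[OF face_open[OF subset_refl F] con] ne fr by blast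
    then have "F = - drawn E" using sub in_components_subset[OF F] by blast
    then have "connected (- drawn E)" "- drawn E \<noteq> {}" using F in_components_connected ne by auto
    then show False using two \<open>F = - drawn E\<close> by (metis components_eq_sing_iff)
  qed
  note ncon = this
  have "\<not> card ?D \<le> 2" using connected_Compl_arcs_le2[OF D] ncon by blast
  moreover have "\<exists>t. facial t F" if c: "card ?D = 3"
  proof -
    obtain x y z where xyz: "x \<noteq> y" "y \<noteq> z" "x \<noteq> z" "?D = {{x, y}, {y, z}, {x, z}}"
      using connected_Compl_arcs_3_or_triangle[OF D c ncon] by blast
    then have "pairs_in {x, y, z} = ?D" using pairs_in_triple by metis
    then have "facial {x, y, z} F" unfolding facial_def is_triangle_def using F fr xyz(1-3) by auto
    then show ?thesis by blast
  qed
  ultimately show ?thesis by auto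
qed

text \<open>Every edge touches at most two faces. If there are at least two faces, every face touches at least four edges
  unless it is a facial triangle. With f faces and t facial triangles this gives 4 f <= 2 card E + t, and Euler's
  formula provides the lower bound for f.\<close>

lemma edges_bound_by_facial_triangles:
  assumes n: "card V \<ge> 4" and noiso: "\<And>v. v \<in> V \<Longrightarrow> \<exists>e\<in>E. v \<in> e"
  shows "2 * card E + 8 \<le> 4 * card V + card facial_triangles"
proof -
  let ?\<F> = "components (- drawn E)"
  let ?f = "card ?\<F>"
  have fin: "finite ?\<F>" by (rule finite_faces) simp
  have finT: "finite facial_triangles"
  proof (rule finite_subset)
    show "facial_triangles \<subseteq> Pow V" using triangle_sub by (auto simp: facial_triangles_def facial_def)
  qed (simp add: finite_V)
  have eul: "card E + 2 \<le> ?f + card V" 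
  proof (rule euler_lower[OF subset_refl])
    show "V \<noteq> {}" using n by (metis card.empty not_numeral_le_zero)
  qed
  show ?thesis
  proof (cases "?f \<le> 1")
    case True then show ?thesis using eul n by linarith
  next
    case False
    let ?d = "\<lambda>F. card {e \<in> E. touches F e}"
    have two: "?\<F> \<noteq> {F}" for F using False by auto
    have len: "3 \<le> ?d F" "?d F = 3 \<Longrightarrow> \<exists>t. facial t F" if "F \<in> ?\<F>" for F
      using face_with_three_edges[OF noiso that two] by blast+
    let ?T = "{F \<in> ?\<F>. ?d F = 3}"
    have cardT: "card ?T \<le> card facial_triangles"
    proof (rule card_inj_on_le[of "\<lambda>F. SOME t. facial t F" , OF _ _ finT])
      have some: "facial (SOME t. facial t F) F" if "F \<in> ?T" for F
        using len(2)[of F] that someI_ex[of "\<lambda>t. facial t F"] by blast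
      show "inj_on (\<lambda>F. SOME t. facial t F) ?T"
      proof (rule inj_onI)
        fix F G assume "F \<in> ?T" "G \<in> ?T" and eq: "(SOME t. facial t F) = (SOME t. facial t G)"
        then have "facial (SOME t. facial t F) F" "facial (SOME t. facial t F) G"
          using some[of F] some[of G] by simp_all
        then show "F = G" using facial_unique[OF n] by blast
      qed
      show "(\<lambda>F. SOME t. facial t F) ` ?T \<subseteq> facial_triangles"
        using some unfolding facial_triangles_def by blast
    qed
    have "4 * ?f = (\<Sum>F\<in>?\<F>. 4)" by simp
    also have "\<dots> \<le> (\<Sum>F\<in>?\<F>. ?d F + (if ?d F = 3 then 1 else 0))"
    proof (rule sum_mono)
      fix F assume "F \<in> ?\<F>"
      then show "4 \<le> ?d F + (if ?d F = 3 then 1 else 0)" using len(1)[of F] by auto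
    qed
    also have "\<dots> = (\<Sum>F\<in>?\<F>. ?d F) + card ?T"
      using fin by (simp add: sum.distrib sum.If_cases Int_def)
    also have "(\<Sum>F\<in>?\<F>. ?d F) = (\<Sum>e\<in>E. card {F \<in> ?\<F>. touches F e})"
      using sum_multicount_gen[of E ?\<F> "\<lambda>e F. touches F e" "\<lambda>F. ?d F"] finite_E fin by simp
    also have "\<dots> \<le> (\<Sum>e\<in>E. 2)"
    proof (rule sum_mono)
      fix e assume e: "e \<in> E"
      show "card {F \<in> ?\<F>. touches F e} \<le> 2"
      proof (rule ccontr)
        assume "\<not> ?thesis"
        then have "3 \<le> card {F \<in> ?\<F>. touches F e}" by simp
        then obtain S where S': "S \<subseteq> {F \<in> ?\<F>. touches F e}" "card S = 3" by (meson obtain_subset_with_card_n)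
        obtain F1 F2 F3 where S: "{F1, F2, F3} \<subseteq> {F \<in> ?\<F>. touches F e}"
          and ne: "F1 \<noteq> F2" "F2 \<noteq> F3" "F1 \<noteq> F3"
          using S'(1) S'(2)[unfolded card_3_iff] by (elim exE conjE) simp
        have "F1 \<in> ?\<F>" "F2 \<in> ?\<F>" "F3 \<in> ?\<F>" "touches F1 e" "touches F2 e" "touches F3 e"
          using S by simp_all
        then have "F1 = F2 \<or> F2 = F3 \<or> F1 = F3" by (rule edge_touches_at_most_two_faces[OF subset_refl e])
        then show False using ne by blast
      qed
    qed
    finally show ?thesis using cardT eul by simp
  qed
qed

end

context plane_graph
begin

lemma finite_facial_triangles: "finite facial_triangles"
proof (rule finite_subset)
  show "facial_triangles \<subseteq> Pow V" using triangle_sub by (auto simp: facial_triangles_def facial_def)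
qed (simp add: finite_V)

text \<open>The point z is drawn in the whole graph, so the face F cannot be a facial triangle.\<close>

lemma open_arc_in_face:
  assumes "D \<subseteq> E" "f \<in> E" "f \<notin> D"
  obtains F z where "F \<in> components (- drawn D)" "z \<in> F" "z \<in> drawn E" "path_image (\<gamma> f) - p ` f \<subseteq> F"
proof -
  let ?A = "path_image (\<gamma> f) - p ` f"
  obtain z where z: "z \<in> ?A" using open_arc_nonempty[OF assms(2)] by blast
  have con: "connected ?A"
    using connected_simple_path_endless[OF arc_imp_simple_path[OF edge_arc[OF assms(2)]]] edge_ends[OF assms(2)] by simp
  have sub: "?A \<subseteq> - drawn D" using arc_Int_drawn[OF assms(2,1,3)] by blast
  let ?F = "connected_component_set (- drawn D) z"
  have "z \<in> - drawn D" using z sub by blast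
  then have "?F \<in> components (- drawn D)" "z \<in> ?F" by (auto simp: components_iff connected_component_refl_eq)
  moreover have "?A \<subseteq> ?F" using connected_component_maximal[OF z con sub] .
  moreover have "z \<in> drawn E" using z assms(2) unfolding drawn_def arcs_def by blast
  ultimately show ?thesis using that by blast
qed

lemma facial_not_containing: "facial t F \<Longrightarrow> z \<in> F \<Longrightarrow> z \<notin> drawn E"
  using face_disjoint unfolding facial_def by blast

text \<open>Suppose that an edge f is missing from D, and let F be the face of D through which f runs. Every edge of D
  already has facial triangles on both sides, and F is not one of these, so F touches no edge of D. Then the
  frontier of F is finite and F is the complement of finitely many points, which is absurd as D is not empty.\<close>

lemma edges_closed_under_facial_triangles:
  assumes n: "card V \<ge> 4" and D: "D \<subseteq> E" "D \<noteq> {}"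
    and full: "\<And>e. e \<in> D \<Longrightarrow> \<exists>t1\<in>facial_triangles. \<exists>t2\<in>facial_triangles. t1 \<noteq> t2 \<and>
       e \<in> pairs_in t1 \<and> e \<in> pairs_in t2 \<and> pairs_in t1 \<subseteq> D \<and> pairs_in t2 \<subseteq> D"
  shows "D = E"
proof (rule ccontr)
  assume "D \<noteq> E"
  then obtain f where f: "f \<in> E" "f \<notin> D" using D by blast
  obtain F z where F: "F \<in> components (- drawn D)" "z \<in> F" "z \<in> drawn E" "path_image (\<gamma> f) - p ` f \<subseteq> F"
    using open_arc_in_face[OF D(1) f] .
  have nt: "\<not> touches F e" if e: "e \<in> D" for e
  proof
    assume t: "touches F e"
    obtain t1 t2 F1 F2 where "facial t1 F1" "facial t2 F2" "t1 \<noteq> t2" "e \<in> pairs_in t1" "e \<in> pairs_in t2"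
      "pairs_in t1 \<subseteq> D" "pairs_in t2 \<subseteq> D"
      using full[OF e] unfolding facial_triangles_def by blast
    then show False
      using facial_triangle_faces_exhaust[OF n D(1) e _ _ _ _ _ _ _ F(1) t] facial_not_containing F(2,3) by metis
  qed
  have "frontier F \<subseteq> p ` V"
  proof
    fix w assume w: "w \<in> frontier F"
    show "w \<in> p ` V"
    proof (rule ccontr)
      assume nw: "w \<notin> p ` V"
      then obtain e where e: "e \<in> D" "w \<in> path_image (\<gamma> e)"
        using face_frontier[OF D(1) F(1)] w unfolding drawn_def arcs_def by blast
      moreover have "w \<notin> p ` e" using nw edge_sub[of e] e D by blast
      ultimately show False using on_frontier_touches[OF e(1) w] nt by blast
    qed
  qed
  moreover have "- (p ` V) \<inter> F \<noteq> {}" using F(2) face_disjoint[OF F(1)] unfolding drawn_def by blast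
  ultimately have "- (p ` V) \<subseteq> F"
    using connected_subset_face[OF face_open[OF D(1) F(1)] connected_Compl_vertices] by blast
  moreover obtain e where e: "e \<in> D" using D(2) by blast
  moreover obtain w where "w \<in> path_image (\<gamma> e) - p ` e" using open_arc_nonempty[of e] e D(1) by blast
  moreover have "path_image (\<gamma> e) \<inter> p ` V = p ` e" using edge_verts[of e] e D(1) by blast
  ultimately have "w \<in> F" "w \<in> drawn D" unfolding drawn_def arcs_def by blast+
  then show False using face_disjoint[OF F(1)] by blast
qed

text \<open>If the triangles around u close up over the neighbours in S, a further edge uy would run into a face F of this
  wheel. As u is in the closure of F, the face F touches a spoke of the wheel. But both sides of each spoke are
  facial triangles, and no edge runs into these.\<close>

lemma closed_link_is_everything:
  assumes n: "card V \<ge> 4" and S: "S \<noteq> {}" and u: "u \<in> V"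
    and two: "\<And>x. x \<in> S \<Longrightarrow> \<exists>t1\<in>facial_triangles. \<exists>t2\<in>facial_triangles. t1 \<noteq> t2 \<and>
       {u, x} \<in> pairs_in t1 \<and> {u, x} \<in> pairs_in t2"
    and cl: "\<And>t x. x \<in> S \<Longrightarrow> t \<in> facial_triangles \<Longrightarrow> {u, x} \<subseteq> t \<Longrightarrow> t \<subseteq> insert u S"
    and y: "{u, y} \<in> E"
  shows "y \<in> S"
proof (rule ccontr)
  assume yS: "y \<notin> S"
  define D where "D = \<Union>(pairs_in ` {t \<in> facial_triangles. u \<in> t \<and> t \<inter> S \<noteq> {}})"
  let ?f = "{u, y}"
  have DE: "D \<subseteq> E" unfolding D_def facial_triangles_def facial_def is_triangle_def by blast
  have uy: "u \<noteq> y" using edge_card[OF y] by auto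
  have Du: "\<exists>x\<in>S. e = {u, x}" if e: "e \<in> D" "u \<in> e" for e
  proof -
    obtain t x where t: "t \<in> facial_triangles" "u \<in> t" "x \<in> t" "x \<in> S" "e \<in> pairs_in t"
      using e unfolding D_def by blast
    then have "t \<subseteq> insert u S" using cl[of x t] by blast
    moreover obtain w where "e = {u, w}" "u \<noteq> w"
      using e(2) t(5) unfolding pairs_in_def card_2_iff by blast
    ultimately show ?thesis using t(5) unfolding pairs_in_def by blast
  qed
  have fD: "?f \<notin> D"
  proof
    assume "?f \<in> D"
    then obtain x where "x \<in> S" "?f = {u, x}" using Du[of ?f] by blast
    then show False using yS uy by (metis doubleton_eq_iff)
  qed
  obtain F z where F: "F \<in> components (- drawn D)" "z \<in> F" "z \<in> drawn E" "path_image (\<gamma> ?f) - p ` ?f \<subseteq> F"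
    using open_arc_in_face[OF DE y fD] .
  have "p u islimpt (path_image (\<gamma> ?f) - p ` ?f)" using end_islimpt_open_arc[OF y, of u] by simp
  then have "p u \<in> closure F" using islimpt_subset[OF _ F(4)] unfolding closure_def by blast
  moreover obtain x where x: "x \<in> S" using S by blast
  obtain t where t: "t \<in> facial_triangles" "{u, x} \<in> pairs_in t" using two[OF x] by blast
  then have "{u, x} \<in> D" using x unfolding D_def pairs_in_def by blast
  ultimately obtain g where g: "g \<in> D" "u \<in> g" "touches F g"
    using frontier_at_vertex[OF DE F(1) u _ \<open>{u, x} \<in> D\<close>] by blast
  obtain x' where x': "x' \<in> S" "g = {u, x'}" using Du[OF g(1,2)] by blast
  obtain t1 t2 F1 F2 where tt: "facial t1 F1" "facial t2 F2" "t1 \<noteq> t2" "g \<in> pairs_in t1" "g \<in> pairs_in t2"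
    using two[OF x'(1)] x'(2) unfolding facial_triangles_def by blast
  have D12: "pairs_in t \<subseteq> D" if "facial t F" "g \<in> pairs_in t" for t F
    using that x' unfolding D_def facial_triangles_def pairs_in_def by blast
  have "F = F1 \<or> F = F2"
    using facial_triangle_faces_exhaust[OF n DE g(1) tt D12[OF tt(1,4)] D12[OF tt(2,5)] F(1) g(3)] .
  then show False using facial_not_containing tt F(2,3) by blast
qed

definition connected_in :: "'a set \<Rightarrow> bool" where
  "connected_in C \<longleftrightarrow> (\<forall>S. S \<subset> C \<longrightarrow> S \<noteq> {} \<longrightarrow> (\<exists>x\<in>S. \<exists>y\<in>C - S. {x, y} \<in> E))"

text \<open>The tree grows from a single vertex; each new edge meets the earlier ones only in one end, so the complement
  stays connected.\<close>

lemma spanning_tree: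
  assumes C: "C \<subseteq> V" "C \<noteq> {}" "connected_in C"
  shows "\<exists>T \<subseteq> {e \<in> E. e \<subseteq> C}. card T + 1 = card C \<and> connected (- arcs T)"
proof -
  have finC: "finite C" using C finite_V finite_subset by blast
  let ?P = "\<lambda>S. S \<subseteq> C \<and> S \<noteq> {} \<and> (\<exists>T \<subseteq> {e \<in> E. e \<subseteq> S}. card T + 1 = card S \<and> connected (- arcs T))"
  obtain a where "a \<in> C" using C by blast
  then have "?P {a}" using connected_Compl_arcs_empty by (intro conjI exI[of _ "{}"]) simp_all
  have grow: "\<exists>S. ?P S \<and> card S = k" if "k \<ge> 1" "k \<le> card C" for k
    using that
  proof (induction k rule: nat_induct_at_least)
    case base then show ?case using \<open>?P {a}\<close> by (intro exI[of _ "{a}"]) simp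
  next
    case (Suc k)
    then obtain S T where S: "S \<subseteq> C" "S \<noteq> {}" "card S = k" and T: "T \<subseteq> {e \<in> E. e \<subseteq> S}" "card T + 1 = card S" "connected (- arcs T)"
      by auto
    have "S \<subset> C" using S Suc by auto
    then obtain x y where xy: "x \<in> S" "y \<in> C - S" "{x, y} \<in> E" using C(3) S(2) unfolding connected_in_def by blast
    have TE: "T \<subseteq> E" "\<Union>T \<subseteq> S" using T by blast+
    have notT: "{x, y} \<notin> T" using TE(2) xy by blast
    have "{x, y} \<inter> \<Union>T \<subseteq> {x}" using TE(2) xy by blast
    then have "card ({x, y} \<inter> \<Union>T) \<le> 1"
      using card_mono[of "{x}" "{x, y} \<inter> \<Union>T"] by simp
    then have con: "connected (- arcs (insert {x, y} T))"
      using connected_Compl_arcs_insert[OF xy(3) TE(1) notT] T(3) by blast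
    have finS: "finite S" using S(1) finC finite_subset by blast
    have cy: "card (insert y S) = Suc k" using S(3) xy(2) finS by simp
    have a: "card (insert {x, y} T) + 1 = card (insert y S)"
      using T(2) S(3) notT finite_sub_E[OF TE(1)] cy by simp
    have b: "insert {x, y} T \<subseteq> {e \<in> E. e \<subseteq> insert y S}" using T(1) xy by blast
    have c: "insert y S \<subseteq> C" "insert y S \<noteq> {}" using S(1) xy(2) by blast+
    have P: "?P (insert y S)" by (intro conjI exI[of _ "insert {x, y} T"] a b c con)
    show ?case by (rule exI[of _ "insert y S"], rule conjI[OF P cy])
  qed
  have "card C \<ge> 1" using C(2) finC by (simp add: Suc_le_eq card_gt_0_iff)
  from grow[OF this order_refl] obtain S where S: "?P S \<and> card S = card C" by (elim exE)
  then have "S = C" using finC card_subset_eq by metis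
  with S show ?thesis by simp
qed

text \<open>The other half of Euler's formula, for the subgraph induced by C. Its faces include the facial triangles inside
  C and one more face, through which the edge f runs. Removing the edges outside a spanning tree one by one loses
  at most one face each time and leaves a single face.\<close>

lemma facial_triangles_in_connected_part:
  assumes n: "card V \<ge> 4" and C: "C \<subseteq> V" "C \<noteq> {}" "connected_in C" and f: "f \<in> E" "\<not> f \<subseteq> C"
  shows "card C + card {t \<in> facial_triangles. t \<subseteq> C} \<le> card {e \<in> E. e \<subseteq> C} + 1"
proof -
  let ?D = "{e \<in> E. e \<subseteq> C}" and ?T = "{t \<in> facial_triangles. t \<subseteq> C}"
  have D: "?D \<subseteq> E" "f \<notin> ?D" using f by auto
  obtain T where T: "T \<subseteq> ?D" "card T + 1 = card C" "connected (- arcs T)" using spanning_tree[OF C] by blast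
  have TE: "T \<subseteq> E" using T by blast
  have conT: "connected (- drawn T)"
  proof -
    have "open (- arcs T)" using compact_arcs[OF TE] by (intro open_Compl compact_imp_closed)
    then have "connected (- arcs T - p ` V)"
      using T(3) finite_V by (intro connected_open_diff_countable countable_finite) auto
    moreover have "- arcs T - p ` V = - drawn T" unfolding drawn_def by blast
    ultimately show ?thesis by simp
  qed
  obtain F0 z where F0: "F0 \<in> components (- drawn ?D)" "z \<in> F0" "z \<in> drawn E"
    "path_image (\<gamma> f) - p ` f \<subseteq> F0"
    using open_arc_in_face[OF D(1) f(1) D(2)] .
  define \<phi> where "\<phi> = (\<lambda>t. SOME F. facial t F)"
  have \<phi>: "facial t (\<phi> t)" if "t \<in> ?T" for t
    using that unfolding \<phi>_def facial_triangles_def by (metis (mono_tags, lifting) mem_Collect_eq someI)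
  have inj: "inj_on \<phi> ?T"
  proof (rule inj_onI)
    fix t t' assume "t \<in> ?T" "t' \<in> ?T" "\<phi> t = \<phi> t'"
    then show "t = t'" using facial_inj[of t "\<phi> t" t'] \<phi>[of t] \<phi>[of t'] by simp
  qed
  have notin: "F0 \<notin> \<phi> ` ?T" using \<phi> facial_not_containing F0(2,3) by blast
  have fin: "finite ?T" using finite_facial_triangles by simp
  have sub: "insert F0 (\<phi> ` ?T) \<subseteq> components (- drawn ?D)"
  proof -
    have "\<phi> t \<in> components (- drawn ?D)" if t: "t \<in> ?T" for t
    proof (rule facial_face_of_subgraph[OF \<phi>[OF t] D(1)])
      show "pairs_in t \<subseteq> ?D" using \<phi>[OF t] t unfolding facial_def is_triangle_def pairs_in_def by blast
    qed
    then show ?thesis using F0(1) by blast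
  qed
  have "finite (insert F0 (\<phi> ` ?T))" using fin by simp
  then obtain P where P: "face_reps (drawn ?D) P" "card P = card (insert F0 (\<phi> ` ?T))"
    using face_reps_of_components sub by blast
  have cP: "card P = card ?T + 1" using P(2) notin fin inj by (simp add: card_image)
  obtain P' where P': "face_reps (drawn T) P'" "card P \<le> card P' + card (?D - T)"
    using face_reps_remove_edges[OF P(1) D(1) T(1)] by blast
  have "card P' \<le> 1" using face_reps_connected[OF conT P'(1)] .
  moreover have "card (?D - T) = card ?D - card T" "card T \<le> card ?D"
    using T(1) finite_sub_E[OF TE] finite_sub_E[OF D(1)] by (simp_all add: card_Diff_subset card_mono)
  ultimately show ?thesis using P'(2) cP T(2) by linarith
qed

end

section \<open>Links in fan-free plane graphs\<close>

lemma triple_eqD: "{a, b, c} = {a, b, d} \<Longrightarrow> a \<noteq> c \<Longrightarrow> b \<noteq> c \<Longrightarrow> c = d"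
  by (metis insertCI insertE singletonD)

text \<open>A fan is given by its hub u and the list of vertices on its path. An isolated vertex would be a frontier point
  that belongs to no edge, so there are none here.\<close>

locale fan_free_plane_graph = plane_graph +
  fixes k :: nat
  assumes k: "k \<in> {2, 3, 4, 5}"
    and card_V: "card V \<ge> 4"
    and no_isolated: "\<And>v. v \<in> V \<Longrightarrow> \<exists>e\<in>E. v \<in> e"
    and fan_free: "\<And>u xs. distinct xs \<Longrightarrow> length xs = k + 1 \<Longrightarrow> (\<And>x. x \<in> set xs \<Longrightarrow> {u, x} \<in> E) \<Longrightarrow>
       successively (\<lambda>x y. {x, y} \<in> E) xs \<Longrightarrow> False"
begin

abbreviation T :: "'a set set" where "T \<equiv> facial_triangles"

definition nbrs :: "'a \<Rightarrow> 'a set" where "nbrs u = {x. {u, x} \<in> E}"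

text \<open>The facial triangles at u form a graph on the neighbours of u, the link of u, in which the set below consists of
  the neighbours of x. An edge has two sides, so degrees in the link are at most two and its components are paths
  and cycles.\<close>

definition lk :: "'a \<Rightarrow> 'a \<Rightarrow> 'a set" where "lk u x = {y. {u, x, y} \<in> T}"

lemma edge_distinct: "{x, y} \<in> E \<Longrightarrow> x \<noteq> y"
  using edge_card[of "{x, y}"] by auto

lemma edge_in_V: "{x, y} \<in> E \<Longrightarrow> x \<in> V" "{x, y} \<in> E \<Longrightarrow> y \<in> V"
  using edge_sub[of "{x, y}"] by auto

lemma nbrs_sub: "nbrs u \<subseteq> V" and finite_nbrs: "finite (nbrs u)"
proof -
  show "nbrs u \<subseteq> V" using edge_in_V unfolding nbrs_def by blast
  then show "finite (nbrs u)" using finite_V finite_subset by blast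
qed

lemma nbrs_sym: "x \<in> nbrs u \<longleftrightarrow> u \<in> nbrs x"
  by (simp add: nbrs_def insert_commute)

lemma T_triangle: "t \<in> T \<Longrightarrow> is_triangle t"
  by (auto simp: facial_triangles_def facial_def)

lemma T_card: "t \<in> T \<Longrightarrow> card t = 3" and T_sub: "t \<in> T \<Longrightarrow> t \<subseteq> V"
  using T_triangle triangle_sub by (auto simp: is_triangle_def)

lemma T_edge: "t \<in> T \<Longrightarrow> x \<in> t \<Longrightarrow> y \<in> t \<Longrightarrow> x \<noteq> y \<Longrightarrow> {x, y} \<in> E"
  using T_triangle[of t] by (auto simp: is_triangle_def pairs_in_def)

lemma lk_distinct: assumes "y \<in> lk u x" shows "u \<noteq> x" "x \<noteq> y" "u \<noteq> y"
proof -
  have "card {u, x, y} = 3" using T_card assms by (simp add: lk_def)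
  then show "u \<noteq> x" "x \<noteq> y" "u \<noteq> y" by (auto simp: card_insert_if split: if_splits)
qed

lemma lk_edges: assumes "y \<in> lk u x" shows "{u, x} \<in> E" "{x, y} \<in> E" "{u, y} \<in> E"
  using T_edge[of "{u, x, y}"] lk_distinct[OF assms] assms by (auto simp: lk_def)

lemma lk_sym: "y \<in> lk u x \<longleftrightarrow> x \<in> lk u y"
  by (simp add: lk_def insert_commute)

lemma finite_lk: "finite (lk u x)"
proof (rule finite_subset)
  show "lk u x \<subseteq> nbrs u" using lk_edges by (auto simp: nbrs_def)
qed (rule finite_nbrs)

lemma card_lk:
  assumes "x \<noteq> y" shows "card (lk x y) = card {t \<in> T. x \<in> t \<and> y \<in> t}"
proof (rule bij_betw_same_card)
  show "bij_betw (\<lambda>z. {x, y, z}) (lk x y) {t \<in> T. x \<in> t \<and> y \<in> t}"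
    unfolding bij_betw_def
  proof
    show "inj_on (\<lambda>z. {x, y, z}) (lk x y)"
    proof (rule inj_onI)
      fix z z' assume "z \<in> lk x y" "z' \<in> lk x y" "{x, y, z} = {x, y, z'}"
      then show "z = z'" using triple_eqD[of x y z z'] lk_distinct[of z x y] by metis
    qed
    show "(\<lambda>z. {x, y, z}) ` lk x y = {t \<in> T. x \<in> t \<and> y \<in> t}"
    proof
      show "(\<lambda>z. {x, y, z}) ` lk x y \<subseteq> {t \<in> T. x \<in> t \<and> y \<in> t}" by (auto simp: lk_def)
      show "{t \<in> T. x \<in> t \<and> y \<in> t} \<subseteq> (\<lambda>z. {x, y, z}) ` lk x y"
      proof
        fix t assume "t \<in> {t \<in> T. x \<in> t \<and> y \<in> t}"
        then have t: "t \<in> T" "x \<in> t" "y \<in> t" by auto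
        have "card (t - {x, y}) = 1" using T_card[OF t(1)] t assms by (simp add: card_Diff_subset)
        then obtain z where "t - {x, y} = {z}" using card_1_singletonE by blast
        then have "t = {x, y, z}" using t by blast
        then show "t \<in> (\<lambda>z. {x, y, z}) ` lk x y" using t(1) by (auto simp: lk_def)
      qed
    qed
  qed
qed

lemma card_lk_le2: "card (lk u x) \<le> 2"
proof (rule ccontr)
  assume "\<not> ?thesis"
  then have "3 \<le> card (lk u x)" by simp
  then obtain S where S: "S \<subseteq> lk u x" "card S = 3" by (meson obtain_subset_with_card_n)
  then obtain a b c where abc: "S = {a, b, c}" "a \<noteq> b" "b \<noteq> c" "a \<noteq> c" by (metis card_3_iff)
  then have l: "a \<in> lk u x" "b \<in> lk u x" "c \<in> lk u x" using S by auto
  have e: "{u, x} \<in> pairs_in {u, x, y}" for y using lk_distinct(1)[OF l(1)] by (simp add: pairs_in_def)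
  have t: "{u, x, a} \<in> T" "{u, x, b} \<in> T" "{u, x, c} \<in> T" using l by (simp_all add: lk_def)
  have "{u, x, a} = {u, x, b} \<or> {u, x, b} = {u, x, c} \<or> {u, x, a} = {u, x, c}"
    by (rule edge_in_at_most_two_facial[OF card_V t e e e])
  then show False using abc(2-4) triple_eqD[of u x a b] triple_eqD[of u x b c] triple_eqD[of u x a c]
      lk_distinct(2,3)[OF l(1)] lk_distinct(2,3)[OF l(2)] by metis
qed

lemma two_triangles:
  assumes "card (lk u x) = 2"
  shows "\<exists>t1\<in>T. \<exists>t2\<in>T. t1 \<noteq> t2 \<and> {u, x} \<in> pairs_in t1 \<and> {u, x} \<in> pairs_in t2"
proof -
  obtain a b where ab: "lk u x = {a, b}" "a \<noteq> b" using assms card_2_iff by metis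
  then have l: "a \<in> lk u x" "b \<in> lk u x" by auto
  have "{u, x, a} \<noteq> {u, x, b}" using ab(2) lk_distinct[OF l(1)] triple_eqD[of u x a b] by metis
  moreover have "{u, x} \<in> pairs_in {u, x, y}" for y using lk_distinct(1)[OF l(1)] by (simp add: pairs_in_def)
  moreover have "{u, x, a} \<in> T" "{u, x, b} \<in> T" using l by (simp_all add: lk_def)
  ultimately show ?thesis by metis
qed

text \<open>At these vertices all corners are facial triangles; their links are cycles.\<close>

definition inner :: "'a set" where
  "inner = {u \<in> V. \<forall>x\<in>nbrs u. card (lk u x) = 2}"

text \<open>A cycle in the link of u is the whole link, for topological reasons: its triangles fill a neighbourhood of u.\<close>

lemma closed_link:
  assumes u: "u \<in> V" and S: "S \<noteq> {}" "\<And>x. x \<in> S \<Longrightarrow> card (lk u x) = 2" "\<And>x. x \<in> S \<Longrightarrow> lk u x \<subseteq> S"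
  shows "nbrs u \<subseteq> S"
proof
  fix y assume "y \<in> nbrs u"
  then have y: "{u, y} \<in> E" by (simp add: nbrs_def)
  have cl: "t \<subseteq> insert u S" if x: "x \<in> S" "t \<in> T" "{u, x} \<subseteq> t" for t x
  proof -
    have "u \<noteq> x" using S(2)[OF x(1)] lk_distinct(1)[of _ u x] by (metis card.empty ex_in_conv zero_neq_numeral)
    then have "card (t - {u, x}) = 1" using T_card[OF x(2)] x by (simp add: card_Diff_subset)
    then obtain z where "t - {u, x} = {z}" using card_1_singletonE by blast
    then have t: "t = {u, x, z}" using x by blast
    then have "z \<in> lk u x" using x by (simp add: lk_def)
    then show ?thesis using S(3)[OF x(1)] x(1) t by blast
  qed
  show "y \<in> S"
    by (rule closed_link_is_everything[OF card_V S(1) u two_triangles[OF S(2)] cl y])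
qed

definition link_path :: "'a \<Rightarrow> 'a list \<Rightarrow> bool" where
  "link_path u xs \<longleftrightarrow> xs \<noteq> [] \<and> distinct xs \<and> set xs \<subseteq> nbrs u \<and> successively (\<lambda>x y. y \<in> lk u x) xs"

text \<open>Together with u, a longer path would be a fan.\<close>

lemma link_path_length: assumes "link_path u xs" shows "length xs \<le> k"
proof (rule ccontr)
  assume n: "\<not> ?thesis"
  let ?ys = "take (k + 1) xs"
  have "successively (\<lambda>x y. y \<in> lk u x) ?ys"
    using assms unfolding link_path_def by (metis append_take_drop_id successively_append_iff)
  then have "successively (\<lambda>x y. {x, y} \<in> E) ?ys"
    by (rule successively_mono) (use lk_edges(2) in blast)
  moreover have "{u, x} \<in> E" if "x \<in> set ?ys" for x
    using that assms set_take_subset[of "k + 1" xs] unfolding link_path_def nbrs_def by blast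
  moreover have "distinct ?ys" "length ?ys = k + 1" using assms n by (auto simp: link_path_def)
  ultimately show False using fan_free[of ?ys u] by blast
qed

lemma link_path_rev: "link_path u xs \<Longrightarrow> link_path u (rev xs)"
  by (simp add: link_path_def lk_sym)

lemma link_path_nth:
  assumes "link_path u xs" "Suc i < length xs" shows "xs ! Suc i \<in> lk u (xs ! i)" "xs ! i \<in> lk u (xs ! Suc i)"
  using assms unfolding link_path_def successively_conv_nth by (auto simp: lk_sym)

text \<open>A set that is closed under neighbours in the link contains with one vertex the whole path, in both directions.\<close>

lemma link_path_sub_closed:
  assumes p: "link_path u xs" and S: "\<And>x. x \<in> S \<Longrightarrow> lk u x \<subseteq> S" and i: "i < length xs" "xs ! i \<in> S"
  shows "set xs \<subseteq> S"
proof -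
  have up: "xs ! (i + j) \<in> S" if "i + j < length xs" for j using that
  proof (induction j)
    case (Suc j)
    then have "xs ! (i + j) \<in> S" by simp
    moreover have "xs ! Suc (i + j) \<in> lk u (xs ! (i + j))" using link_path_nth(1)[OF p] Suc.prems by simp
    ultimately show ?case using S by auto
  qed (use i in simp)
  have down: "xs ! (i - j) \<in> S" if "j \<le> i" for j using that
  proof (induction j)
    case (Suc j)
    then have "xs ! (i - j) \<in> S" "Suc (i - Suc j) = i - j" by auto
    moreover have "xs ! (i - Suc j) \<in> lk u (xs ! Suc (i - Suc j))"
      using link_path_nth(2)[OF p, of "i - Suc j"] Suc.prems i by simp
    ultimately show ?case using S by auto
  qed (use i in simp)
  have "xs ! j \<in> S" if "j < length xs" for j
  proof (cases "i \<le> j")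
    case True then show ?thesis using up[of "j - i"] that by simp
  next
    case False then show ?thesis using down[of "i - j"] by simp
  qed
  then show ?thesis by (auto simp: in_set_conv_nth)
qed

text \<open>Degrees in the link are at most two, so the two neighbours on the path are all neighbours.\<close>

lemma lk_interior:
  assumes "link_path u xs" "Suc (Suc i) < length xs"
  shows "lk u (xs ! Suc i) = {xs ! i, xs ! Suc (Suc i)}"
proof -
  have "{xs ! i, xs ! Suc (Suc i)} \<subseteq> lk u (xs ! Suc i)" using link_path_nth[OF assms(1)] assms(2) by auto
  moreover have "xs ! i \<noteq> xs ! Suc (Suc i)" using assms nth_eq_iff_index_eq[of xs i "Suc (Suc i)"] by (simp add: link_path_def)
  then have "card {xs ! i, xs ! Suc (Suc i)} = 2" by simp
  ultimately show ?thesis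
    using card_lk_le2[of u "xs ! Suc i"] finite_lk card_seteq by (metis (no_types, lifting))
qed

text \<open>A longest path through x fills the component of x: interior vertices have no further neighbours, and a neighbour
  of an end outside the path would extend it.\<close>

lemma maximal_link_path:
  assumes "x \<in> nbrs u"
  obtains xs where "link_path u xs" "x \<in> set xs" "\<And>y. y \<in> set xs \<Longrightarrow> lk u y \<subseteq> set xs"
proof -
  let ?P = "\<lambda>xs. link_path u xs \<and> x \<in> set xs"
  have "?P [x]" using assms by (simp add: link_path_def)
  moreover have "\<And>xs. ?P xs \<Longrightarrow> length xs < k + 1" using link_path_length by fastforce
  ultimately obtain xs where xs: "?P xs" "\<And>ys. ?P ys \<Longrightarrow> length ys \<le> length xs"
    using ex_has_greatest_nat[of ?P "[x]" length "k + 1"] by blast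
  have p: "link_path u xs" "xs \<noteq> []" "distinct xs" using xs(1) by (auto simp: link_path_def)
  have ends: "lk u (hd ys) \<subseteq> set ys" if ys: "?P ys" "length ys = length xs" for ys
  proof
    fix z assume z: "z \<in> lk u (hd ys)"
    show "z \<in> set ys"
    proof (rule ccontr)
      assume "z \<notin> set ys"
      moreover have "z \<in> nbrs u" using lk_edges(3)[OF z] by (simp add: nbrs_def)
      moreover have "hd ys \<in> lk u z" using z lk_sym by blast
      ultimately have "?P (z # ys)" using ys(1) by (auto simp: link_path_def successively_Cons)
      then show False using xs(2)[of "z # ys"] ys(2) by simp
    qed
  qed
  have "lk u y \<subseteq> set xs" if y: "y \<in> set xs" for y
  proof -
    obtain i where i: "i < length xs" "y = xs ! i" using y by (metis in_set_conv_nth)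
    consider "i = 0" | "i = length xs - 1" | j where "i = Suc j" "Suc i < length xs"
      using i by (metis Suc_lessI diff_Suc_1 not0_implies_Suc)
    then show ?thesis
    proof cases
      case 1 then show ?thesis using ends[of xs] xs i p(2) by (simp add: hd_conv_nth)
    next
      case 2
      then have "y = hd (rev xs)" using i p(2) by (simp add: hd_rev last_conv_nth)
      then show ?thesis using ends[of "rev xs"] xs(1) link_path_rev by auto
    next
      case 3
      then show ?thesis using lk_interior[OF p(1), of j] i by simp
    qed
  qed
  then show ?thesis using that xs(1) by blast
qed

text \<open>The component filled by a longest path in the link consists of vertices of degree two, so it is the whole link;
  and a path in the link has at most k vertices.\<close>

lemma inner_degree:
  assumes "u \<in> inner" shows "card (nbrs u) \<le> k"
proof (cases "nbrs u = {}")
  case False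
  then obtain x where "x \<in> nbrs u" by blast
  then obtain xs where xs: "link_path u xs" "x \<in> set xs" "\<And>y. y \<in> set xs \<Longrightarrow> lk u y \<subseteq> set xs"
    using maximal_link_path by blast
  have u: "u \<in> V" "\<And>y. y \<in> set xs \<Longrightarrow> card (lk u y) = 2"
    using assms xs(1) unfolding inner_def link_path_def by blast+
  have "nbrs u \<subseteq> set xs" using closed_link[where S = "set xs", OF u(1) _ u(2) xs(3)] xs(2) by force
  then have "card (nbrs u) \<le> length xs" by (meson List.finite_set card_length card_mono order_trans)
  then show ?thesis using link_path_length[OF xs(1)] by simp
qed simp

text \<open>Not all vertices of the component have degree two, since otherwise it would be the whole link and u would be
  inner. If the first vertex of the longest path had degree two, its second neighbour could only be the last
  vertex, and then all degrees would be two. So both ends have degree one, unless the path is a single vertex.\<close>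

lemma link_component:
  assumes u: "u \<in> V" "u \<notin> inner" and x: "x \<in> nbrs u"
  obtains xs where "link_path u xs" "x \<in> set xs" "\<And>y. y \<in> set xs \<Longrightarrow> lk u y \<subseteq> set xs"
    "card (lk u x) \<noteq> 0 \<Longrightarrow> length xs \<ge> 2 \<and> card (lk u (hd xs)) = 1 \<and> card (lk u (last xs)) = 1"
    "\<And>i. 0 < i \<Longrightarrow> i < length xs - 1 \<Longrightarrow> card (lk u (xs ! i)) = 2"
proof -
  obtain xs where xs: "link_path u xs" "x \<in> set xs" "\<And>y. y \<in> set xs \<Longrightarrow> lk u y \<subseteq> set xs"
    using maximal_link_path[OF x] by blast
  have int: "card (lk u (ys ! i)) = 2" if h: "link_path u ys" "0 < i" "i < length ys - 1" for i ys
  proof -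
    obtain j where j: "i = Suc j" using gr0_implies_Suc[OF h(2)] by (elim exE)
    have ne: "ys ! j \<noteq> ys ! Suc (Suc j)"
      using h j nth_eq_iff_index_eq[of ys j "Suc (Suc j)"] by (simp add: link_path_def)
    show ?thesis using lk_interior[of u ys j] h j ne by simp
  qed
  have "\<exists>y\<in>set xs. card (lk u y) \<noteq> 2"
  proof (rule ccontr)
    assume "\<not> ?thesis"
    then have two: "\<And>y. y \<in> set xs \<Longrightarrow> card (lk u y) = 2" by blast
    then have "nbrs u \<subseteq> set xs" using closed_link[where S = "set xs", OF u(1) _ two xs(3)] xs(2) by force
    then show False using u two unfolding inner_def by blast
  qed
  then obtain y where y: "y \<in> set xs" "card (lk u y) \<noteq> 2" by blast
  have first: "card (lk u (hd ys)) = 1"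
    if ys: "link_path u ys" "\<And>y. y \<in> set ys \<Longrightarrow> lk u y \<subseteq> set ys" "length ys \<ge> 2" "y \<in> set ys" for ys
  proof -
    let ?n = "length ys"
    have hd: "hd ys = ys ! 0" using ys by (simp add: hd_conv_nth link_path_def)
    have dist: "distinct ys" using ys(1) by (simp add: link_path_def)
    have m1: "ys ! 1 \<in> lk u (ys ! 0)" using link_path_nth(1)[OF ys(1), of 0] ys(3) by simp
    then have "card (lk u (hd ys)) \<noteq> 0" using finite_lk hd by auto
    moreover have "card (lk u (hd ys)) \<noteq> 2"
    proof
      assume "card (lk u (hd ys)) = 2"
      then obtain z where z: "z \<in> lk u (ys ! 0)" "z \<noteq> ys ! 1" using m1 hd
        by (metis card_2_iff insertCI)
      have "ys ! 0 \<in> set ys" using ys(3) by (intro nth_mem) linarith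
      then have "z \<in> set ys" using ys(2) z(1) by blast
      then obtain j where j: "j < ?n" "z = ys ! j" by (metis in_set_conv_nth)
      have "j \<noteq> 0" using z j lk_distinct(2) by metis
      have "j \<noteq> 1" using z j by metis
      then obtain j' where j': "j = Suc (Suc j')" using \<open>j \<noteq> 0\<close> by (metis One_nat_def not0_implies_Suc)
      have closing: "ys ! 0 \<in> lk u (ys ! j)" using z(1) j(2) lk_sym by blast
      have "\<not> Suc j < ?n"
      proof
        assume s: "Suc j < ?n"
        then have "lk u (ys ! j) = {ys ! Suc j', ys ! Suc j}" using lk_interior[OF ys(1), of "Suc j'"] j' by simp
        then have "ys ! 0 = ys ! Suc j' \<or> ys ! 0 = ys ! Suc j" using closing by blast
        then show False using nth_eq_iff_index_eq[OF dist, of 0 "Suc j'"] nth_eq_iff_index_eq[OF dist, of 0 "Suc j"] s j'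
          by fastforce
      qed
      then have jn: "j = ?n - 1" using j by simp
      have pred: "ys ! Suc j' \<in> lk u (ys ! j)" using link_path_nth(2)[OF ys(1), of "Suc j'"] j' j by simp
      have "ys ! 0 \<noteq> ys ! Suc j'" using nth_eq_iff_index_eq[OF dist, of 0 "Suc j'"] j j' by fastforce
      then have "card {ys ! 0, ys ! Suc j'} = 2" by simp
      moreover have "{ys ! 0, ys ! Suc j'} \<subseteq> lk u (ys ! j)" using closing pred by simp
      ultimately have "card (lk u (ys ! j)) \<ge> 2" using card_mono[OF finite_lk] by metis
      then have "card (lk u (ys ! j)) = 2" using card_lk_le2[of u "ys ! j"] by simp
      then have all: "card (lk u (ys ! i)) = 2" if "i < ?n" for i
        using that int[OF ys(1), of i] \<open>card (lk u (hd ys)) = 2\<close> hd jn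
        by (metis One_nat_def Suc_pred bot_nat_0.not_eq_extremum dual_order.strict_trans1 less_Suc_eq_le order_le_less)
      then show False using y(2) ys(4) by (metis in_set_conv_nth)
    qed
    ultimately show ?thesis using card_lk_le2[of u "hd ys"] by linarith
  qed
  have long: "length xs \<ge> 2" if c: "card (lk u x) \<noteq> 0"
  proof -
    obtain z where z: "z \<in> lk u x" using c by (metis card.empty ex_in_conv)
    have "{x, z} \<subseteq> set xs" using xs(2) xs(3)[OF xs(2)] z by blast
    moreover have "card {x, z} = 2" using lk_distinct(2)[OF z] by simp
    ultimately show ?thesis by (metis List.finite_set card_length card_mono order_trans)
  qed
  have "length xs \<ge> 2 \<and> card (lk u (hd xs)) = 1 \<and> card (lk u (last xs)) = 1" if "card (lk u x) \<noteq> 0"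
  proof -
    have l: "length xs \<ge> 2" using long[OF that] .
    have "card (lk u (hd (rev xs))) = 1"
      by (rule first[OF link_path_rev[OF xs(1)]]) (use xs(3) l y in auto)
    moreover have "xs \<noteq> []" using l by auto
    ultimately show ?thesis using first[OF xs(1,3) l y(1)] l by (simp add: hd_rev)
  qed
  then show ?thesis using that[OF xs(1,2,3) _ int[OF xs(1)]] by blast
qed

end

section \<open>Counting around inner and outer vertices\<close>

lemma double_count:
  assumes "finite A" "finite B"
  shows "(\<Sum>a\<in>A. card {b \<in> B. R a b}) = (\<Sum>b\<in>B. card {a \<in> A. R a b})"
  by (rule sum_multicount_gen[OF assms]) simp

context fan_free_plane_graph
begin

text \<open>The component of a vertex of degree one in the link is a path with two ends and at most k - 2 interior vertices,
  and every vertex of degree two lies in such a component. The inequality counts the pairs of an end and an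
  interior vertex of the same component.\<close>

lemma outer_vertex_link:
  assumes u: "u \<in> V" "u \<notin> inner"
  shows "2 * card {x \<in> nbrs u. card (lk u x) = 2} \<le> (k - 2) * card {x \<in> nbrs u. card (lk u x) = 1}"
proof -
  let ?N1 = "{x \<in> nbrs u. card (lk u x) = 1}" and ?N2 = "{x \<in> nbrs u. card (lk u x) = 2}"
  define good where "good = (\<lambda>x xs. link_path u xs \<and> x \<in> set xs \<and> (\<forall>y\<in>set xs. lk u y \<subseteq> set xs) \<and>
    (card (lk u x) \<noteq> 0 \<longrightarrow> length xs \<ge> 2 \<and> card (lk u (hd xs)) = 1 \<and> card (lk u (last xs)) = 1))"
  define C where "C = (\<lambda>x. set (SOME xs. good x xs))"
  have ex: "\<exists>xs. good x xs" if "x \<in> nbrs u" for x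
    using link_component[OF u that] unfolding good_def by metis
  have some: "good x (SOME xs. good x xs)" if "x \<in> nbrs u" for x
    using someI_ex[OF ex[OF that]] .
  have closed: "lk u y \<subseteq> C x" if "x \<in> nbrs u" "y \<in> C x" for x y
    using some[OF that(1)] that(2) unfolding good_def C_def by blast
  have self: "x \<in> C x" if "x \<in> nbrs u" for x using some[OF that] unfolding good_def C_def by blast
  have mono: "C x \<subseteq> C y" if h: "x \<in> nbrs u" "y \<in> nbrs u" "z \<in> C x" "z \<in> C y" for x y z
  proof -
    have p: "link_path u (SOME xs. good x xs)" using some[OF h(1)] unfolding good_def by blast
    obtain i where i: "i < length (SOME xs. good x xs)" "(SOME xs. good x xs) ! i = z"
      using h(3) unfolding C_def by (metis in_set_conv_nth)
    have "set (SOME xs. good x xs) \<subseteq> C y"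
    proof (rule link_path_sub_closed[OF p _ i(1)])
      show "\<And>w. w \<in> C y \<Longrightarrow> lk u w \<subseteq> C y" using closed[OF h(2)] by blast
      show "(SOME xs. good x xs) ! i \<in> C y" using i(2) h(4) by simp
    qed
    then show ?thesis unfolding C_def[of] by (simp add: C_def)
  qed
  have fin: "finite ?N1" "finite ?N2" using finite_nbrs by simp_all
  have per1: "card {y \<in> ?N2. y \<in> C x} \<le> k - 2" if x: "x \<in> ?N1" for x
  proof -
    let ?xs = "SOME xs. good x xs"
    have g: "good x ?xs" using some x by blast
    then have p: "link_path u ?xs" "length ?xs \<ge> 2" "card (lk u (hd ?xs)) = 1" "card (lk u (last ?xs)) = 1"
      using x unfolding good_def by auto
    have ne: "?xs \<noteq> []" "distinct ?xs" using p(1) by (auto simp: link_path_def)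
    have hl: "hd ?xs \<noteq> last ?xs"
      using ne p(2) nth_eq_iff_index_eq[of ?xs 0 "length ?xs - 1"] by (simp add: hd_conv_nth last_conv_nth)
    have "{y \<in> ?N2. y \<in> C x} \<subseteq> set ?xs - {hd ?xs, last ?xs}" using p(3,4) unfolding C_def by auto
    then have "card {y \<in> ?N2. y \<in> C x} \<le> card (set ?xs - {hd ?xs, last ?xs})" by (intro card_mono) auto
    also have "\<dots> = card (set ?xs) - card {hd ?xs, last ?xs}" using ne(1) by (intro card_Diff_subset) auto
    also have "\<dots> = length ?xs - 2" using ne(2) hl by (simp add: distinct_card)
    also have "\<dots> \<le> k - 2" using link_path_length[OF p(1)] by simp
    finally show ?thesis .
  qed
  have per2: "2 \<le> card {x \<in> ?N1. y \<in> C x}" if y: "y \<in> ?N2" for y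
  proof -
    let ?xs = "SOME xs. good y xs"
    have g: "good y ?xs" using some y by blast
    then have p: "link_path u ?xs" "length ?xs \<ge> 2" "card (lk u (hd ?xs)) = 1" "card (lk u (last ?xs)) = 1"
      using y unfolding good_def by auto
    have ne: "?xs \<noteq> []" "distinct ?xs" using p(1) by (auto simp: link_path_def)
    have hl: "hd ?xs \<noteq> last ?xs"
      using ne p(2) nth_eq_iff_index_eq[of ?xs 0 "length ?xs - 1"] by (simp add: hd_conv_nth last_conv_nth)
    have sub: "set ?xs \<subseteq> nbrs u" using p(1) by (simp add: link_path_def)
    have "w \<in> {x \<in> ?N1. y \<in> C x}" if w: "w \<in> set ?xs" "card (lk u w) = 1" for w
    proof -
      have wn: "w \<in> nbrs u" using w sub by blast
      have "w \<in> C y" using w(1) by (simp add: C_def)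
      then have "C y \<subseteq> C w" using mono[OF _ wn _ self[OF wn]] y by blast
      then show ?thesis using self[of y] y w wn by blast
    qed
    then have hl': "{hd ?xs, last ?xs} \<subseteq> {x \<in> ?N1. y \<in> C x}" using p(3,4) ne(1) by simp
    have "finite {x \<in> ?N1. y \<in> C x}" by (rule finite_subset[OF _ fin(1)]) blast
    then have "card {hd ?xs, last ?xs} \<le> card {x \<in> ?N1. y \<in> C x}" using hl' by (rule card_mono)
    then show ?thesis using hl by simp
  qed
  have "2 * card ?N2 = (\<Sum>y\<in>?N2. 2)" by simp
  also have "\<dots> \<le> (\<Sum>y\<in>?N2. card {x \<in> ?N1. y \<in> C x})" using per2 by (rule sum_mono)
  also have "\<dots> = (\<Sum>x\<in>?N1. card {y \<in> ?N2. y \<in> C x})"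
    by (rule double_count[OF fin(2,1)])
  also have "\<dots> \<le> (\<Sum>x\<in>?N1. k - 2)" using per1 by (rule sum_mono)
  finally show ?thesis by (simp add: mult.commute)
qed

text \<open>Ordered pairs, so that sums of degrees become cardinalities; edges inside a set count twice.\<close>

definition pairs_between :: "'a set \<Rightarrow> 'a set \<Rightarrow> ('a \<times> 'a) set" where
  "pairs_between P Q = {(x, y). x \<in> P \<and> y \<in> Q \<and> {x, y} \<in> E}"

lemma finite_pairs: "finite (pairs_between P Q)"
proof (rule finite_subset)
  show "pairs_between P Q \<subseteq> V \<times> V" using edge_in_V by (auto simp: pairs_between_def)
qed (simp add: finite_V)

lemma pairs_split:
  assumes "Q1 \<inter> Q2 = {}"
  shows "card (pairs_between P (Q1 \<union> Q2)) = card (pairs_between P Q1) + card (pairs_between P Q2)"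
    "card (pairs_between (Q1 \<union> Q2) P) = card (pairs_between Q1 P) + card (pairs_between Q2 P)"
proof -
  have "pairs_between P (Q1 \<union> Q2) = pairs_between P Q1 \<union> pairs_between P Q2"
    "pairs_between (Q1 \<union> Q2) P = pairs_between Q1 P \<union> pairs_between Q2 P"
    by (auto simp: pairs_between_def)
  moreover have "pairs_between P Q1 \<inter> pairs_between P Q2 = {}" "pairs_between Q1 P \<inter> pairs_between Q2 P = {}"
    using assms by (auto simp: pairs_between_def)
  ultimately show "card (pairs_between P (Q1 \<union> Q2)) = card (pairs_between P Q1) + card (pairs_between P Q2)"
    "card (pairs_between (Q1 \<union> Q2) P) = card (pairs_between Q1 P) + card (pairs_between Q2 P)"
    by (simp_all add: card_Un_disjoint finite_pairs)
qed

lemma pairs_sym: "card (pairs_between P Q) = card (pairs_between Q P)"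
proof (rule bij_betw_same_card)
  show "bij_betw prod.swap (pairs_between P Q) (pairs_between Q P)"
    by (rule bij_betw_byWitness[of _ prod.swap]) (auto simp: pairs_between_def insert_commute)
qed

lemma sum_pairs: "finite P \<Longrightarrow> (\<Sum>q\<in>pairs_between P Q. f (fst q) (snd q)) = (\<Sum>x\<in>P. \<Sum>y\<in>nbrs x \<inter> Q. f x y)"
proof -
  assume P: "finite P"
  have "pairs_between P Q = (SIGMA x:P. nbrs x \<inter> Q)" by (auto simp: pairs_between_def nbrs_def)
  then show ?thesis using P finite_nbrs by (subst sum.Sigma) (auto simp: case_prod_beta)
qed

lemma card_pairs: "finite P \<Longrightarrow> card (pairs_between P Q) = (\<Sum>x\<in>P. card (nbrs x \<inter> Q))"
  using sum_pairs[where P = P and Q = Q and f = "\<lambda>_ _. 1 :: nat"] by simp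

lemma card_pairs_within: "card (pairs_between C C) = 2 * card {e \<in> E. e \<subseteq> C}"
proof -
  have "(\<Sum>q\<in>pairs_between C C. card {e \<in> {e \<in> E. e \<subseteq> C}. e = {fst q, snd q}})
      = (\<Sum>e\<in>{e \<in> E. e \<subseteq> C}. card {q \<in> pairs_between C C. e = {fst q, snd q}})"
    by (rule double_count) (simp_all add: finite_pairs finite_E)
  moreover have "card {e \<in> {e \<in> E. e \<subseteq> C}. e = {fst q, snd q}} = 1" if "q \<in> pairs_between C C" for q
  proof -
    have "{e \<in> {e \<in> E. e \<subseteq> C}. e = {fst q, snd q}} = {{fst q, snd q}}" using that by (auto simp: pairs_between_def)
    then show ?thesis by simp
  qed
  moreover have "card {q \<in> pairs_between C C. e = {fst q, snd q}} = 2" if "e \<in> {e \<in> E. e \<subseteq> C}" for e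
  proof -
    have "card e = 2" using that edge_card by blast
    then obtain a b where e: "e = {a, b}" "a \<noteq> b" unfolding card_2_iff by (elim exE conjE)
    have "{q \<in> pairs_between C C. e = {fst q, snd q}} = {(a, b), (b, a)}"
      using that e by (auto simp: pairs_between_def doubleton_eq_iff insert_commute)
    then show ?thesis using e by simp
  qed
  ultimately show ?thesis by simp
qed

text \<open>An edge together with a facial triangle at it is counted from the side of the edge and from the side of the
  triangle.\<close>

lemma sum_lk_pairs:
  "(\<Sum>q\<in>pairs_between P Q. card (lk (fst q) (snd q))) = (\<Sum>t\<in>T. card {(x, y). x \<in> t \<inter> P \<and> y \<in> t \<inter> Q \<and> x \<noteq> y})"
proof -
  have "(\<Sum>q\<in>pairs_between P Q. card (lk (fst q) (snd q))) = (\<Sum>q\<in>pairs_between P Q. card {t \<in> T. fst q \<in> t \<and> snd q \<in> t})"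
    by (rule sum.cong) (auto simp: pairs_between_def edge_distinct card_lk)
  also have "\<dots> = (\<Sum>t\<in>T. card {q \<in> pairs_between P Q. fst q \<in> t \<and> snd q \<in> t})"
    by (rule double_count[OF finite_pairs finite_facial_triangles])
  also have "\<dots> = (\<Sum>t\<in>T. card {(x, y). x \<in> t \<inter> P \<and> y \<in> t \<inter> Q \<and> x \<noteq> y})"
  proof (rule sum.cong)
    fix t assume t: "t \<in> T"
    have "{q \<in> pairs_between P Q. fst q \<in> t \<and> snd q \<in> t} = {(x, y). x \<in> t \<inter> P \<and> y \<in> t \<inter> Q \<and> x \<noteq> y}"
      using T_edge[OF t] edge_distinct by (auto simp: pairs_between_def)
    then show "card {q \<in> pairs_between P Q. fst q \<in> t \<and> snd q \<in> t} = card {(x, y). x \<in> t \<inter> P \<and> y \<in> t \<inter> Q \<and> x \<noteq> y}"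
      by simp
  qed simp
  finally show ?thesis .
qed

lemma card_offdiag: "finite A \<Longrightarrow> card {(x, y). x \<in> A \<and> y \<in> A \<and> x \<noteq> y} = card A * (card A - 1)"
proof -
  assume A: "finite A"
  have "{(x, y). x \<in> A \<and> y \<in> A \<and> x \<noteq> y} = A \<times> A - (\<lambda>x. (x, x)) ` A" by auto
  moreover have "card ((\<lambda>x. (x, x)) ` A) = card A" by (rule card_image) (simp add: inj_on_def)
  ultimately show ?thesis using A by (simp add: card_Diff_subset image_subset_iff card_cartesian_product diff_mult_distrib2)
qed

lemma sum_lk_all: "(\<Sum>q\<in>pairs_between V V. card (lk (fst q) (snd q))) = 6 * card T"
proof -
  have "card {(x, y). x \<in> t \<inter> V \<and> y \<in> t \<inter> V \<and> x \<noteq> y} = 6" if t: "t \<in> T" for t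
  proof -
    have "t \<inter> V = t" using T_sub[OF t] by blast
    then show ?thesis using card_offdiag[of t] T_card[OF t] by (simp add: card_ge_0_finite)
  qed
  then show ?thesis by (simp add: sum_lk_pairs)
qed

text \<open>Each edge at an inner vertex lies in exactly two facial triangles, and a facial triangle with i vertices in C
  has i (i - 1) ordered sides inside C and i (3 - i) ordered sides from C to its complement.\<close>

lemma inner_component_counts:
  assumes C: "C \<subseteq> inner"
  defines "n \<equiv> \<lambda>i. card {t \<in> T. card (t \<inter> C) = i}"
  shows "card (pairs_between C C) = 3 * n 3 + n 2" "card (pairs_between C (V - C)) = n 2 + n 1"
proof -
  have two: "card (lk (fst q) (snd q)) = 2" if "q \<in> pairs_between C Q" for q Q
    using that C unfolding pairs_between_def inner_def nbrs_def by auto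
  have sumT: "(\<Sum>t\<in>T. h (card (t \<inter> C))) = h 0 * n 0 + h 1 * n 1 + h 2 * n 2 + h 3 * n 3" for h :: "nat \<Rightarrow> nat"
  proof -
    have fin: "finite T" by (rule finite_facial_triangles)
    have "card (t \<inter> C) \<in> {0, 1, 2, 3}" if "t \<in> T" for t
    proof -
      have "card (t \<inter> C) \<le> card t" using T_card[OF that] by (intro card_mono) (auto simp: card_ge_0_finite)
      then show ?thesis using T_card[OF that] by auto
    qed
    then have "(\<Sum>t\<in>T. h (card (t \<inter> C))) = (\<Sum>i\<in>{0, 1, 2, 3}. \<Sum>t\<in>{t \<in> T. card (t \<inter> C) = i}. h (card (t \<inter> C)))"
    proof -
      have sub: "(\<lambda>t. card (t \<inter> C)) ` T \<subseteq> {0, 1, 2, 3}"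
        by (rule image_subsetI) (rule \<open>\<And>t. t \<in> T \<Longrightarrow> card (t \<inter> C) \<in> {0, 1, 2, 3}\<close>)
      show ?thesis
        by (rule sum.group[OF fin _ sub, of "\<lambda>t. h (card (t \<inter> C))", symmetric]) simp
    qed
    also have "\<dots> = (\<Sum>i\<in>{0, 1, 2, 3}. h i * n i)"
      unfolding n_def by (intro sum.cong) auto
    finally show ?thesis by simp
  qed
  have "2 * card (pairs_between C C) = (\<Sum>q\<in>pairs_between C C. card (lk (fst q) (snd q)))"
    using two[of _ C] by simp
  also have "\<dots> = (\<Sum>t\<in>T. card (t \<inter> C) * (card (t \<inter> C) - 1))"
    unfolding sum_lk_pairs
  proof (rule sum.cong)
    fix t assume "t \<in> T"
    then have "finite (t \<inter> C)" using T_card[of t] by (simp add: card_ge_0_finite)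
    then show "card {(x, y). x \<in> t \<inter> C \<and> y \<in> t \<inter> C \<and> x \<noteq> y} = card (t \<inter> C) * (card (t \<inter> C) - 1)"
      by (rule card_offdiag)
  qed simp
  also have "\<dots> = 6 * n 3 + 2 * n 2" using sumT[of "\<lambda>m. m * (m - 1)"] by simp
  finally show "card (pairs_between C C) = 3 * n 3 + n 2" by simp
  have "2 * card (pairs_between C (V - C)) = (\<Sum>q\<in>pairs_between C (V - C). card (lk (fst q) (snd q)))"
    using two[of _ "V - C"] by simp
  also have "\<dots> = (\<Sum>t\<in>T. card (t \<inter> C) * (3 - card (t \<inter> C)))"
    unfolding sum_lk_pairs
  proof (rule sum.cong)
    fix t assume t: "t \<in> T"
    have "{(x, y). x \<in> t \<inter> C \<and> y \<in> t \<inter> (V - C) \<and> x \<noteq> y} = (t \<inter> C) \<times> (t - t \<inter> C)" using T_sub[OF t] by auto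
    moreover have "finite t" using T_card[OF t] by (simp add: card_ge_0_finite)
    ultimately show "card {(x, y). x \<in> t \<inter> C \<and> y \<in> t \<inter> (V - C) \<and> x \<noteq> y} = card (t \<inter> C) * (3 - card (t \<inter> C))"
      using T_card[OF t] by (simp add: card_cartesian_product card_Diff_subset)
  qed simp
  also have "\<dots> = 2 * n 2 + 2 * n 1" using sumT[of "\<lambda>m. m * (3 - m)"] by simp
  finally show "card (pairs_between C (V - C)) = n 2 + n 1" by simp
qed

end

context fan_free_plane_graph
begin

text \<open>Unions of components of the subgraph induced by the inner vertices.\<close>

definition inner_closed :: "'a set \<Rightarrow> bool" where
  "inner_closed C \<longleftrightarrow> C \<subseteq> inner \<and> (\<forall>x\<in>C. nbrs x \<inter> inner \<subseteq> C)"

text \<open>A vertex u outside C with a neighbour c in C is not inner, so the component of c in the link of u is a path with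
  ends of degree one, and such ends are not inner. Following the path from c in both directions it leaves C twice,
  at different vertices.\<close>

lemma two_link_edges_at_boundary:
  assumes C: "inner_closed C" and u: "u \<in> V - C" and c: "c \<in> C" "c \<in> nbrs u"
  obtains y1 y2 c1 c2 where "y1 \<noteq> y2" "y1 \<notin> C" "y2 \<notin> C" "y1 \<noteq> u" "y2 \<noteq> u" "c1 \<in> C" "c2 \<in> C"
    "{u, y1, c1} \<in> T" "{u, y2, c2} \<in> T"
proof -
  have uo: "u \<in> V" "u \<notin> inner" using C u c nbrs_sym unfolding inner_closed_def by blast+
  have in2: "card (lk u x) = 2" if "x \<in> nbrs u" "x \<in> inner" for x
  proof -
    have "lk u x = lk x u" by (simp add: lk_def insert_commute)
    moreover have "u \<in> nbrs x" using that nbrs_sym by blast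
    ultimately show ?thesis using that(2) by (simp add: inner_def)
  qed
  have cin: "c \<in> inner" using C c unfolding inner_closed_def by blast
  obtain xs where xs: "link_path u xs" "c \<in> set xs"
    "card (lk u c) \<noteq> 0 \<Longrightarrow> length xs \<ge> 2 \<and> card (lk u (hd xs)) = 1 \<and> card (lk u (last xs)) = 1"
    using link_component[OF uo c(2)] by metis
  have l: "length xs \<ge> 2" "card (lk u (hd xs)) = 1" "card (lk u (last xs)) = 1"
    using xs(3) in2[OF c(2) cin] by simp_all
  have ne: "xs \<noteq> []" and dist: "distinct xs" and sub: "set xs \<subseteq> nbrs u" using xs(1) by (auto simp: link_path_def)
  have "hd xs \<in> nbrs u" "last xs \<in> nbrs u" using ne sub by auto
  then have "hd xs \<notin> inner" "last xs \<notin> inner"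
    using in2[of "hd xs"] in2[of "last xs"] l(2,3) by auto
  then have hC: "xs ! 0 \<notin> C" "xs ! (length xs - 1) \<notin> C"
    using C ne unfolding inner_closed_def by (auto simp: hd_conv_nth last_conv_nth)
  obtain i where i: "i < length xs" "xs ! i = c" using xs(2) by (metis in_set_conv_nth)
  \<comment> \<open>Walk along the link path from c to both sides until it leaves C.\<close>
  define l0 where "l0 = Max {j. j < i \<and> xs ! j \<notin> C}"
  have i0: "i \<noteq> 0" "i \<noteq> length xs - 1" using hC i c by metis+
  have L: "{j. j < i \<and> xs ! j \<notin> C} \<noteq> {}" "finite {j. j < i \<and> xs ! j \<notin> C}" using i0 hC by auto
  have l0: "l0 < i" "xs ! l0 \<notin> C" using Max_in[OF L(2,1)] unfolding l0_def by auto
  have l1: "xs ! Suc l0 \<in> C"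
  proof (rule ccontr)
    assume a: "xs ! Suc l0 \<notin> C"
    then have "Suc l0 \<noteq> i" using i c by metis
    then have "Suc l0 \<in> {j. j < i \<and> xs ! j \<notin> C}" using a l0 by simp
    then have "Suc l0 \<le> l0" unfolding l0_def using Max_ge[OF L(2)] by blast
    then show False by simp
  qed
  define r0 where "r0 = Min {j. i < j \<and> j < length xs \<and> xs ! j \<notin> C}"
  have "length xs - 1 \<in> {j. i < j \<and> j < length xs \<and> xs ! j \<notin> C}" using i i0 hC by auto
  then have R: "{j. i < j \<and> j < length xs \<and> xs ! j \<notin> C} \<noteq> {}" "finite {j. i < j \<and> j < length xs \<and> xs ! j \<notin> C}"
    by blast simp
  have r0: "i < r0" "r0 < length xs" "xs ! r0 \<notin> C" using Min_in[OF R(2,1)] unfolding r0_def by auto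
  obtain r1 where r1: "r0 = Suc r1" using r0(1) by (metis less_imp_Suc_add)
  have rC: "xs ! r1 \<in> C"
  proof (rule ccontr)
    assume a: "xs ! r1 \<notin> C"
    then have "r1 \<noteq> i" using i c by metis
    then have "r1 \<in> {j. i < j \<and> j < length xs \<and> xs ! j \<notin> C}" using a r0 r1 by simp
    then have "r0 \<le> r1" unfolding r0_def using Min_le[OF R(2)] by blast
    then show False using r1 by simp
  qed
  have "xs ! l0 \<noteq> xs ! r0" using nth_eq_iff_index_eq[OF dist, of l0 r0] l0 r0 by simp
  moreover have "xs ! l0 \<in> lk u (xs ! Suc l0)" using link_path_nth(2)[OF xs(1), of l0] l0 i by simp
  moreover have "xs ! r0 \<in> lk u (xs ! r1)" using link_path_nth(1)[OF xs(1), of r1] r0 r1 by simp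
  ultimately show ?thesis
    using that[of "xs ! l0" "xs ! r0" "xs ! Suc l0" "xs ! r1"] l0 l1 r0 rC lk_distinct(3)
    by (auto simp: lk_def insert_commute)
qed

text \<open>The sides opposite to C of the triangles with exactly one vertex in C form a graph in which every vertex has at
  least two neighbours. Such a graph has at least three edges.\<close>

lemma boundary_triangles:
  assumes C: "inner_closed C" and u: "u \<in> V - C" and c: "c \<in> C" "c \<in> nbrs u"
  shows "3 \<le> card {t \<in> T. card (t \<inter> C) = 1}"
proof -
  let ?T1 = "{t \<in> T. card (t \<inter> C) = 1}"
  have T1: "{u, y} \<in> (\<lambda>t. t - C) ` ?T1" if "{u, y, c} \<in> T" "u \<notin> C" "y \<notin> C" "c \<in> C" for u y c
  proof -
    have "{u, y, c} \<inter> C = {c}" "{u, y, c} - C = {u, y}" using that by auto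
    then show ?thesis using that(1) by (intro image_eqI[of _ _ "{u, y, c}"]) auto
  qed
  obtain y1 y2 c1 c2 where y: "y1 \<noteq> y2" "y1 \<notin> C" "y2 \<notin> C" "y1 \<noteq> u" "y2 \<noteq> u" "c1 \<in> C" "c2 \<in> C"
    "{u, y1, c1} \<in> T" "{u, y2, c2} \<in> T"
    using two_link_edges_at_boundary[OF C u c] .
  have "y1 \<in> V - C" using T_sub[OF y(8)] y(2) by blast
  moreover have "c1 \<in> nbrs y1" using lk_edges(2)[of c1 u y1] y(8) by (simp add: lk_def nbrs_def)
  ultimately obtain z1 z2 d1 d2 where z: "z1 \<noteq> z2" "z1 \<notin> C" "z2 \<notin> C" "z1 \<noteq> y1" "z2 \<noteq> y1" "d1 \<in> C" "d2 \<in> C"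
    "{y1, z1, d1} \<in> T" "{y1, z2, d2} \<in> T"
    using two_link_edges_at_boundary[OF C _ y(6), of y1] by metis
  obtain z d where zd: "z \<noteq> u" "z \<notin> C" "z \<noteq> y1" "d \<in> C" "{y1, z, d} \<in> T" using z by metis
  have sub: "{{u, y1}, {u, y2}, {y1, z}} \<subseteq> (\<lambda>t. t - C) ` ?T1"
    using T1[OF y(8)] T1[OF y(9)] T1[OF zd(5)] u y zd by simp
  have three: "card {{u, y1}, {u, y2}, {y1, z}} = 3"
    using y(1,4,5) zd(1,3) by (simp add: card_insert_if doubleton_eq_iff)
  have "finite ((\<lambda>t. t - C) ` ?T1)" using finite_facial_triangles by simp
  from card_mono[OF this sub] have "3 \<le> card ((\<lambda>t. t - C) ` ?T1)" unfolding three .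
  also have "\<dots> \<le> card ?T1" using finite_facial_triangles by (intro card_image_le) simp
  finally show ?thesis .
qed

text \<open>Otherwise the edges inside C are closed under facial triangles, so they are all edges, and every vertex is in C.\<close>

lemma leaving_edge:
  assumes C: "inner_closed C" "C \<noteq> {}" and V: "inner \<noteq> V"
  shows "\<exists>u\<in>V - C. \<exists>c\<in>C. c \<in> nbrs u"
proof (rule ccontr)
  assume no: "\<not> ?thesis"
  have CV: "C \<subseteq> V" "C \<subseteq> inner" using C by (auto simp: inner_closed_def inner_def)
  have stay: "nbrs x \<subseteq> C" if "x \<in> C" for x using no that nbrs_sub nbrs_sym by blast
  let ?D = "{e \<in> E. e \<subseteq> C}"
  obtain x where x: "x \<in> C" using C by blast
  have edge_C: "e \<subseteq> C" if e: "e \<in> E" "x \<in> e" "x \<in> C" for e x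
  proof -
    obtain a b where ab: "e = {a, b}" using edge_card[OF e(1)] card_2_iff by metis
    then have "e = {x, a} \<or> e = {x, b}" using e(2) by (auto simp: insert_commute)
    then show ?thesis using stay[OF e(3)] e(1,3) unfolding nbrs_def by auto
  qed
  obtain e where e: "e \<in> E" "x \<in> e" using no_isolated x CV by blast
  have "?D = E"
  proof (rule edges_closed_under_facial_triangles[OF card_V])
    show "?D \<subseteq> E" by blast
    show "?D \<noteq> {}" using e edge_C[OF e x] by blast
    fix e assume e: "e \<in> ?D"
    then have "card e = 2" using edge_card by blast
    then obtain a b where ab: "e = {a, b}" unfolding card_2_iff by (elim exE conjE)
    then have a: "a \<in> C" "b \<in> nbrs a" using e by (auto simp: nbrs_def)
    have "card (lk a b) = 2" using a CV unfolding inner_def by blast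
    then obtain t1 t2 where t: "t1 \<in> T" "t2 \<in> T" "t1 \<noteq> t2" "{a, b} \<in> pairs_in t1" "{a, b} \<in> pairs_in t2"
      using two_triangles by blast
    have "pairs_in t \<subseteq> ?D" if t: "t \<in> T" "{a, b} \<in> pairs_in t" for t
    proof -
      have "t \<subseteq> C"
      proof
        fix y assume "y \<in> t"
        moreover have "a \<in> t" using t(2) by (auto simp: pairs_in_def)
        ultimately have "y = a \<or> y \<in> nbrs a" using T_edge[OF t(1)] by (auto simp: nbrs_def)
        then show "y \<in> C" using a stay by blast
      qed
      then show ?thesis using T_triangle[OF t(1)] by (auto simp: is_triangle_def pairs_in_def)
    qed
    then show "\<exists>t1\<in>T. \<exists>t2\<in>T. t1 \<noteq> t2 \<and> e \<in> pairs_in t1 \<and> e \<in> pairs_in t2 \<and> pairs_in t1 \<subseteq> ?D \<and> pairs_in t2 \<subseteq> ?D"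
      using t unfolding ab by blast
  qed
  then have "V \<subseteq> C" using no_isolated by blast
  then show False using CV V unfolding inner_def by blast
qed

lemma minimal_inner_closed_connected:
  assumes C: "inner_closed C" and min: "\<And>S. inner_closed S \<Longrightarrow> S \<noteq> {} \<Longrightarrow> S \<subseteq> C \<Longrightarrow> S = C"
  shows "connected_in C"
  unfolding connected_in_def
proof (intro allI impI)
  fix S assume S: "S \<subset> C" "S \<noteq> {}"
  show "\<exists>x\<in>S. \<exists>y\<in>C - S. {x, y} \<in> E"
  proof (rule ccontr)
    assume no: "\<not> ?thesis"
    have "inner_closed S"
      unfolding inner_closed_def
    proof (intro conjI ballI)
      show "S \<subseteq> inner" using S C unfolding inner_closed_def by blast
      fix x assume x: "x \<in> S"
      have "nbrs x \<inter> inner \<subseteq> C" using x S C unfolding inner_closed_def by blast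
      then show "nbrs x \<inter> inner \<subseteq> S" using no x unfolding nbrs_def by blast
    qed
    then show False using min S by blast
  qed
qed

text \<open>In words, at least 3 card W edges meet W. By additivity it is enough to consider a component C. Let n3, n2 and
  n1 be the numbers of facial triangles with three, two and one vertices in C, let e be the number of edges inside
  C and e' the number of edges that leave C. Euler's formula for C gives card C + n3 <= e + 1, and counting sides
  gives 2 e = 3 n3 + n2 and e' = n2 + n1. Since n1 is at least 3, it follows that 3 card C <= e + e'.\<close>

lemma inner_isoperimetric:
  assumes V: "inner \<noteq> V" and W: "inner_closed W"
  shows "6 * card W \<le> card (pairs_between W W) + 2 * card (pairs_between W (V - W))"
proof -
  have "W \<subseteq> V" using W unfolding inner_closed_def inner_def by blast
  then have "finite W" using finite_V by (rule finite_subset)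
  then show ?thesis using W
  proof (induction W rule: finite_psubset_induct)
    case (psubset W)
    show ?case
    proof (cases "W = {}")
      case False
      have "\<exists>C. inner_closed C \<and> C \<noteq> {} \<and> C \<subseteq> W \<and> (\<forall>S. inner_closed S \<longrightarrow> S \<noteq> {} \<longrightarrow> S \<subseteq> C \<longrightarrow> S = C)"
        using psubset.hyps(1) psubset.prems False
      proof (induction W rule: finite_psubset_induct)
        case (psubset W)
        show ?case
        proof (cases "\<exists>S. inner_closed S \<and> S \<noteq> {} \<and> S \<subset> W")
          case True
          then obtain S where "inner_closed S" "S \<noteq> {}" "S \<subset> W" by blast
          then show ?thesis using psubset.IH[of S] by (meson order_trans psubset_imp_subset)
        next
          case False
          then show ?thesis using psubset.prems by (intro exI[of _ W]) blast
        qed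
      qed
      then obtain C where C: "inner_closed C" "C \<noteq> {}" "C \<subseteq> W"
        and min: "\<And>S. inner_closed S \<Longrightarrow> S \<noteq> {} \<Longrightarrow> S \<subseteq> C \<Longrightarrow> S = C" by blast
      have CV: "C \<subseteq> V" "C \<subseteq> inner" "W \<subseteq> inner" "W \<subseteq> V" using C psubset.prems by (auto simp: inner_closed_def inner_def)
      have finW: "finite W" using psubset.hyps(1) .
      obtain u c where uc: "u \<in> V - C" "c \<in> C" "c \<in> nbrs u" using leaving_edge[OF C(1,2) V] by blast
      define n where "n = (\<lambda>i. card {t \<in> T. card (t \<inter> C) = i})"
      have cnt: "card (pairs_between C C) = 3 * n 3 + n 2" "card (pairs_between C (V - C)) = n 2 + n 1"
        using inner_component_counts[OF CV(2)] unfolding n_def by simp_all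
      have n1: "3 \<le> n 1" using boundary_triangles[OF C(1) uc] unfolding n_def .
      have n3: "{t \<in> T. card (t \<inter> C) = 3} = {t \<in> T. t \<subseteq> C}"
      proof (intro Collect_cong conj_cong refl)
        fix t assume t: "t \<in> T"
        have fin: "finite t" using T_card[OF t] by (simp add: card_ge_0_finite)
        show "card (t \<inter> C) = 3 \<longleftrightarrow> t \<subseteq> C"
          using card_subset_eq[OF fin, of "t \<inter> C"] T_card[OF t] by (metis Int_lower1 inf.absorb_iff1)
      qed
      have "card C + n 3 \<le> card {e \<in> E. e \<subseteq> C} + 1"
        unfolding n_def n3
      proof (rule facial_triangles_in_connected_part[OF card_V CV(1) C(2) minimal_inner_closed_connected[OF C(1) min]])
        show "{u, c} \<in> E" using uc(3) by (simp add: nbrs_def)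
        show "\<not> {u, c} \<subseteq> C" using uc(1) by blast
      qed
      then have one: "6 * card C \<le> card (pairs_between C C) + 2 * card (pairs_between C (V - C))"
        using card_pairs_within[of C] cnt n1 by linarith
      \<comment> \<open>No edge joins C to the rest of W, so both sides of the inequality are additive.\<close>
      let ?W = "W - C"
      have cl: "inner_closed ?W"
        unfolding inner_closed_def
      proof (intro conjI ballI subsetI)
        show "x \<in> inner" if "x \<in> ?W" for x using that CV by blast
        fix x y assume x: "x \<in> ?W" and y: "y \<in> nbrs x \<inter> inner"
        have "y \<in> W" using x y psubset.prems unfolding inner_closed_def by blast
        moreover have "y \<notin> C"
        proof
          assume "y \<in> C"
          moreover have "x \<in> nbrs y" using y nbrs_sym by blast
          ultimately have "x \<in> C" using C(1) x CV unfolding inner_closed_def by blast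
          then show False using x by blast
        qed
        ultimately show "y \<in> ?W" by blast
      qed
      have "?W \<subset> W" using C by blast
      then have two: "6 * card ?W \<le> card (pairs_between ?W ?W) + 2 * card (pairs_between ?W (V - ?W))"
        using psubset.IH cl by blast
      have none: "{x, y} \<notin> E" "{y, x} \<notin> E" if "x \<in> C" "y \<in> ?W" for x y
      proof -
        show "{x, y} \<notin> E" using that C(1) CV unfolding inner_closed_def nbrs_def by blast
        then show "{y, x} \<notin> E" by (simp add: insert_commute)
      qed
      have p1: "pairs_between W W = pairs_between C C \<union> pairs_between ?W ?W" "pairs_between C C \<inter> pairs_between ?W ?W = {}"
        using none C(3) unfolding pairs_between_def by auto
      have p2: "pairs_between W (V - W) = pairs_between C (V - C) \<union> pairs_between ?W (V - ?W)"
        "pairs_between C (V - C) \<inter> pairs_between ?W (V - ?W) = {}"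
        using none C(3) unfolding pairs_between_def by auto
      have "card W = card C + card ?W" using C(3) finW by (metis card_Diff_subset card_mono finite_subset le_add_diff_inverse)
      moreover have "card (pairs_between W W) = card (pairs_between C C) + card (pairs_between ?W ?W)"
        using p1 card_Un_disjoint[OF finite_pairs finite_pairs] by metis
      moreover have "card (pairs_between W (V - W)) = card (pairs_between C (V - C)) + card (pairs_between ?W (V - ?W))"
        using p2 card_Un_disjoint[OF finite_pairs finite_pairs] by metis
      ultimately show ?thesis using one two by linarith
    qed (simp add: pairs_between_def)
  qed
qed

text \<open>This bound covers the graphs that are too small for the next one.\<close>

lemma card_E_le: "card E \<le> 3 * card V - 6"
proof -
  have "6 * card T = (\<Sum>q\<in>pairs_between V V. card (lk (fst q) (snd q)))" using sum_lk_all by simp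
  also have "\<dots> \<le> (\<Sum>q\<in>pairs_between V V. 2)" using card_lk_le2 by (intro sum_mono) blast
  also have "\<dots> = 4 * card E"
  proof -
    have "{e \<in> E. e \<subseteq> V} = E" using edge_sub by blast
    then show ?thesis using card_pairs_within[of V] by simp
  qed
  finally show ?thesis using edges_bound_by_facial_triangles[OF card_V no_isolated] by linarith
qed

text \<open>Let A and B be the sets of inner and of outer vertices, and let b = 2 card E - 3 card T be the number of sides
  of edges that are not on a facial triangle. At each outer vertex u with degree d and with a inner neighbours the
  link estimate bounds (6 - k) d + k a by 2 k times the defect of u, and the defects sum up to 2 b. The degrees in
  A are at most k, which together with the isoperimetric inequality shows that the inner degrees, weighted by 6 -
  k, are paid for by the terms k a. Hence 2 (6 - k) card E <= 4 k b, that is, 6 k card T <= (5 k - 6) card E, and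
  Euler's formula turns this into the claim. If all vertices are inner, all degrees are at most k, and this alone
  is enough.\<close>

lemma fan_free_edge_bound:
  assumes n: "(6 - k) * card V > 12"
  shows "(7 * k + 6) * card E + 48 * k \<le> 24 * k * card V"
proof -
  have EV: "card (pairs_between V V) = 2 * card E"
  proof -
    have "{e \<in> E. e \<subseteq> V} = E" using edge_sub by blast
    then show ?thesis using card_pairs_within[of V] by simp
  qed
  have euler: "2 * card E + 8 \<le> 4 * card V + card T"
    by (rule edges_bound_by_facial_triangles[OF card_V no_isolated])
  show ?thesis
  proof (cases "inner = V")
    case True
    have "nbrs x \<inter> V = nbrs x" for x using nbrs_sub by blast
    then have "2 * card E = (\<Sum>x\<in>V. card (nbrs x))" using EV card_pairs[OF finite_V, of V] by simp
    also have "\<dots> \<le> (\<Sum>x\<in>V. k)" using inner_degree True by (intro sum_mono) blast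
    finally have deg: "2 * card E \<le> card V * k" by simp
    \<comment> \<open>For k = 5 and 13 vertices the bound holds only because the number of edges is an integer.\<close>
    show ?thesis
    proof (cases "k = 5")
      case True
      then have "2 * card E \<le> card V * 5" "12 < card V" using deg n by simp_all
      then have "41 * card E + 240 \<le> 120 * card V"
      proof (cases "card V = 13")
        case True
        then have "card E \<le> 32" using \<open>2 * card E \<le> card V * 5\<close> by simp
        then show ?thesis using True by simp
      qed linarith
      then show ?thesis using True by simp
    next
      case False
      then show ?thesis using deg n k by auto
    qed
  next
    case False
    let ?A = "inner" and ?B = "V - inner"
    let ?p = "\<lambda>P Q. card (pairs_between P Q)"
    have AV: "?A \<subseteq> V" and AB: "V = ?A \<union> ?B" "?A \<inter> ?B = {}" by (auto simp: inner_def)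
    have finA: "finite ?A" "finite ?B" using finite_V AV finite_subset by auto
    have iso: "6 * card ?A \<le> ?p ?A ?A + 2 * ?p ?A ?B"
      by (rule inner_isoperimetric[OF False]) (simp add: inner_closed_def)
    have split: "?p V V = ?p ?A ?A + 2 * ?p ?A ?B + ?p ?B ?B"
    proof -
      have "?p V V = ?p ?A V + ?p ?B V" using pairs_split(2)[OF AB(2), of V] AB(1) by simp
      also have "?p ?A V = ?p ?A ?A + ?p ?A ?B" using pairs_split(1)[OF AB(2), of ?A] AB(1) by simp
      also have "?p ?B V = ?p ?B ?A + ?p ?B ?B" using pairs_split(1)[OF AB(2), of ?B] AB(1) by simp
      finally show ?thesis using pairs_sym[of ?B ?A] by simp
    qed
    have degA: "?p ?A ?A + ?p ?A ?B \<le> k * card ?A"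
    proof -
      have "?p ?A ?A + ?p ?A ?B = ?p ?A V" using pairs_split(1)[OF AB(2), of ?A] AB(1) by simp
      also have "\<dots> = (\<Sum>x\<in>?A. card (nbrs x \<inter> V))" by (rule card_pairs[OF finA(1)])
      also have "\<dots> \<le> (\<Sum>x\<in>?A. k)"
      proof (rule sum_mono)
        fix x assume "x \<in> ?A"
        moreover have "nbrs x \<inter> V = nbrs x" using nbrs_sub by blast
        ultimately show "card (nbrs x \<inter> V) \<le> k" using inner_degree by simp
      qed
      finally show ?thesis by (simp add: mult.commute)
    qed
    \<comment> \<open>The defect of u is the number of sides of edges at u that face a non-triangular corner.\<close>
    define defect where "defect = (\<lambda>u. \<Sum>x\<in>nbrs u. 2 - int (card (lk u x)))"
    have outer: "(6 - int k) * int (card (nbrs u)) + int k * int (card (nbrs u \<inter> ?A)) \<le> 2 * int k * defect u"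
      if u: "u \<in> ?B" for u
    proof -
      let ?N = "\<lambda>i. {x \<in> nbrs u. card (lk u x) = i}"
      have part: "nbrs u = ?N 0 \<union> ?N 1 \<union> ?N 2" using card_lk_le2[of u] by (auto simp: le_Suc_eq numeral_2_eq_2)
      have fin: "finite (?N i)" for i using finite_nbrs by simp
      have sum3: "(\<Sum>x\<in>nbrs u. h (card (lk u x))) = h 0 * card (?N 0) + h 1 * card (?N 1) + h 2 * card (?N 2)"
        for h :: "nat \<Rightarrow> int"
      proof -
        have "(\<Sum>x\<in>nbrs u. h (card (lk u x))) = (\<Sum>x\<in>?N 0 \<union> ?N 1 \<union> ?N 2. h (card (lk u x)))" using part by simp
        also have "\<dots> = (\<Sum>x\<in>?N 0. h (card (lk u x))) + (\<Sum>x\<in>?N 1. h (card (lk u x))) + (\<Sum>x\<in>?N 2. h (card (lk u x)))"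
          using fin by (subst sum.union_disjoint; (subst sum.union_disjoint)?) auto
        finally show ?thesis by simp
      qed
      have d: "int (card (nbrs u)) = card (?N 0) + card (?N 1) + card (?N 2)" using sum3[of "\<lambda>_. 1"] by simp
      have f: "defect u = 2 * card (?N 0) + card (?N 1)" using sum3[of "\<lambda>i. 2 - int i"] by (simp add: defect_def)
      have "nbrs u \<inter> ?A \<subseteq> ?N 2"
      proof
        fix x assume x: "x \<in> nbrs u \<inter> ?A"
        then have "u \<in> nbrs x" using nbrs_sym by blast
        then have "card (lk x u) = 2" using x by (auto simp: inner_def)
        moreover have "lk u x = lk x u" by (simp add: lk_def insert_commute)
        ultimately show "x \<in> ?N 2" using x by simp
      qed
      then have a: "card (nbrs u \<inter> ?A) \<le> card (?N 2)" using fin by (intro card_mono) auto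
      have l: "2 * card (?N 2) \<le> (k - 2) * card (?N 1)" using outer_vertex_link[of u] u by blast
      show ?thesis using k a l unfolding d f by auto
    qed
    have "(\<Sum>u\<in>?B. (6 - int k) * int (card (nbrs u)) + int k * int (card (nbrs u \<inter> ?A))) \<le> (\<Sum>u\<in>?B. 2 * int k * defect u)"
      by (rule sum_mono) (rule outer)
    moreover have "(\<Sum>u\<in>?B. (6 - int k) * int (card (nbrs u)) + int k * int (card (nbrs u \<inter> ?A)))
        = (6 - int k) * (?p ?A ?B + ?p ?B ?B) + int k * ?p ?A ?B"
    proof -
      have "nbrs x \<inter> V = nbrs x" for x using nbrs_sub by blast
      then have "(\<Sum>u\<in>?B. int (card (nbrs u))) = int (?p ?B V)" using card_pairs[OF finA(2), of V] by simp
      also have "\<dots> = ?p ?A ?B + ?p ?B ?B"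
        using pairs_split(1)[OF AB(2), of ?B] AB(1) pairs_sym[of ?B ?A] by simp
      finally have "(\<Sum>u\<in>?B. int (card (nbrs u))) = ?p ?A ?B + ?p ?B ?B" .
      moreover have "(\<Sum>u\<in>?B. int (card (nbrs u \<inter> ?A))) = ?p ?A ?B"
        using card_pairs[OF finA(2), of ?A] pairs_sym[of ?B ?A] by simp
      ultimately show ?thesis by (simp add: sum.distrib flip: sum_distrib_left)
    qed
    moreover have "(\<Sum>u\<in>?B. 2 * int k * defect u) = 2 * int k * (4 * int (card E) - 6 * int (card T))"
    proof -
      have "defect u = 0" if "u \<in> ?A" for u
        unfolding defect_def using that by (intro sum.neutral) (auto simp: inner_def)
      then have "(\<Sum>u\<in>V. defect u) = (\<Sum>u\<in>?B. defect u)"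
        using finite_V AV by (intro sum.mono_neutral_right) auto
      moreover have "(\<Sum>u\<in>V. defect u) = (\<Sum>u\<in>V. \<Sum>x\<in>nbrs u \<inter> V. 2 - int (card (lk u x)))"
      proof -
        have "nbrs x \<inter> V = nbrs x" for x using nbrs_sub by blast
        then show ?thesis by (simp add: defect_def)
      qed
      moreover have "\<dots> = (\<Sum>q\<in>pairs_between V V. 2 - int (card (lk (fst q) (snd q))))"
        using sum_pairs[OF finite_V, of "\<lambda>u x. 2 - int (card (lk u x))" V] by simp
      moreover have "\<dots> = 2 * int (?p V V) - int (\<Sum>q\<in>pairs_between V V. card (lk (fst q) (snd q)))"
        by (simp add: sum_subtractf)
      moreover have "\<dots> = 4 * int (card E) - 6 * int (card T)" unfolding sum_lk_all EV by simp
      ultimately have "(\<Sum>u\<in>?B. defect u) = 4 * int (card E) - 6 * int (card T)" by simp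
      then show ?thesis by (simp flip: sum_distrib_left)
    qed
    ultimately have main: "(6 - int k) * (?p ?A ?B + ?p ?B ?B) + int k * ?p ?A ?B
        \<le> 2 * int k * (4 * int (card E) - 6 * int (card T))" by simp
    show ?thesis using k main iso degA split EV euler by auto
  qed
qed

end

section \<open>The upper bound for planar graphs\<close>

lemma contains_fan:
  assumes G: "simple_graph (V, E)" and d: "distinct xs" and l: "length xs = k + 1"
    and hub: "\<And>x. x \<in> set xs \<Longrightarrow> {u, x} \<in> E" and path: "successively (\<lambda>x y. {x, y} \<in> E) xs"
  shows "contains_copy (V, E) (fan k)"
proof -
  define \<phi> where "\<phi> = (\<lambda>i. if i = 0 then u else xs ! (i - 1))"
  have E: "e \<subseteq> V" "card e = 2" if "e \<in> E" for e using G that by (auto simp: simple_graph_def)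
  have u: "u \<notin> set xs" using hub[of u] E(2)[of "{u, u}"] by auto
  have V: "set xs \<subseteq> V" "u \<in> V"
  proof -
    show "set xs \<subseteq> V" using hub E(1) by blast
    have "xs ! 0 \<in> set xs" using l by (intro nth_mem) simp
    then show "u \<in> V" using hub E(1) by blast
  qed
  have inj: "inj_on \<phi> {0..k + 1}"
  proof (rule inj_onI)
    fix i j assume ij: "i \<in> {0..k + 1}" "j \<in> {0..k + 1}" "\<phi> i = \<phi> j"
    have mem: "xs ! (i - 1) \<in> set xs" if "i \<noteq> 0" "i \<in> {0..k + 1}" for i using that l by (intro nth_mem) auto
    show "i = j"
      using ij mem[of i] mem[of j] u nth_eq_iff_index_eq[OF d, of "i - 1" "j - 1"] l
      by (auto simp: \<phi>_def split: if_splits)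
  qed
  moreover have "\<phi> ` {0..k + 1} \<subseteq> V"
  proof
    fix x assume "x \<in> \<phi> ` {0..k + 1}"
    then obtain i where i: "i \<le> k + 1" "x = \<phi> i" by auto
    show "x \<in> V"
    proof (cases "i = 0")
      case False
      then have "xs ! (i - 1) \<in> set xs" using i l by (intro nth_mem) simp
      then show ?thesis using V i False by (auto simp: \<phi>_def)
    qed (use V i in \<open>simp add: \<phi>_def\<close>)
  qed
  moreover have "\<phi> ` e \<in> E" if e: "e \<in> edges (fan k)" for e
  proof -
    consider i where "e = {0, i}" "i \<in> {1..k + 1}" | i where "e = {i, i + 1}" "i \<in> {1..k}"
      using e by (auto simp: fan_def)
    then show ?thesis
    proof cases
      case 1
      then have "xs ! (i - 1) \<in> set xs" using l by (intro nth_mem) auto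
      then have "{u, xs ! (i - 1)} \<in> E" by (rule hub)
      then show ?thesis using 1 by (auto simp: \<phi>_def insert_commute)
    next
      case 2
      then have "Suc (i - 1) < length xs" using l by auto
      then have "{xs ! (i - 1), xs ! Suc (i - 1)} \<in> E"
        using path unfolding successively_conv_nth by blast
      moreover have "Suc (i - 1) = i" "i \<noteq> 0" using 2 by auto
      ultimately show ?thesis using 2 by (simp add: \<phi>_def)
    qed
  qed
  ultimately show ?thesis unfolding contains_copy_def fan_def by (intro exI[of _ \<phi>]) auto
qed

text \<open>Without isolated vertices this is the preceding bound. If too few vertices remain after removing the isolated
  ones, the remaining graph is at most as large as a triangulation, and the removed vertices leave enough room.\<close>

lemma fan_free_planar_edge_bound:
  assumes k: "k \<in> {2, 3, 4, 5}" and n: "18 - k \<le> (6 - k) * n"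
    and G: "(V, E) \<in> free_planar_graphs n (fan k)"
  shows "(7 * k + 6) * card E + 48 * k \<le> 24 * k * n"
proof -
  have sg: "simple_graph (V, E)" and cV: "card V = n" and free: "\<not> contains_copy (V, E) (fan k)"
    using G by (auto simp: free_planar_graphs_def)
  obtain p \<gamma> where dr: "planar_drawing (V, E) p \<gamma>" using G by (auto simp: free_planar_graphs_def planar_def)
  have finV: "finite V" and E: "E \<subseteq> {e. e \<subseteq> V \<and> card e = 2}" using sg by (auto simp: simple_graph_def)
  \<comment> \<open>Isolated vertices only help, so they are dropped.\<close>
  let ?W = "\<Union>E"
  have WV: "?W \<subseteq> V" using E by blast
  then have finW: "finite ?W" and mn: "card ?W \<le> n" using finV cV by (auto intro: finite_subset card_mono)
  have EW: "E \<subseteq> {e. e \<subseteq> ?W \<and> card e = 2}" using E by blast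
  have pg: "plane_graph ?W E p \<gamma>"
  proof
    show "finite ?W" "E \<subseteq> {e. e \<subseteq> ?W \<and> card e = 2}" by (rule finW, rule EW)
    have "path_image (\<gamma> e) \<inter> p ` ?W = p ` e" if e: "e \<in> E" for e
    proof -
      have "path_image (\<gamma> e) \<inter> p ` V = p ` e" using dr e by (simp add: planar_drawing_def)
      moreover have "p ` e \<subseteq> p ` ?W" "p ` ?W \<subseteq> p ` V" using e 
        by (simp_all only: image_mono Union_upper WV)
      moreover have "A \<inter> C = D" if "A \<inter> B = D" "D \<subseteq> C" "C \<subseteq> B" for A B C D :: "complex set" using that by blast
      ultimately show ?thesis by metis
    qed
    moreover have "inj_on p ?W" using dr WV inj_on_subset by (auto simp: planar_drawing_def)
    ultimately show "planar_drawing (?W, E) p \<gamma>" using dr by (simp add: planar_drawing_def)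
  qed
  have loc: "fan_free_plane_graph ?W E p \<gamma> k" if "card ?W \<ge> 4"
  proof -
    interpret plane_graph ?W E p \<gamma> by (rule pg)
    show ?thesis
    proof
      show "k \<in> {2, 3, 4, 5}" by (rule k)
      show "4 \<le> card ?W" by (rule that)
      show "\<exists>e\<in>E. v \<in> e" if "v \<in> ?W" for v using that by blast
      show False if "distinct xs" "length xs = k + 1" "\<And>x. x \<in> set xs \<Longrightarrow> {u, x} \<in> E"
        "successively (\<lambda>x y. {x, y} \<in> E) xs" for u xs
        using contains_fan[OF sg that] free by blast
    qed
  qed
  show ?thesis
  proof (cases "(6 - k) * card ?W > 12")
    case True
    then have "card ?W \<ge> 4" using k by auto
    then have "(7 * k + 6) * card E + 48 * k \<le> 24 * k * card ?W"
      using fan_free_plane_graph.fan_free_edge_bound[OF loc True] by blast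
    also have "\<dots> \<le> 24 * k * n" using mn by simp
    finally show ?thesis .
  next
    case False
    have "card E \<le> 3 * card ?W - 6 \<or> card E \<le> 3"
    proof (cases "card ?W \<ge> 4")
      case True
      then show ?thesis using fan_free_plane_graph.card_E_le[OF loc] by blast
    next
      case False
      have "card E \<le> card {e. e \<subseteq> ?W \<and> card e = 2}" using EW finW by (intro card_mono) auto
      also have "\<dots> = card ?W choose 2" using n_subsets[OF finW] by simp
      also have "\<dots> \<le> 3 choose 2" using False binomial_right_mono[of "card ?W" 3 2] by simp
      finally show ?thesis by (simp add: numeral_eq_Suc)
    qed
    then show ?thesis using False n k by auto
  qed
qed

section \<open>Straight-line drawings and gluing\<close>

text \<open>Twice the signed area of the triangle a b c; its sign tells on which side of the line ab the point c lies.\<close>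

definition cross :: "complex \<Rightarrow> complex \<Rightarrow> complex \<Rightarrow> real" where
  "cross a b c = (Re b - Re a) * (Im c - Im a) - (Im b - Im a) * (Re c - Re a)"

lemma cross_affine: "cross a b ((1 - t) *\<^sub>R c + t *\<^sub>R d) = (1 - t) * cross a b c + t * cross a b d"
  by (simp add: cross_def algebra_simps)

lemma cross_self: "cross a b a = 0" "cross a b b = 0"
  by (simp_all add: cross_def)

lemma cross_on_segment: "z \<in> closed_segment a b \<Longrightarrow> cross a b z = 0"
  by (auto simp: closed_segment_def cross_affine cross_self)

lemma segments_disjoint:
  assumes "cross a b c * cross a b d > 0"
  shows "closed_segment a b \<inter> closed_segment c d = {}"
proof -
  have False if z: "z \<in> closed_segment a b" "z \<in> closed_segment c d" for z
  proof -
    obtain t where t: "0 \<le> t" "t \<le> 1" "z = (1 - t) *\<^sub>R c + t *\<^sub>R d" using z(2) by (auto simp: closed_segment_def)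
    have 0: "(1 - t) * cross a b c + t * cross a b d = 0"
      using cross_on_segment[OF z(1)] unfolding t(3) cross_affine .
    consider "cross a b c > 0" "cross a b d > 0" | "cross a b c < 0" "cross a b d < 0"
      using assms by (auto simp: zero_less_mult_iff)
    then show False
    proof cases
      case 1
      then have "(1 - t) * cross a b c + t * cross a b d > 0"
        using t by (cases "t = 0") (auto intro!: add_nonneg_pos)
      then show False using 0 by simp
    next
      case 2
      then have "(1 - t) * cross a b c + t * cross a b d < 0"
        using t by (cases "t = 0") (auto intro!: add_nonpos_neg mult_nonneg_nonpos mult_pos_neg)
      then show False using 0 by simp
    qed
  qed
  then show ?thesis by blast
qed

lemma segments_common_end:
  assumes "cross a b d \<noteq> 0"
  shows "closed_segment a b \<inter> closed_segment a d = {a}"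
proof -
  have "z = a" if z: "z \<in> closed_segment a b" "z \<in> closed_segment a d" for z
  proof -
    obtain t where t: "z = (1 - t) *\<^sub>R a + t *\<^sub>R d" using z(2) by (auto simp: closed_segment_def)
    have "t * cross a b d = 0" using cross_on_segment[OF z(1)] unfolding t cross_affine by (simp add: cross_self)
    then show ?thesis using assms t by simp
  qed
  then show ?thesis by auto
qed

definition icross :: "int \<times> int \<Rightarrow> int \<times> int \<Rightarrow> int \<times> int \<Rightarrow> int" where
  "icross a b c = (fst b - fst a) * (snd c - snd a) - (snd b - snd a) * (fst c - fst a)"

text \<open>Edges with a common end must not be parallel. For disjoint edges, one of them has to lie strictly on one side of
  the line through the other, which is sufficient for disjointness and can be decided by evaluation.\<close>

definition seg_ok :: "(int \<times> int) list \<Rightarrow> nat \<times> nat \<Rightarrow> nat \<times> nat \<Rightarrow> bool" where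
  "seg_ok ps = (\<lambda>(a, b) (c, d).
     if a = c then icross (ps ! a) (ps ! b) (ps ! d) \<noteq> 0
     else if a = d then icross (ps ! a) (ps ! b) (ps ! c) \<noteq> 0
     else if b = c then icross (ps ! b) (ps ! a) (ps ! d) \<noteq> 0
     else if b = d then icross (ps ! b) (ps ! a) (ps ! c) \<noteq> 0
     else icross (ps ! a) (ps ! b) (ps ! c) * icross (ps ! a) (ps ! b) (ps ! d) > 0 \<or>
       icross (ps ! c) (ps ! d) (ps ! a) * icross (ps ! c) (ps ! d) (ps ! b) > 0)"

definition grid_point :: "(int \<times> int) list \<Rightarrow> nat \<Rightarrow> complex" where
  "grid_point ps i = Complex (of_int (fst (ps ! i))) (of_int (snd (ps ! i)))"

definition pair_edge :: "nat \<times> nat \<Rightarrow> nat set" where "pair_edge = (\<lambda>(a, b). {a, b})"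

text \<open>An edge is an unordered pair; taking minimum and maximum fixes a direction.\<close>

definition segment_of :: "(int \<times> int) list \<Rightarrow> nat set \<Rightarrow> real \<Rightarrow> complex" where
  "segment_of ps e = linepath (grid_point ps (Min e)) (grid_point ps (Max e))"

text \<open>Since every vertex lies on an edge, conditions on pairs of edges suffice to keep vertices away from the edges to
  which they do not belong.\<close>

definition straight_drawing :: "(int \<times> int) list \<Rightarrow> (nat \<times> nat) list \<Rightarrow> bool" where
  "straight_drawing ps es \<longleftrightarrow> distinct ps \<and> (\<forall>e\<in>set es. fst e < snd e \<and> snd e < length ps) \<and>
     (\<forall>i\<in>{..<length ps}. \<exists>e\<in>set es. i = fst e \<or> i = snd e) \<and> distinct es \<and> sorted_wrt (seg_ok ps) es"

lemma cross_grid_point: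
  "cross (grid_point ps a) (grid_point ps b) (grid_point ps c) = of_int (icross (ps ! a) (ps ! b) (ps ! c))"
  by (simp add: cross_def grid_point_def icross_def)

lemma seg_ok_segments:
  assumes "seg_ok ps (a, b) (c, d)" "a < b" "c < d" "(a, b) \<noteq> (c, d)"
  shows "closed_segment (grid_point ps a) (grid_point ps b) \<inter> closed_segment (grid_point ps c) (grid_point ps d)
    = grid_point ps ` ({a, b} \<inter> {c, d})"
proof -
  let ?p = "grid_point ps"
  have sym: "closed_segment x y = closed_segment y x" for x y :: complex by (rule closed_segment_commute)
  consider "a = c" "b \<noteq> d" | "a = d" "a \<noteq> c" | "b = c" "a \<noteq> c" "a \<noteq> d" | "b = d" "a \<noteq> c" "a \<noteq> d" "b \<noteq> c"
    | "a \<noteq> c" "a \<noteq> d" "b \<noteq> c" "b \<noteq> d" using assms(4) by blast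
  then show ?thesis
  proof cases
    case 1
    then have "cross (?p a) (?p b) (?p d) \<noteq> 0" using assms(1) by (simp add: seg_ok_def cross_grid_point)
    from segments_common_end[OF this] show ?thesis using 1 assms(2,3) by (simp add: Int_insert_left)
  next
    case 2
    then have cr: "cross (?p a) (?p b) (?p c) \<noteq> 0" using assms(1) by (simp add: seg_ok_def cross_grid_point)
    have eq: "closed_segment (?p c) (?p d) = closed_segment (?p a) (?p c)" unfolding 2(1) by (rule sym)
    have "closed_segment (?p a) (?p b) \<inter> closed_segment (?p c) (?p d) = {?p a}"
      unfolding eq by (rule segments_common_end[OF cr])
    then show ?thesis using 2 assms(2,3) by (simp add: Int_insert_left)
  next
    case 3
    then have cr: "cross (?p b) (?p a) (?p d) \<noteq> 0" using assms(1) by (simp add: seg_ok_def cross_grid_point)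
    have eq: "closed_segment (?p c) (?p d) = closed_segment (?p b) (?p d)" unfolding 3(1) ..
    have "closed_segment (?p a) (?p b) \<inter> closed_segment (?p c) (?p d) = {?p b}"
      unfolding eq sym[of "?p a"] by (rule segments_common_end[OF cr])
    then show ?thesis using 3 assms(2,3) by (simp add: Int_insert_left)
  next
    case 4
    then have cr: "cross (?p b) (?p a) (?p c) \<noteq> 0" using assms(1) by (simp add: seg_ok_def cross_grid_point)
    have eq: "closed_segment (?p c) (?p d) = closed_segment (?p b) (?p c)" unfolding 4(1) by (rule sym)
    have "closed_segment (?p a) (?p b) \<inter> closed_segment (?p c) (?p d) = {?p b}"
      unfolding eq sym[of "?p a"] by (rule segments_common_end[OF cr])
    then show ?thesis using 4 assms(2,3) by (simp add: Int_insert_left)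
  next
    case 5
    let ?i = "\<lambda>x y z. icross (ps ! x) (ps ! y) (ps ! z)"
    have "0 < ?i a b c * ?i a b d \<or> 0 < ?i c d a * ?i c d b" using assms(1) 5 by (simp add: seg_ok_def)
    then have "(0::real) < of_int (?i a b c * ?i a b d) \<or> (0::real) < of_int (?i c d a * ?i c d b)"
      unfolding of_int_0_less_iff .
    then have "cross (?p a) (?p b) (?p c) * cross (?p a) (?p b) (?p d) > 0 \<or>
        cross (?p c) (?p d) (?p a) * cross (?p c) (?p d) (?p b) > 0"
      unfolding cross_grid_point of_int_mult .
    then have "closed_segment (?p a) (?p b) \<inter> closed_segment (?p c) (?p d) = {}"
    proof
      assume "cross (?p a) (?p b) (?p c) * cross (?p a) (?p b) (?p d) > 0"
      then show ?thesis by (rule segments_disjoint)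
    next
      assume "cross (?p c) (?p d) (?p a) * cross (?p c) (?p d) (?p b) > 0"
      from segments_disjoint[OF this] show ?thesis by (simp add: Int_commute)
    qed
    then show ?thesis using 5 by simp
  qed
qed

lemma segment_pair: "a < b \<Longrightarrow> segment_of ps {a, b} = linepath (grid_point ps a) (grid_point ps b)"
  by (simp add: segment_of_def min_def max_def)

lemma straight_drawing_planar:
  assumes ok: "straight_drawing ps es"
  shows "planar_drawing ({..<length ps}, pair_edge ` set es) (grid_point ps) (segment_of ps)"
proof -
  let ?p = "grid_point ps" and ?W = "{..<length ps}" and ?D = "pair_edge ` set es"
  have es: "fst e < snd e" "snd e < length ps" if "e \<in> set es" for e using ok that by (auto simp: straight_drawing_def)
  have D: "\<exists>a b. (a, b) \<in> set es \<and> e = {a, b} \<and> a < b \<and> b < length ps" if "e \<in> ?D" for e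
    using that es unfolding pair_edge_def by fastforce
  have inj: "inj_on ?p ?W"
  proof (rule inj_onI)
    fix i j assume ij: "i \<in> ?W" "j \<in> ?W" "?p i = ?p j"
    then have "ps ! i = ps ! j" by (simp add: grid_point_def prod_eq_iff)
    then show "i = j" using ok ij nth_eq_iff_index_eq[of ps i j] by (simp add: straight_drawing_def)
  qed
  have int: "path_image (segment_of ps e) \<inter> path_image (segment_of ps f) = ?p ` (e \<inter> f)"
    if e: "e \<in> ?D" and f: "f \<in> ?D" and ef: "e \<noteq> f" for e f
  proof -
    obtain a b where ab: "(a, b) \<in> set es" "e = {a, b}" "a < b" using D[OF e] by blast
    obtain c d where cd: "(c, d) \<in> set es" "f = {c, d}" "c < d" using D[OF f] by blast
    have ne: "(a, b) \<noteq> (c, d)" using ef ab cd by blast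
    obtain i where i: "i < length es" "es ! i = (a, b)" using ab by (metis in_set_conv_nth)
    obtain j where j: "j < length es" "es ! j = (c, d)" using cd by (metis in_set_conv_nth)
    have st: "sorted_wrt (seg_ok ps) es" using ok by (simp add: straight_drawing_def)
    have "i \<noteq> j" using i j ne by auto
    then have "seg_ok ps (a, b) (c, d) \<or> seg_ok ps (c, d) (a, b)"
      using sorted_wrt_nth_less[OF st, of i j] sorted_wrt_nth_less[OF st, of j i] i j by (cases "i < j") auto
    then have "closed_segment (?p a) (?p b) \<inter> closed_segment (?p c) (?p d) = ?p ` ({a, b} \<inter> {c, d})"
    proof
      assume "seg_ok ps (a, b) (c, d)" then show ?thesis using seg_ok_segments ab cd ne by blast
    next
      assume "seg_ok ps (c, d) (a, b)"
      then have "closed_segment (?p c) (?p d) \<inter> closed_segment (?p a) (?p b) = ?p ` ({c, d} \<inter> {a, b})"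
        using seg_ok_segments[of ps c d a b] ab cd ne by metis
      then show ?thesis by (metis Int_commute)
    qed
    then show ?thesis using ab cd by (simp add: segment_pair)
  qed
  have ends: "arc (segment_of ps e) \<and> {pathstart (segment_of ps e), pathfinish (segment_of ps e)} = ?p ` e"
    if e: "e \<in> ?D" for e
  proof -
    obtain a b where ab: "e = {a, b}" "a < b" "b < length ps" using D[OF e] by blast
    then have "?p a \<noteq> ?p b" using inj inj_onD[OF inj, of a b] by force
    then show ?thesis using ab by (simp add: segment_pair arc_linepath)
  qed
  have verts: "path_image (segment_of ps e) \<inter> ?p ` ?W = ?p ` e" if e: "e \<in> ?D" for e
  proof
    have "e \<subseteq> ?W" using D[OF e] by auto
    moreover have "?p ` e \<subseteq> path_image (segment_of ps e)"
      using ends[OF e] pathstart_in_path_image pathfinish_in_path_image by (metis insert_subset empty_subsetI)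
    ultimately show "?p ` e \<subseteq> path_image (segment_of ps e) \<inter> ?p ` ?W" by blast
    show "path_image (segment_of ps e) \<inter> ?p ` ?W \<subseteq> ?p ` e"
    proof
      fix z assume z: "z \<in> path_image (segment_of ps e) \<inter> ?p ` ?W"
      then obtain w where w: "w \<in> ?W" "z = ?p w" by blast
      obtain f where f: "f \<in> set es" "w = fst f \<or> w = snd f" using ok w unfolding straight_drawing_def by blast
      then have fD: "pair_edge f \<in> ?D" "w \<in> pair_edge f" by (auto simp: pair_edge_def)
      have "z \<in> path_image (segment_of ps (pair_edge f))"
        using ends[OF fD(1)] fD(2) w pathstart_in_path_image pathfinish_in_path_image
        by (metis (no_types, opaque_lifting) image_eqI insertE singletonD)
      then show "z \<in> ?p ` e" using int[OF e fD(1)] z fD(2) w(2) by (cases "e = pair_edge f") auto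
    qed
  qed
  show ?thesis unfolding planar_drawing_def using inj int ends verts by simp
qed

lemma arc_inj_image:
  assumes "arc g" "continuous_on (path_image g) f" "inj_on f (path_image g)"
  shows "arc (f \<circ> g)"
  using assms by (simp add: arc_def path_continuous_image path_image_def comp_inj_on)

text \<open>A drawing inside S is copied into the plane once for each block b by an injective map. If two copies of S meet
  only in points of common vertices, the copies of the arcs form a drawing of the union, because crossings within
  a block are excluded by the original drawing and crossings between blocks by the position of the copies.\<close>

lemma glued_planar_drawing:
  fixes \<nu> :: "'b \<Rightarrow> 'w \<Rightarrow> 'v" and \<psi> :: "'b \<Rightarrow> complex \<Rightarrow> complex"
  assumes dr: "planar_drawing (W, D) q \<eta>" and D: "\<And>d. d \<in> D \<Longrightarrow> d \<subseteq> W"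
    and S: "\<And>d. d \<in> D \<Longrightarrow> path_image (\<eta> d) \<subseteq> S" "q ` W \<subseteq> S"
    and card2: "\<And>d. d \<in> D \<Longrightarrow> card d = 2"
    and \<psi>: "\<And>b. b \<in> I \<Longrightarrow> continuous_on S (\<psi> b)" "\<And>b. b \<in> I \<Longrightarrow> inj_on (\<psi> b) S"
    and \<nu>: "\<And>b. b \<in> I \<Longrightarrow> inj_on (\<nu> b) W"
    and meet: "\<And>b c z z'. \<lbrakk>b \<in> I; c \<in> I; b \<noteq> c; z \<in> S; z' \<in> S; \<psi> b z = \<psi> c z'\<rbrakk> \<Longrightarrow>
        \<exists>w\<in>W. \<exists>w'\<in>W. z = q w \<and> z' = q w' \<and> \<nu> b w = \<nu> c w'"
    and pos: "\<And>b w. b \<in> I \<Longrightarrow> w \<in> W \<Longrightarrow> pos (\<nu> b w) = \<psi> b (q w)"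
    and once: "\<And>b c w1 w2 u1 u2. \<lbrakk>b \<in> I; c \<in> I; b \<noteq> c; w1 \<in> W; w2 \<in> W; u1 \<in> W; u2 \<in> W;
        \<nu> b w1 = \<nu> c u1; \<nu> b w2 = \<nu> c u2\<rbrakk> \<Longrightarrow> w1 = w2"
  shows "planar (\<Union>b\<in>I. \<nu> b ` W, \<Union>b\<in>I. (`) (\<nu> b) ` D)"
proof -
  let ?V = "\<Union>b\<in>I. \<nu> b ` W" and ?E = "\<Union>b\<in>I. (`) (\<nu> b) ` D"
  have qW: "q w \<in> S" if "w \<in> W" for w using S(2) that by blast
  have injq: "inj_on q W" using dr by (simp add: planar_drawing_def)
  have loc: "arc (\<eta> d)" "{pathstart (\<eta> d), pathfinish (\<eta> d)} = q ` d" "path_image (\<eta> d) \<inter> q ` W = q ` d"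
    if "d \<in> D" for d using dr that by (auto simp: planar_drawing_def)
  have loc2: "path_image (\<eta> d) \<inter> path_image (\<eta> d') = q ` (d \<inter> d')" if "d \<in> D" "d' \<in> D" "d \<noteq> d'" for d d'
    using dr that by (auto simp: planar_drawing_def)
  have same: "\<nu> b w = \<nu> c u" if h: "b \<in> I" "c \<in> I" "w \<in> W" "u \<in> W" "\<psi> b (q w) = \<psi> c (q u)" for b c w u
  proof (cases "b = c")
    case True
    then have "q w = q u" using \<psi>(2)[OF h(1)] h qW by (simp add: inj_on_eq_iff)
    then show ?thesis using injq h True by (simp add: inj_on_eq_iff)
  next
    case False
    obtain w' u' where w': "w' \<in> W" "u' \<in> W" "q w = q w'" "q u = q u'" "\<nu> b w' = \<nu> c u'"
      using meet[OF h(1,2) False qW[OF h(3)] qW[OF h(4)] h(5)] by blast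
    then show ?thesis using injq h by (simp add: inj_on_eq_iff)
  qed
  have onD: "w \<in> d" if "d \<in> D" "w \<in> W" "q w \<in> path_image (\<eta> d)" for d w
  proof -
    have "q w \<in> q ` d" using loc(3)[OF that(1)] that by blast
    then show ?thesis using injq D[OF that(1)] that(2) inj_on_image_mem_iff by metis
  qed
  have inD: "q w \<in> path_image (\<eta> d)" if "d \<in> D" "w \<in> d" for d w
    using loc(3)[OF that(1)] that by blast
  \<comment> \<open>Distinct blocks share at most one vertex, so an edge determines its block.\<close>
  have uniq: "b = c \<and> d = d'" if h: "b \<in> I" "c \<in> I" "d \<in> D" "d' \<in> D" "\<nu> b ` d = \<nu> c ` d'" for b c d d'
  proof -
    have "b = c"
    proof (rule ccontr)
      assume bc: "b \<noteq> c"
      obtain x y where xy: "d = {x, y}" "x \<noteq> y" using card2[OF h(3)] by (metis card_2_iff)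
      have "\<nu> b x \<in> \<nu> b ` d" "\<nu> b y \<in> \<nu> b ` d" using xy(1) by simp_all
      then obtain x' y' where "x' \<in> d'" "y' \<in> d'" "\<nu> b x = \<nu> c x'" "\<nu> b y = \<nu> c y'"
        unfolding h(5) by blast
      then show False using once[OF h(1,2) bc, of x y x' y'] D[OF h(3)] D[OF h(4)] xy by blast
    qed
    moreover have "d = d'" using h \<nu>[OF h(1)] D calculation by (metis inj_on_image_eq_iff)
    ultimately show ?thesis by blast
  qed
  define dec where "dec = (\<lambda>e. SOME x. fst x \<in> I \<and> snd x \<in> D \<and> e = \<nu> (fst x) ` snd x)"
  define \<gamma> where "\<gamma> = (\<lambda>e. \<psi> (fst (dec e)) \<circ> \<eta> (snd (dec e)))"
  have dec: "dec (\<nu> b ` d) = (b, d)" if "b \<in> I" "d \<in> D" for b d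
  proof -
    have "fst (dec (\<nu> b ` d)) \<in> I \<and> snd (dec (\<nu> b ` d)) \<in> D \<and> \<nu> b ` d = \<nu> (fst (dec (\<nu> b ` d))) ` snd (dec (\<nu> b ` d))"
      unfolding dec_def by (rule someI[of _ "(b, d)"]) (use that in simp)
    then show ?thesis using uniq[OF that(1) _ that(2)] by (metis prod.collapse)
  qed
  have \<gamma>: "\<gamma> (\<nu> b ` d) = \<psi> b \<circ> \<eta> d" if "b \<in> I" "d \<in> D" for b d using dec[OF that] by (simp add: \<gamma>_def)
  have img: "path_image (\<gamma> (\<nu> b ` d)) = \<psi> b ` path_image (\<eta> d)" if "b \<in> I" "d \<in> D" for b d
    using \<gamma>[OF that] by (simp add: path_image_compose)
  have posd: "pos ` \<nu> b ` d = \<psi> b ` q ` d" if "b \<in> I" "d \<in> D" for b d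
    unfolding image_image using pos[OF that(1)] D[OF that(2)] by (intro image_cong) auto
  have "planar_drawing (?V, ?E) pos \<gamma>"
    unfolding planar_drawing_def fst_conv snd_conv
  proof (intro conjI ballI impI)
    show "inj_on pos ?V"
    proof (rule inj_onI)
      fix x y assume "x \<in> ?V" "y \<in> ?V" and eq: "pos x = pos y"
      then obtain b w c u where bw: "b \<in> I" "w \<in> W" "x = \<nu> b w" and cu: "c \<in> I" "u \<in> W" "y = \<nu> c u" by blast
      then show "x = y" using same[OF bw(1) cu(1) bw(2) cu(2)] pos eq by simp
    qed
    fix e assume "e \<in> ?E"
    then obtain b d where b: "b \<in> I" and d: "d \<in> D" and e: "e = \<nu> b ` d" by blast
    have cont: "continuous_on (path_image (\<eta> d)) (\<psi> b)" "inj_on (\<psi> b) (path_image (\<eta> d))"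
      using \<psi>[OF b] S(1)[OF d] by (auto intro: continuous_on_subset inj_on_subset)
    show "arc (\<gamma> e)" unfolding e \<gamma>[OF b d]
      by (rule arc_inj_image[OF loc(1)[OF d] cont])
    show "{pathstart (\<gamma> e), pathfinish (\<gamma> e)} = pos ` e"
      unfolding e \<gamma>[OF b d] posd[OF b d] using loc(2)[OF d] by (simp add: pathstart_compose pathfinish_compose flip: loc(2)[OF d])
    show "path_image (\<gamma> e) \<inter> pos ` ?V = pos ` e"
    proof
      have "q ` d \<subseteq> path_image (\<eta> d)" using inD[OF d] by blast
      then show "pos ` e \<subseteq> path_image (\<gamma> e) \<inter> pos ` ?V"
        unfolding e img[OF b d] using posd[OF b d] D[OF d] b by blast
      show "path_image (\<gamma> e) \<inter> pos ` ?V \<subseteq> pos ` e"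
      proof
        fix y assume "y \<in> path_image (\<gamma> e) \<inter> pos ` ?V"
        then obtain z c u where z: "z \<in> path_image (\<eta> d)" "y = \<psi> b z" and cu: "c \<in> I" "u \<in> W" "y = pos (\<nu> c u)"
          unfolding e img[OF b d] by blast
        have zS: "z \<in> S" using z S(1)[OF d] by blast
        have eq: "\<psi> b z = \<psi> c (q u)" using z cu pos by simp
        have "\<exists>w\<in>W. z = q w"
        proof (cases "b = c")
          case True
          then have "z = q u" using eq \<psi>(2)[OF b] zS qW[OF cu(2)] by (simp add: inj_on_eq_iff)
          then show ?thesis using cu by blast
        next
          case False
          then show ?thesis using meet[OF b cu(1) False zS qW[OF cu(2)] eq] by blast
        qed
        then obtain w where w: "w \<in> W" "z = q w" by blast
        then have "w \<in> d" using onD[OF d] z by blast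
        then show "y \<in> pos ` e" unfolding e posd[OF b d] using z w by blast
      qed
    qed
    fix f assume "f \<in> ?E" and ef: "e \<noteq> f"
    then obtain c d' where c: "c \<in> I" and d': "d' \<in> D" and f: "f = \<nu> c ` d'" by blast
    show "path_image (\<gamma> e) \<inter> path_image (\<gamma> f) = pos ` (e \<inter> f)"
    proof
      show "pos ` (e \<inter> f) \<subseteq> path_image (\<gamma> e) \<inter> path_image (\<gamma> f)"
      proof -
        have "pos ` e \<subseteq> path_image (\<gamma> e)" unfolding e img[OF b d] posd[OF b d] using inD[OF d] by blast
        moreover have "pos ` f \<subseteq> path_image (\<gamma> f)" unfolding f img[OF c d'] posd[OF c d'] using inD[OF d'] by blast
        ultimately show ?thesis by blast
      qed
      show "path_image (\<gamma> e) \<inter> path_image (\<gamma> f) \<subseteq> pos ` (e \<inter> f)"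
      proof
        fix y assume "y \<in> path_image (\<gamma> e) \<inter> path_image (\<gamma> f)"
        then obtain z z' where z: "z \<in> path_image (\<eta> d)" "y = \<psi> b z" and z': "z' \<in> path_image (\<eta> d')" "y = \<psi> c z'"
          unfolding e f img[OF b d] img[OF c d'] by blast
        have zS: "z \<in> S" "z' \<in> S" using z z' S(1)[OF d] S(1)[OF d'] by blast+
        have eq: "\<psi> b z = \<psi> c z'" using z z' by simp
        show "y \<in> pos ` (e \<inter> f)"
        proof (cases "b = c")
          case True
          then have "z = z'" using eq \<psi>(2)[OF b] zS by (simp add: inj_on_eq_iff)
          moreover have "d \<noteq> d'" using ef e f True by blast
          ultimately obtain w where w: "w \<in> d" "w \<in> d'" "z = q w" using loc2[OF d d'] z z' by blast
          then have "y = pos (\<nu> b w)" using pos[OF b] D[OF d] z by auto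
          then show ?thesis unfolding e f using w True by blast
        next
          case False
          obtain w w' where w: "w \<in> W" "w' \<in> W" "z = q w" "z' = q w'" "\<nu> b w = \<nu> c w'"
            using meet[OF b c False zS eq] by blast
          have "w \<in> d" "w' \<in> d'" using onD[OF d w(1)] onD[OF d' w(2)] w z z' by auto
          then have "\<nu> b w \<in> e \<inter> f" unfolding e f using w(5) by (metis IntI image_eqI)
          moreover have "y = pos (\<nu> b w)" using pos[OF b w(1)] z w by simp
          ultimately show ?thesis by blast
        qed
      qed
    qed
  qed
  then show ?thesis unfolding planar_def by blast
qed

section \<open>Graphs glued from regular blocks\<close>

text \<open>Each block is a copy of the same graph, with its vertices named by the map for that block. Two blocks share at
  most one vertex, and if three blocks meet pairwise, then at least two of the three meeting points coincide. So
  no edge and no triangle is created by the gluing.\<close>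

locale glued_blocks =
  fixes I :: "'b set" and W :: "'w set" and D :: "'w set set" and \<nu> :: "'b \<Rightarrow> 'w \<Rightarrow> 'v"
  assumes finite_I: "finite I" and finite_W: "finite W"
    and D_sub: "\<And>d. d \<in> D \<Longrightarrow> d \<subseteq> W" and D_card: "\<And>d. d \<in> D \<Longrightarrow> card d = 2"
    and \<nu>_inj: "\<And>b. b \<in> I \<Longrightarrow> inj_on (\<nu> b) W"
    and once: "\<And>b c w1 w2 u1 u2. \<lbrakk>b \<in> I; c \<in> I; b \<noteq> c; w1 \<in> W; w2 \<in> W; u1 \<in> W; u2 \<in> W;
        \<nu> b w1 = \<nu> c u1; \<nu> b w2 = \<nu> c u2\<rbrakk> \<Longrightarrow> w1 = w2"
    and no_block_triangle: "\<And>b c d w1 u1 w2 u2 w3 u3. \<lbrakk>b \<in> I; c \<in> I; d \<in> I; b \<noteq> c; c \<noteq> d; b \<noteq> d;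
        w1 \<in> W; u1 \<in> W; w2 \<in> W; u2 \<in> W; w3 \<in> W; u3 \<in> W;
        \<nu> b w1 = \<nu> c u1; \<nu> c w2 = \<nu> d u2; \<nu> b w3 = \<nu> d u3\<rbrakk> \<Longrightarrow>
        \<nu> b w1 = \<nu> c w2 \<or> \<nu> c w2 = \<nu> b w3 \<or> \<nu> b w1 = \<nu> b w3"
begin

definition block_edges :: "'b \<Rightarrow> 'v set set" where "block_edges b = (`) (\<nu> b) ` D"
definition glued_verts :: "'v set" where "glued_verts = (\<Union>b\<in>I. \<nu> b ` W)"
definition glued_edges :: "'v set set" where "glued_edges = (\<Union>b\<in>I. block_edges b)"

lemma finite_D: "finite D"
  using D_sub finite_W by (meson Pow_iff finite_Pow_iff finite_subset subsetI)

lemma block_edge_ends: "{x, y} \<in> block_edges b \<Longrightarrow> x \<in> \<nu> b ` W \<and> y \<in> \<nu> b ` W"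
proof -
  assume "{x, y} \<in> block_edges b"
  then obtain d where d: "d \<in> D" "{x, y} = \<nu> b ` d" by (auto simp: block_edges_def)
  have "\<nu> b ` d \<subseteq> \<nu> b ` W" using D_sub[OF d(1)] by (rule image_mono)
  then show ?thesis unfolding d(2)[symmetric] by simp
qed

lemma block_edge_card: "b \<in> I \<Longrightarrow> e \<in> block_edges b \<Longrightarrow> card e = 2"
  unfolding block_edges_def using D_card D_sub \<nu>_inj card_image inj_on_subset by (metis (no_types, lifting) imageE)

lemma block_unique:
  assumes "b \<in> I" "c \<in> I" "x \<noteq> y" "x \<in> \<nu> b ` W" "y \<in> \<nu> b ` W" "x \<in> \<nu> c ` W" "y \<in> \<nu> c ` W"
  shows "b = c"
proof (rule ccontr)
  assume bc: "b \<noteq> c"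
  obtain w1 w2 where w: "w1 \<in> W" "w2 \<in> W" "x = \<nu> b w1" "y = \<nu> b w2" using assms(4,5) by blast
  obtain u1 u2 where u: "u1 \<in> W" "u2 \<in> W" "x = \<nu> c u1" "y = \<nu> c u2" using assms(6,7) by blast
  have "w1 = w2" using once[OF assms(1,2) bc w(1,2) u(1,2)] w(3,4) u(3,4) by simp
  then show False using w assms(3) by simp
qed

lemma edge_block_unique:
  assumes "b \<in> I" "c \<in> I" "{x, y} \<in> block_edges b" "{x, y} \<in> block_edges c" shows "b = c"
proof (rule block_unique[OF assms(1,2)])
  show "x \<noteq> y" using block_edge_card[OF assms(1,3)] by auto
qed (use block_edge_ends assms in blast)+

lemma card_glued_edges: "card glued_edges = card I * card D"
proof -
  have "card (block_edges b) = card D" if b: "b \<in> I" for b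
    unfolding block_edges_def
  proof (rule card_image, rule inj_onI)
    fix d d' assume "d \<in> D" "d' \<in> D" "\<nu> b ` d = \<nu> b ` d'"
    then show "d = d'" using inj_on_image_eq_iff[OF \<nu>_inj[OF b]] D_sub by blast
  qed
  moreover have "block_edges b \<inter> block_edges c = {}" if "b \<in> I" "c \<in> I" "b \<noteq> c" for b c
  proof -
    have False if e: "e \<in> block_edges b" "e \<in> block_edges c" for e
    proof -
      have "card e = 2" using block_edge_card \<open>b \<in> I\<close> e by blast
      then obtain x y where "e = {x, y}" unfolding card_2_iff by (elim exE conjE)
      then show False using edge_block_unique \<open>b \<in> I\<close> \<open>c \<in> I\<close> \<open>b \<noteq> c\<close> e by blast
    qed
    then show ?thesis by blast
  qed
  ultimately show ?thesis
    unfolding glued_edges_def using finite_I finite_D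
    by (subst card_UN_disjoint) (auto simp: block_edges_def)
qed

lemma simple_glued: "simple_graph (glued_verts, glued_edges)"
  unfolding simple_graph_def fst_conv snd_conv
proof
  show "finite glued_verts" unfolding glued_verts_def using finite_I finite_W by simp
  show "glued_edges \<subseteq> {e. e \<subseteq> glued_verts \<and> card e = 2}"
  proof
    fix e assume "e \<in> glued_edges"
    then obtain b where b: "b \<in> I" "e \<in> block_edges b" by (auto simp: glued_edges_def)
    then obtain d where "d \<in> D" "e = \<nu> b ` d" by (auto simp: block_edges_def)
    then have "e \<subseteq> glued_verts" using D_sub b(1) unfolding glued_verts_def by blast
    then show "e \<in> {e. e \<subseteq> glued_verts \<and> card e = 2}" using block_edge_card[OF b] by blast
  qed
qed

text \<open>If two sides of a triangle were in different blocks, the third side would be in a third block, and the three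
  blocks would meet pairwise in three different vertices.\<close>

lemma triangle_in_block:
  assumes "{x, y} \<in> block_edges b" "{y, z} \<in> block_edges c" "{x, z} \<in> glued_edges" "b \<in> I" "c \<in> I"
  shows "b = c"
proof (rule ccontr)
  assume bc: "b \<noteq> c"
  obtain d where d: "d \<in> I" "{x, z} \<in> block_edges d" using assms(3) by (auto simp: glued_edges_def)
  note ends = block_edge_ends[OF assms(1)] block_edge_ends[OF assms(2)] block_edge_ends[OF d(2)]
  have ne: "x \<noteq> y" "y \<noteq> z" "x \<noteq> z"
    using block_edge_card[OF assms(4,1)] block_edge_card[OF assms(5,2)] block_edge_card[OF d] by auto
  have "b \<noteq> d"
  proof
    assume "b = d"
    then have "b = c" using block_unique[OF assms(4,5) ne(2)] ends by blast
    then show False using bc by blast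
  qed
  moreover have "c \<noteq> d"
  proof
    assume "c = d"
    then have "b = c" using block_unique[OF assms(4,5) ne(1)] ends by blast
    then show False using bc by blast
  qed
  moreover obtain w1 u1 where 1: "w1 \<in> W" "u1 \<in> W" "y = \<nu> b w1" "y = \<nu> c u1" using ends by blast
  moreover obtain w2 u2 where 2: "w2 \<in> W" "u2 \<in> W" "z = \<nu> c w2" "z = \<nu> d u2" using ends by blast
  moreover obtain w3 u3 where 3: "w3 \<in> W" "u3 \<in> W" "x = \<nu> b w3" "x = \<nu> d u3" using ends by blast
  ultimately have "y = z \<or> z = x \<or> y = x"
    using no_block_triangle[OF assms(4,5) d(1) bc, of w1 u1 w2 u2 w3 u3] by metis
  then show False using ne by blast
qed

text \<open>Consecutive triangles of a fan share an edge and so lie in the same block. Hence the hub has k + 1 neighbours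
  within one block, more than the degree k allows.\<close>

lemma glued_fan_free:
  assumes deg: "\<And>w. w \<in> W \<Longrightarrow> card {x. {w, x} \<in> D} \<le> k"
  shows "\<not> contains_copy (glued_verts, glued_edges) (fan k)"
proof
  assume "contains_copy (glued_verts, glued_edges) (fan k)"
  then obtain \<phi> where inj: "inj_on \<phi> {0..k + 1}" and img: "\<And>e. e \<in> edges (fan k) \<Longrightarrow> \<phi> ` e \<in> glued_edges"
    unfolding contains_copy_def by (auto simp: fan_def)
  have spoke: "{\<phi> 0, \<phi> i} \<in> glued_edges" if "i \<in> {1..k + 1}" for i
  proof -
    have "{0, i} \<in> edges (fan k)" using that by (auto simp: fan_def)
    from img[OF this] show ?thesis by simp
  qed
  have rim: "{\<phi> i, \<phi> (Suc i)} \<in> glued_edges" if "i \<in> {1..k}" for i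
  proof -
    have "{i, i + 1} \<in> edges (fan k)" using that by (auto simp: fan_def)
    from img[OF this] show ?thesis by simp
  qed
  obtain b where b: "b \<in> I" "{\<phi> 0, \<phi> 1} \<in> block_edges b" using spoke[of 1] by (auto simp: glued_edges_def)
  have all: "{\<phi> 0, \<phi> (Suc i)} \<in> block_edges b" if "i \<le> k" for i using that
  proof (induction i)
    case 0 then show ?case using b by simp
  next
    case (Suc i)
    have IH: "{\<phi> (Suc i), \<phi> 0} \<in> block_edges b" using Suc by (simp add: insert_commute)
    obtain c where c: "c \<in> I" "{\<phi> 0, \<phi> (Suc (Suc i))} \<in> block_edges c"
      using spoke[of "Suc (Suc i)"] Suc.prems by (auto simp: glued_edges_def)
    have "{\<phi> (Suc i), \<phi> (Suc (Suc i))} \<in> glued_edges" using rim[of "Suc i"] Suc.prems by simp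
    then have "b = c" using triangle_in_block[OF IH c(2)] b c by blast
    then show ?case using c by simp
  qed
  let ?g = "inv_into W (\<nu> b)"
  have pull: "{?g (\<phi> 0), ?g (\<phi> (Suc i))} \<in> D" if i: "i \<le> k" for i
  proof -
    obtain d where d: "d \<in> D" "{\<phi> 0, \<phi> (Suc i)} = \<nu> b ` d" using all[OF i] by (auto simp: block_edges_def)
    have "?g ` {\<phi> 0, \<phi> (Suc i)} = d" unfolding d(2) using inv_into_image_cancel[OF \<nu>_inj[OF b(1)] D_sub[OF d(1)]] .
    then show ?thesis using d(1) by simp
  qed
  have inW: "\<phi> (Suc i) \<in> \<nu> b ` W" if "i \<le> k" for i using block_edge_ends[OF all[OF that]] by blast
  have "?g (\<phi> 0) \<in> W" using pull[of 0] D_sub by blast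
  then have "card {x. {?g (\<phi> 0), x} \<in> D} \<le> k" by (rule deg)
  moreover have "(\<lambda>i. ?g (\<phi> (Suc i))) ` {..k} \<subseteq> {x. {?g (\<phi> 0), x} \<in> D}" using pull by blast
  moreover have "finite {x. {?g (\<phi> 0), x} \<in> D}"
    by (rule finite_subset[OF _ finite_W]) (use D_sub in blast)
  moreover have "inj_on (\<lambda>i. ?g (\<phi> (Suc i))) {..k}"
  proof (rule inj_onI)
    fix i j assume ij: "i \<in> {..k}" "j \<in> {..k}" "?g (\<phi> (Suc i)) = ?g (\<phi> (Suc j))"
    then have "\<phi> (Suc i) = \<phi> (Suc j)" using inv_into_injective[OF ij(3)] inW by simp
    then show "i = j" using inj ij(1,2) by (auto dest: inj_onD)
  qed
  ultimately have "card {..k} \<le> k" by (metis card_image card_mono order_trans)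
  then show False by simp
qed

end

section \<open>The blocks and the pattern in which they are glued\<close>

text \<open>The blocks are the k-regular triangulations: the triangle, the tetrahedron, the octahedron and the icosahedron.
  They are drawn with straight edges inside the triangle of their first three vertices. Every vertex has degree k
  inside its block, and all vertices but these three are surrounded by triangles.\<close>

definition gadget_points :: "nat \<Rightarrow> (int \<times> int) list" where
  "gadget_points k = [(0, 0), (12, 0), (0, 12)] @
    (if k = 3 then [(4, 4)]
     else if k = 4 then [(5, 2), (5, 5), (2, 5)]
     else if k = 5 then [(5, 1), (6, 2), (5, 5), (3, 6), (1, 5), (2, 3), (4, 2), (5, 4), (2, 5)]
     else [])"

definition gadget_edges :: "nat \<Rightarrow> (nat \<times> nat) list" where
  "gadget_edges k =
    (if k = 3 then [(0, 1), (0, 2), (0, 3), (1, 2), (1, 3), (2, 3)]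
     else if k = 4 then [(0, 1), (0, 2), (0, 3), (0, 5), (1, 2), (1, 3), (1, 4), (2, 4), (2, 5), (3, 4), (3, 5), (4, 5)]
     else if k = 5 then [(0, 1), (0, 2), (0, 3), (0, 7), (0, 8), (1, 2), (1, 3), (1, 4), (1, 5), (2, 5), (2, 6),
       (2, 7), (3, 4), (3, 8), (3, 9), (4, 5), (4, 9), (4, 10), (5, 6), (5, 10), (6, 7), (6, 10), (6, 11), (7, 8),
       (7, 11), (8, 9), (8, 11), (9, 10), (9, 11), (10, 11)]
     else [(0, 1), (0, 2), (1, 2)])"

text \<open>The conditions of a straight drawing together with the bounds on positions and degrees, phrased with lists so
  that they can be evaluated.\<close>

definition gadget_ok :: "nat \<Rightarrow> bool" where
  "gadget_ok k \<longleftrightarrow> distinct (gadget_points k) \<and>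
     list_all (\<lambda>(x, y). 0 \<le> x \<and> 0 \<le> y \<and> x + y \<le> 12) (gadget_points k) \<and>
     list_all (\<lambda>e. fst e < snd e \<and> snd e < length (gadget_points k)) (gadget_edges k) \<and>
     list_all (\<lambda>i. list_ex (\<lambda>e. i = fst e \<or> i = snd e) (gadget_edges k) \<and>
        length (filter (\<lambda>e. i = fst e \<or> i = snd e) (gadget_edges k)) \<le> k) [0..<length (gadget_points k)] \<and>
     distinct (gadget_edges k) \<and> sorted_wrt (seg_ok (gadget_points k)) (gadget_edges k)"

lemma gadget_ok_2: "gadget_ok 2" by code_simp
lemma gadget_ok_3: "gadget_ok 3" by code_simp
lemma gadget_ok_4: "gadget_ok 4" by code_simp
lemma gadget_ok_5: "gadget_ok 5" by code_simp

text \<open>The pattern consists of concentric rings, and each ring has positions 0 to 7 modulo 8. The block with index (r,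
  i) for i less than 4 lies in the slab between ring r and ring r + 1. Its corner w is on ring r plus the first
  table entry at position 2 i plus the second table entry; the tables depend on r modulo 4. The slabs with r = 0
  and r = 1 modulo 4 together are a cuboctahedron between two of its squares, and the two slabs after them join it
  to the next cuboctahedron through a ring of eight vertices. Every edge of the pattern is on the boundary of
  exactly one of its triangles, and the remaining faces are quadrilaterals.\<close>

definition corner_up :: "nat \<Rightarrow> nat \<Rightarrow> nat" where
  "corner_up s w = [[0, 0, 1], [0, 1, 1], [0, 1, 1], [0, 0, 1]] ! s ! w"
definition corner_shift :: "nat \<Rightarrow> nat \<Rightarrow> nat" where
  "corner_shift s w = [[0, 2, 1], [1, 0, 2], [0, 0, 1], [1, 2, 2]] ! s ! w"

text \<open>The offset m shifts the index of the first ring; since the tables are periodic, only m modulo 4 matters for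
  comparing blocks with each other.\<close>

definition corner :: "nat \<Rightarrow> nat \<times> nat \<Rightarrow> nat \<Rightarrow> nat \<times> nat" where
  "corner m = (\<lambda>(r, i) w. (r + corner_up ((m + r) mod 4) w, (2 * i + corner_shift ((m + r) mod 4) w) mod 8))"

definition corners :: "nat \<Rightarrow> nat \<times> nat \<Rightarrow> (nat \<times> nat) list" where
  "corners m b = map (corner m b) [0, 1, 2]"

definition common :: "nat \<Rightarrow> nat \<times> nat \<Rightarrow> nat \<times> nat \<Rightarrow> (nat \<times> nat) list" where
  "common m b c = filter (\<lambda>x. x \<in> set (corners m b)) (corners m c)"

definition two_slabs :: "(nat \<times> nat) list" where
  "two_slabs = List.product [0, 1] [0, 1, 2, 3]"

text \<open>Blocks with a common corner lie in the same slab or in consecutive slabs, so that it is enough to compare the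
  eight blocks of two consecutive slabs, for each of the four types of the lower slab.\<close>

definition pattern_ok :: "nat \<Rightarrow> bool" where
  "pattern_ok m \<longleftrightarrow> list_all (\<lambda>b. distinct (corners m b) \<and> list_all (\<lambda>c. b = c \<or> common m b c = [] \<or>
      length (common m b c) = 1 \<and>
      list_all (\<lambda>d. d = b \<or> d = c \<or> common m b d = [] \<or> common m c d = [] \<or> common m b c = common m b d
         \<or> common m b c = common m c d \<or> common m b d = common m c d) two_slabs) two_slabs) two_slabs"

lemma pattern_ok_0: "pattern_ok 0" by code_simp
lemma pattern_ok_1: "pattern_ok 1" by code_simp
lemma pattern_ok_2: "pattern_ok 2" by code_simp
lemma pattern_ok_3: "pattern_ok 3" by code_simp

lemma gadget_checked: "k \<in> {2, 3, 4, 5} \<Longrightarrow> gadget_ok k"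
  using gadget_ok_2 gadget_ok_3 gadget_ok_4 gadget_ok_5 by blast

lemma gadget_straight: "k \<in> {2, 3, 4, 5} \<Longrightarrow> straight_drawing (gadget_points k) (gadget_edges k)"
  using gadget_checked unfolding gadget_ok_def straight_drawing_def list_all_iff list_ex_iff by auto

definition cell :: "complex set" where
  "cell = {z. 0 \<le> Re z \<and> 0 \<le> Im z \<and> Re z + Im z \<le> 12}"

lemma convex_cell: "convex cell"
proof -
  have 1: "cell = {z. 0 \<le> Re z} \<inter> {z. 0 \<le> Im z} \<inter> {z. Re z + Im z \<le> 12}" by (auto simp: cell_def)
  have 2: "convex {z. Re z + Im z \<le> 12}"
  proof -
    have "{z. Re z + Im z \<le> 12} = {z. inner (Complex 1 1) z \<le> 12}" by (simp add: inner_complex_def)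
    then show ?thesis by (simp only: convex_halfspace_le)
  qed
  show ?thesis unfolding 1 by (intro convex_Int convex_halfspace_Re_ge convex_halfspace_Im_ge 2)
qed

lemma gadget_in_cell:
  assumes "k \<in> {2, 3, 4, 5}" "w < length (gadget_points k)"
  shows "grid_point (gadget_points k) w \<in> cell"
proof -
  have "gadget_points k ! w \<in> set (gadget_points k)" using assms by simp
  then have "0 \<le> fst (gadget_points k ! w)" "0 \<le> snd (gadget_points k ! w)"
    "fst (gadget_points k ! w) + snd (gadget_points k ! w) \<le> 12"
    using gadget_checked[OF assms(1)] unfolding gadget_ok_def list_all_iff by (auto simp: case_prod_beta)
  then show ?thesis by (simp add: cell_def grid_point_def flip: of_int_add)
qed

lemma grid_corner:
  "grid_point (gadget_points k) 0 = 0" "grid_point (gadget_points k) 1 = 12"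
  "grid_point (gadget_points k) 2 = Complex 0 12"
  by (simp_all add: grid_point_def gadget_points_def complex_eq_iff)

lemma slab_cases: "(r::nat) mod 4 = 0 \<or> r mod 4 = 1 \<or> r mod 4 = 2 \<or> r mod 4 = 3"
  by presburger

lemma three_cases: "w < (3::nat) \<Longrightarrow> w = 0 \<or> w = 1 \<or> w = 2"
  by auto

lemma corner_table:
  "corner_up 0 0 = 0" "corner_up 0 1 = 0" "corner_up 0 2 = 1" "corner_shift 0 0 = 0" "corner_shift 0 1 = 2" "corner_shift 0 2 = 1"
  "corner_up 1 0 = 0" "corner_up 1 1 = 1" "corner_up 1 2 = 1" "corner_shift 1 0 = 1" "corner_shift 1 1 = 0" "corner_shift 1 2 = 2"
  "corner_up 2 0 = 0" "corner_up 2 1 = 1" "corner_up 2 2 = 1" "corner_shift 2 0 = 0" "corner_shift 2 1 = 0" "corner_shift 2 2 = 1"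
  "corner_up 3 0 = 0" "corner_up 3 1 = 0" "corner_up 3 2 = 1" "corner_shift 3 0 = 1" "corner_shift 3 1 = 2" "corner_shift 3 2 = 2"
  by (simp_all add: corner_up_def corner_shift_def numeral_eq_Suc)

lemma corner_up_le: "w < 3 \<Longrightarrow> corner_up (r mod 4) w \<le> 1"
  using slab_cases[of r] three_cases[of w] corner_table by fastforce

lemma pattern_ok_mod: "pattern_ok (m mod 4)"
  using slab_cases[of m] pattern_ok_0 pattern_ok_1 pattern_ok_2 pattern_ok_3 by metis

text \<open>Reduces the comparison of blocks near ring m to the finite pattern that has been evaluated.\<close>

lemma corner_relative:
  "corner 0 (m + a, i) w = (m + fst (corner (m mod 4) (a, i) w), snd (corner (m mod 4) (a, i) w))"
  by (simp add: corner_def mod_add_left_eq)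

lemma set_corners: "set (corners m b) = corner m b ` {..<3}"
proof -
  have "{..<3::nat} = {0, 1, 2}" by auto
  then show ?thesis by (simp add: corners_def)
qed

lemma set_common: "set (common m b c) = set (corners m b) \<inter> set (corners m c)"
  by (auto simp: common_def)

lemma in_two_slabs: "a < 2 \<Longrightarrow> i < 4 \<Longrightarrow> (a, i) \<in> set two_slabs"
  by (auto simp: two_slabs_def less_2_cases_iff)

lemma corner_inj:
  assumes "i < 4" "w < 3" "u < 3" "corner 0 (r, i) w = corner 0 (r, i) u" shows "w = u"
proof -
  have "distinct (corners (r mod 4) (0, i))"
    using pattern_ok_mod[of r] in_two_slabs[of 0 i] assms(1) unfolding pattern_ok_def list_all_iff by auto
  moreover have "corner (r mod 4) (0, i) w = corner (r mod 4) (0, i) u"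
    using assms(4) corner_relative[of r 0 i] by (simp add: prod_eq_iff)
  ultimately show ?thesis using three_cases[OF assms(2)] three_cases[OF assms(3)] by (auto simp: corners_def)
qed

text \<open>A corner of a block is on one of the two rings that bound its slab.\<close>

lemma slab_diff:
  assumes "w < 3" "u < 3" "corner 0 (r, i) w = corner 0 (s, i') u" shows "r \<le> Suc s" "s \<le> Suc r"
  using assms(3) corner_up_le[OF assms(1), of r] corner_up_le[OF assms(2), of s] by (auto simp: corner_def)

lemma corner_once:
  assumes "i < 4" "i' < 4" "(r, i) \<noteq> (s, i')" "w1 < 3" "w2 < 3" "u1 < 3" "u2 < 3"
    "corner 0 (r, i) w1 = corner 0 (s, i') u1" "corner 0 (r, i) w2 = corner 0 (s, i') u2"
  shows "w1 = w2"
proof -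
  define m where "m = min r s"
  define a where "a = r - m"
  define b where "b = s - m"
  have a: "r = m + a" "a < 2" and b: "s = m + b" "b < 2"
    using slab_diff[OF assms(4,6,8)] unfolding a_def b_def m_def by (auto simp: min_def)
  let ?c = "corner (m mod 4)" and ?m = "m mod 4"
  have B: "(a, i) \<in> set two_slabs" "(b, i') \<in> set two_slabs" "(a, i) \<noteq> (b, i')"
    using in_two_slabs a b assms by auto
  have eq: "?c (a, i) w1 = ?c (b, i') u1" "?c (a, i) w2 = ?c (b, i') u2"
    using assms(8,9) unfolding a(1) b(1) corner_relative by (auto simp: prod_eq_iff)
  then have in_: "?c (a, i) w1 \<in> set (common ?m (a, i) (b, i'))" "?c (a, i) w2 \<in> set (common ?m (a, i) (b, i'))"
    unfolding set_common set_corners using assms(4-7) by (metis IntI image_eqI lessThan_iff)+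
  have "length (common ?m (a, i) (b, i')) = 1"
    using pattern_ok_mod[of m] B in_(1) unfolding pattern_ok_def list_all_iff by fastforce
  then obtain x where "common ?m (a, i) (b, i') = [x]" by (auto simp: length_Suc_conv)
  then have "?c (a, i) w1 = ?c (a, i) w2" using in_ by simp
  then have "corner 0 (r, i) w1 = corner 0 (r, i) w2" unfolding a(1) corner_relative by simp
  then show ?thesis using corner_inj assms by blast
qed

lemma corner_no_triangle:
  assumes i: "i1 < 4" "i2 < 4" "i3 < 4" and ne: "(r1, i1) \<noteq> (r2, i2)" "(r2, i2) \<noteq> (r3, i3)" "(r1, i1) \<noteq> (r3, i3)"
    and w: "w1 < 3" "u1 < 3" "w2 < 3" "u2 < 3" "w3 < 3" "u3 < 3"
    and eq: "corner 0 (r1, i1) w1 = corner 0 (r2, i2) u1" "corner 0 (r2, i2) w2 = corner 0 (r3, i3) u2"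
      "corner 0 (r1, i1) w3 = corner 0 (r3, i3) u3"
  shows "corner 0 (r1, i1) w1 = corner 0 (r2, i2) w2 \<or> corner 0 (r2, i2) w2 = corner 0 (r1, i1) w3 \<or>
    corner 0 (r1, i1) w1 = corner 0 (r1, i1) w3"
proof -
  define m where "m = min r1 (min r2 r3)"
  note sd = slab_diff[OF w(1,2) eq(1)] slab_diff[OF w(3,4) eq(2)] slab_diff[OF w(5,6) eq(3)]
  define a where "a = r1 - m"
  define b where "b = r2 - m"
  define c where "c = r3 - m"
  have abc: "r1 = m + a" "a < 2" "r2 = m + b" "b < 2" "r3 = m + c" "c < 2"
    using sd unfolding a_def b_def c_def m_def by (auto simp: min_def)
  let ?c = "corner (m mod 4)" and ?m = "m mod 4"
  let ?A = "(a, i1)" and ?B = "(b, i2)" and ?C = "(c, i3)"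
  have S: "?A \<in> set two_slabs" "?B \<in> set two_slabs" "?C \<in> set two_slabs" using in_two_slabs abc i by auto
  have n: "?A \<noteq> ?B" "?B \<noteq> ?C" "?A \<noteq> ?C" using ne abc by auto
  have e: "?c ?A w1 = ?c ?B u1" "?c ?B w2 = ?c ?C u2" "?c ?A w3 = ?c ?C u3"
    using eq unfolding abc(1,3,5) corner_relative by (auto simp: prod_eq_iff)
  have mem: "?c x v \<in> set (common ?m x y)" if "?c x v = ?c y u" "v < 3" "u < 3" for x y v u
    unfolding set_common set_corners using that by (metis IntI image_eqI lessThan_iff)
  have m1: "?c ?A w1 \<in> set (common ?m ?A ?B)" by (rule mem[OF e(1) w(1,2)])
  have m2: "?c ?B w2 \<in> set (common ?m ?B ?C)" by (rule mem[OF e(2) w(3,4)])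
  have m3: "?c ?A w3 \<in> set (common ?m ?A ?C)" by (rule mem[OF e(3) w(5,6)])
  have ne': "common ?m ?A ?B \<noteq> []" "common ?m ?B ?C \<noteq> []" "common ?m ?A ?C \<noteq> []" using m1 m2 m3 by auto
  have pat: "\<And>b c. b \<in> set two_slabs \<Longrightarrow> c \<in> set two_slabs \<Longrightarrow> b \<noteq> c \<Longrightarrow> common ?m b c \<noteq> [] \<Longrightarrow>
      length (common ?m b c) = 1 \<and> (\<forall>d\<in>set two_slabs. d = b \<or> d = c \<or> common ?m b d = [] \<or> common ?m c d = [] \<or>
        common ?m b c = common ?m b d \<or> common ?m b c = common ?m c d \<or> common ?m b d = common ?m c d)"
    using pattern_ok_mod[of m] unfolding pattern_ok_def list_all_iff by blast
  have l: "length (common ?m ?A ?B) = 1" "length (common ?m ?B ?C) = 1" "length (common ?m ?A ?C) = 1"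
    using pat[OF S(1,2) n(1) ne'(1)] pat[OF S(2,3) n(2) ne'(2)] pat[OF S(1,3) n(3) ne'(3)] by simp_all
  have one: "x = y" if "length xs = 1" "x \<in> set xs" "y \<in> set xs" for x y :: "nat \<times> nat" and xs
    using that by (auto simp: length_Suc_conv)
  have "common ?m ?A ?B = common ?m ?A ?C \<or> common ?m ?A ?B = common ?m ?B ?C \<or> common ?m ?A ?C = common ?m ?B ?C"
    using pat[OF S(1,2) n(1) ne'(1)] S(3) n ne' by metis
  then have "?c ?A w1 = ?c ?A w3 \<or> ?c ?A w1 = ?c ?B w2 \<or> ?c ?A w3 = ?c ?B w2"
    using one l m1 m2 m3 by metis
  then show ?thesis unfolding abc(1,3,5) corner_relative by auto
qed

definition blocks :: "nat \<Rightarrow> (nat \<times> nat) set" where "blocks j = {..<4 * j + 2} \<times> {..<4}"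

text \<open>Corners are shared between blocks and marked by a last component 0. All other vertices belong to one block and
  carry their own number, which is at least 3.\<close>

definition vertex :: "nat \<times> nat \<Rightarrow> nat \<Rightarrow> nat \<times> nat \<times> nat" where
  "vertex b w = (if w < 3 then (fst (corner 0 b w), snd (corner 0 b w), 0) else (fst b, snd b, w))"

definition gadget_verts :: "nat \<Rightarrow> nat set" where "gadget_verts k = {..<length (gadget_points k)}"
definition gadget_graph_edges :: "nat \<Rightarrow> nat set set" where "gadget_graph_edges k = pair_edge ` set (gadget_edges k)"

lemma vertex_eq_distinct_blocks:
  assumes "b \<noteq> c" "vertex b w = vertex c u"
  shows "w < 3" "u < 3" "corner 0 b w = corner 0 c u"
  using assms by (auto simp: vertex_def prod_eq_iff split: if_splits)

lemma gadget_edge: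
  assumes "k \<in> {2, 3, 4, 5}" "d \<in> gadget_graph_edges k"
  obtains a b where "d = {a, b}" "a < b" "b < length (gadget_points k)" "(a, b) \<in> set (gadget_edges k)"
proof -
  obtain e where e: "e \<in> set (gadget_edges k)" "d = pair_edge e" using assms(2) by (auto simp: gadget_graph_edges_def)
  have "fst e < snd e" "snd e < length (gadget_points k)"
    using gadget_checked[OF assms(1)] e(1) unfolding gadget_ok_def list_all_iff by auto
  then show ?thesis using that[of "fst e" "snd e"] e by (simp add: pair_edge_def case_prod_beta)
qed

lemma glued_pattern:
  assumes k: "k \<in> {2, 3, 4, 5}"
  shows "glued_blocks (blocks j) (gadget_verts k) (gadget_graph_edges k) vertex"
proof
  show "finite (blocks j)" "finite (gadget_verts k)" by (simp_all add: blocks_def gadget_verts_def)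
  show "d \<subseteq> gadget_verts k" "card d = 2" if d: "d \<in> gadget_graph_edges k" for d
  proof -
    obtain a b where "d = {a, b}" "a < b" "b < length (gadget_points k)" "(a, b) \<in> set (gadget_edges k)"
      by (rule gadget_edge[OF k d])
    then show "d \<subseteq> gadget_verts k" "card d = 2" by (auto simp: gadget_verts_def)
  qed
  show "inj_on (vertex b) (gadget_verts k)" if hb: "b \<in> blocks j" for b
  proof (rule inj_onI)
    fix w u assume "vertex b w = vertex b u"
    moreover obtain r i where "b = (r, i)" "i < 4" using hb by (auto simp: blocks_def)
    ultimately show "w = u" using corner_inj[of i w u r] by (auto simp: vertex_def prod_eq_iff split: if_splits)
  qed
  show "w1 = w2" if h: "b \<in> blocks j" "c \<in> blocks j" "b \<noteq> c" "vertex b w1 = vertex c u1" "vertex b w2 = vertex c u2"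
    for b c w1 w2 u1 u2
  proof -
    obtain r i s i' where "b = (r, i)" "c = (s, i')" "i < 4" "i' < 4" using h(1,2) by (auto simp: blocks_def)
    then show ?thesis
      using corner_once[of i i' r s w1 w2 u1 u2] vertex_eq_distinct_blocks[OF h(3,4)] vertex_eq_distinct_blocks[OF h(3,5)] h(3)
      by blast
  qed
  show "vertex b w1 = vertex c w2 \<or> vertex c w2 = vertex b w3 \<or> vertex b w1 = vertex b w3"
    if h: "b \<in> blocks j" "c \<in> blocks j" "d \<in> blocks j" "b \<noteq> c" "c \<noteq> d" "b \<noteq> d"
      "vertex b w1 = vertex c u1" "vertex c w2 = vertex d u2" "vertex b w3 = vertex d u3" for b c d w1 u1 w2 u2 w3 u3
  proof -
    obtain r1 i1 r2 i2 r3 i3 where bcd: "b = (r1, i1)" "c = (r2, i2)" "d = (r3, i3)" "i1 < 4" "i2 < 4" "i3 < 4"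
      using h(1-3) by (auto simp: blocks_def)
    note v1 = vertex_eq_distinct_blocks[OF h(4,7)] and v2 = vertex_eq_distinct_blocks[OF h(5,8)]
      and v3 = vertex_eq_distinct_blocks[OF h(6,9)]
    have "corner 0 b w1 = corner 0 c w2 \<or> corner 0 c w2 = corner 0 b w3 \<or> corner 0 b w1 = corner 0 b w3"
      using corner_no_triangle[OF bcd(4-6), of r1 r2 r3 w1 u1 w2 u2 w3 u3] h(4-6) v1 v2 v3 unfolding bcd by blast
    then show ?thesis using v1(1) v2(1) v3(1) by (auto simp: vertex_def)
  qed
qed

lemma gadget_degree:
  assumes k: "k \<in> {2, 3, 4, 5}" and w: "w \<in> gadget_verts k"
  shows "card {x. {w, x} \<in> gadget_graph_edges k} \<le> k"
proof -
  let ?F = "filter (\<lambda>e. w = fst e \<or> w = snd e) (gadget_edges k)"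
  have "{x. {w, x} \<in> gadget_graph_edges k} \<subseteq> (\<lambda>e. if w = fst e then snd e else fst e) ` set ?F"
  proof
    fix x assume "x \<in> {x. {w, x} \<in> gadget_graph_edges k}"
    then have "{w, x} \<in> gadget_graph_edges k" by simp
    then obtain a b where ab: "{w, x} = {a, b}" "a < b" "b < length (gadget_points k)" "(a, b) \<in> set (gadget_edges k)"
      by (rule gadget_edge[OF k])
    then have "(w = a \<and> x = b) \<or> (w = b \<and> x = a)" by (auto simp: doubleton_eq_iff)
    then show "x \<in> (\<lambda>e. if w = fst e then snd e else fst e) ` set ?F"
      using ab by (intro image_eqI[of _ _ "(a, b)"]) auto
  qed
  then have "card {x. {w, x} \<in> gadget_graph_edges k} \<le> card (set ?F)"
    by (meson List.finite_set card_image_le card_mono finite_imageI order_trans)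
  also have "\<dots> \<le> length ?F" by (rule card_length)
  also have "\<dots> \<le> k" using gadget_checked[OF k] w unfolding gadget_ok_def gadget_verts_def list_all_iff by auto
  finally show ?thesis .
qed

section \<open>Drawing the pattern\<close>

text \<open>Affine coordinates on the cell, with values prescribed at the three corners: the height above ring r, and the
  position along the ring relative to 2 i.\<close>

definition level :: "nat \<Rightarrow> complex \<Rightarrow> real" where
  "level s z = (real (corner_up s 0) * (12 - Re z - Im z) + real (corner_up s 1) * Re z + real (corner_up s 2) * Im z) / 12"

definition angle_of :: "nat \<Rightarrow> complex \<Rightarrow> real" where
  "angle_of s z = (real (corner_shift s 0) * (12 - Re z - Im z) + real (corner_shift s 1) * Re z + real (corner_shift s 2) * Im z) / 12"

text \<open>The exponential map wraps a strip of circumference 8 around the origin, so that the rings become concentric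
  circles.\<close>

definition polar_point :: "real \<Rightarrow> real \<Rightarrow> complex" where
  "polar_point l a = exp (Complex l (a * pi / 4))"

definition place :: "nat \<times> nat \<Rightarrow> complex \<Rightarrow> complex" where
  "place = (\<lambda>(r, i) z. polar_point (real r + level (r mod 4) z) (2 * real i + angle_of (r mod 4) z))"

lemma level_angle_simps:
  "level 0 z = Im z / 12" "angle_of 0 z = (2 * Re z + Im z) / 12"
  "level 1 z = (Re z + Im z) / 12" "angle_of 1 z = (12 - Re z + Im z) / 12"
  "level 2 z = (Re z + Im z) / 12" "angle_of 2 z = Im z / 12"
  "level 3 z = Im z / 12" "angle_of 3 z = (12 + Re z + Im z) / 12"
  by (simp_all add: level_def angle_of_def corner_table corner_table[unfolded One_nat_def])

lemma polar_point_eq: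
  assumes "polar_point l a = polar_point l' a'" obtains n :: int where "l = l'" "a - a' = 8 * of_int n"
proof -
  obtain n :: int where n: "Complex l (a * pi / 4) = Complex l' (a' * pi / 4) + of_real (of_int (2 * n) * pi) * \<i>"
    using assms unfolding polar_point_def exp_eq by blast
  have "l = l'" using arg_cong[OF n, of Re] by simp
  moreover have "a * pi / 4 = a' * pi / 4 + of_int (2 * n) * pi" using arg_cong[OF n, of Im] by simp
  then have "pi * (a - a') = pi * (8 * of_int n)" by (simp add: field_simps)
  then have "a - a' = 8 * of_int n" by simp
  ultimately show ?thesis using that by blast
qed

lemma polar_point_mod: "polar_point l (real (a mod 8)) = polar_point l (real a)"
proof -
  have "real a = real (a mod 8) + 8 * real (a div 8)" by (metis mult_div_mod_eq of_nat_add of_nat_mult of_nat_numeral add.commute)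
  then have "Complex l (real a * pi / 4) = Complex l (real (a mod 8) * pi / 4) + of_real (of_int (2 * int (a div 8)) * pi) * \<i>"
    by (simp add: complex_eq_iff field_simps)
  then show ?thesis unfolding polar_point_def using exp_eq by metis
qed

lemma cell_bounds:
  assumes "z \<in> cell"
  shows "0 \<le> level (r mod 4) z" "level (r mod 4) z \<le> 1" "0 \<le> angle_of (r mod 4) z" "angle_of (r mod 4) z \<le> 2"
  using assms slab_cases[of r] by (auto simp: cell_def level_angle_simps level_angle_simps[unfolded One_nat_def])

lemma place_inj: "inj_on (place b) cell"
proof (rule inj_onI)
  fix z z' assume z: "z \<in> cell" "z' \<in> cell" and eq: "place b z = place b z'"
  obtain r i where b: "b = (r, i)" by (cases b)
  obtain n :: int where n: "real r + level (r mod 4) z = real r + level (r mod 4) z'"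
    "(2 * real i + angle_of (r mod 4) z) - (2 * real i + angle_of (r mod 4) z') = 8 * of_int n"
    using eq unfolding b place_def prod.case by (rule polar_point_eq)
  have "\<bar>8 * real_of_int n\<bar> \<le> 2" using n(2) cell_bounds[OF z(1), of r] cell_bounds[OF z(2), of r] by linarith
  then have "n = 0" by linarith
  then have "level (r mod 4) z = level (r mod 4) z'" "angle_of (r mod 4) z = angle_of (r mod 4) z'" using n by auto
  then show "z = z'" using slab_cases[of r]
    by (auto simp: level_angle_simps level_angle_simps[unfolded One_nat_def] complex_eq_iff)
qed

lemma place_continuous: "continuous_on cell (place b)"
proof -
  obtain r i where b: "b = (r, i)" by (cases b)
  show ?thesis unfolding b place_def polar_point_def level_def angle_of_def prod.case
    by (intro continuous_intros continuous_on_exp) (simp_all add: Complex_eq, (intro continuous_intros)?)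
qed

lemma place_corner:
  assumes "w < 3"
  shows "place b (grid_point (gadget_points k) w) = polar_point (real (fst (corner 0 b w))) (real (snd (corner 0 b w)))"
proof -
  obtain r i where b: "b = (r, i)" by (cases b)
  have "level (r mod 4) (grid_point (gadget_points k) w) = corner_up (r mod 4) w"
    "angle_of (r mod 4) (grid_point (gadget_points k) w) = corner_shift (r mod 4) w"
    using three_cases[OF assms] grid_corner[of k] by (auto simp: level_def angle_of_def)
  then show ?thesis unfolding b by (simp add: place_def corner_def polar_point_mod)
qed

text \<open>Positions on a ring are residues modulo 8, and different residues give different points of the circle.\<close>

lemma place_eq_at_corners:
  assumes "w < 3" "u < 3"
    and eq: "place b (grid_point (gadget_points k) w) = place c (grid_point (gadget_points k) u)"
  shows "corner 0 b w = corner 0 c u"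
proof -
  have lt: "snd (corner 0 b w) < 8" "snd (corner 0 c u) < 8" by (simp_all add: corner_def case_prod_beta)
  have "polar_point (real (fst (corner 0 b w))) (real (snd (corner 0 b w)))
      = polar_point (real (fst (corner 0 c u))) (real (snd (corner 0 c u)))"
    using eq unfolding place_corner[OF assms(1)] place_corner[OF assms(2)] .
  then obtain n :: int where n: "real (fst (corner 0 b w)) = real (fst (corner 0 c u))"
    "real (snd (corner 0 b w)) - real (snd (corner 0 c u)) = 8 * of_int n"
    by (rule polar_point_eq)
  have "\<bar>8 * real_of_int n\<bar> < 8" using n(2) lt by linarith
  then have "n = 0" by linarith
  then show ?thesis using n by (simp add: prod_eq_iff)
qed

definition cell_corners :: "complex set" where "cell_corners = {0, 12, Complex 0 12}"

lemma cell_corners_iff: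
  "z \<in> cell_corners \<longleftrightarrow> (Re z = 0 \<and> Im z = 0) \<or> (Re z = 12 \<and> Im z = 0) \<or> (Re z = 0 \<and> Im z = 12)"
  by (auto simp: cell_corners_def complex_eq_iff)

lemma cell_corner_point:
  assumes "z \<in> cell_corners" shows "\<exists>w<3. z = grid_point (gadget_points k) w"
proof -
  consider "z = 0" | "z = 12" | "z = Complex 0 12" using assms by (auto simp: cell_corners_def)
  then show ?thesis
  proof cases
    case 1 then show ?thesis using grid_corner(1)[of k] by (intro exI[of _ 0]) simp
  next
    case 2 then show ?thesis using grid_corner(2)[of k] by (intro exI[of _ 1]) simp
  next
    case 3 then show ?thesis using grid_corner(3)[of k] by (intro exI[of _ 2]) simp
  qed
qed

text \<open>The base positions of blocks are even and the circumference is 8, so the offsets of a common point within two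
  blocks differ by an even number, which is at most 2.\<close>

lemma angles_integral:
  assumes "2 * real i + a - (2 * real i' + a') = 8 * of_int n" "0 \<le> a" "a \<le> 2" "0 \<le> a'" "a' \<le> 2"
  shows "a - a' = -2 \<or> a - a' = 0 \<or> a - a' = 2"
proof -
  define J where "J = 4 * n + int i' - int i"
  have J: "a - a' = 2 * real_of_int J" using assms(1) by (simp add: J_def)
  then have "-1 \<le> real_of_int J" "real_of_int J \<le> 1" using assms by linarith+
  then have "J = -1 \<or> J = 0 \<or> J = 1" by linarith
  then show ?thesis using J by auto
qed

lemma angle_12:
  "12 * angle_of 0 z = 2 * Re z + Im z" "12 * angle_of 1 z = 12 - Re z + Im z"
  "12 * angle_of 2 z = Im z" "12 * angle_of 3 z = 12 + Re z + Im z"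
  unfolding level_angle_simps by simp_all

text \<open>The common point has height 1 in the lower slab and height 0 in the upper one. In each of the four types one of
  the two triangles has only a corner at this height, or both have a side but the two sides are shifted by an odd
  number; so the offsets leave only corners.\<close>

lemma meet_next_slab:
  assumes z: "z \<in> cell" "z' \<in> cell" and eq: "place (r, i) z = place (Suc r, i') z'"
  shows "z \<in> cell_corners \<and> z' \<in> cell_corners"
proof -
  obtain n :: int where n: "real r + level (r mod 4) z = real (Suc r) + level (Suc r mod 4) z'"
    "2 * real i + angle_of (r mod 4) z - (2 * real i' + angle_of (Suc r mod 4) z') = 8 * of_int n"
    using eq unfolding place_def prod.case by (rule polar_point_eq)
  note bd = cell_bounds[OF z(1), of r] cell_bounds[OF z(2), of "Suc r"]
  have lev: "level (r mod 4) z = 1" "level (Suc r mod 4) z' = 0" using n(1) bd by simp_all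
  have ang: "12 * angle_of (r mod 4) z - 12 * angle_of (Suc r mod 4) z' \<in> {-24, 0, 24}"
    using angles_integral[OF n(2) bd(3,4,7,8)] by (elim disjE) simp_all
  have c: "0 \<le> Re z" "0 \<le> Im z" "Re z + Im z \<le> 12" "0 \<le> Re z'" "0 \<le> Im z'" "Re z' + Im z' \<le> 12"
    using z by (auto simp: cell_def)
  consider "r mod 4 = 0" "Suc r mod 4 = 1" | "r mod 4 = 1" "Suc r mod 4 = 2" | "r mod 4 = 2" "Suc r mod 4 = 3"
    | "r mod 4 = 3" "Suc r mod 4 = 0" using slab_cases[of r] by (auto simp: mod_Suc)
  then show ?thesis
  proof cases
    case 1
    then show ?thesis unfolding cell_corners_iff
      using lev[unfolded 1 level_angle_simps] c by (smt (verit) divide_eq_0_iff divide_eq_1_iff)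
  next
    case 2
    have "Re z + Im z = 12" "Re z' + Im z' = 0" using lev[unfolded 2 level_angle_simps] by simp_all
    moreover have "12 - Re z + Im z - Im z' \<in> {-24, 0, 24}" using ang unfolding 2 angle_12 by simp
    ultimately show ?thesis unfolding cell_corners_iff using c by (smt (verit) empty_iff insert_iff)
  next
    case 3
    have "Re z + Im z = 12" "Im z' = 0" using lev[unfolded 3 level_angle_simps] by simp_all
    moreover have "Im z - (12 + Re z' + Im z') \<in> {-24, 0, 24}" using ang unfolding 3 angle_12 by simp
    ultimately show ?thesis unfolding cell_corners_iff using c by (smt (verit) empty_iff insert_iff)
  next
    case 4
    have "Im z = 12" "Im z' = 0" using lev[unfolded 4 level_angle_simps] by simp_all
    moreover have "12 + Re z + Im z - (2 * Re z' + Im z') \<in> {-24, 0, 24}" using ang unfolding 4 angle_12 by simp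
    ultimately show ?thesis unfolding cell_corners_iff using c by (smt (verit) empty_iff insert_iff)
  qed
qed

text \<open>Different blocks of a slab have offsets that differ by exactly 2, so one offset is 0 and the other is 2. Such
  values are attained only at corners, and in half of the types not at all.\<close>

lemma meet_same_slab:
  assumes z: "z \<in> cell" "z' \<in> cell" and i: "i < 4" "i' < 4" "i \<noteq> i'" and eq: "place (r, i) z = place (r, i') z'"
  shows "z \<in> cell_corners \<and> z' \<in> cell_corners"
proof -
  obtain n :: int where n: "real r + level (r mod 4) z = real r + level (r mod 4) z'"
    "2 * real i + angle_of (r mod 4) z - (2 * real i' + angle_of (r mod 4) z') = 8 * of_int n"
    using eq unfolding place_def prod.case by (rule polar_point_eq)
  note bd = cell_bounds[OF z(1), of r] cell_bounds[OF z(2), of r]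
  have "angle_of (r mod 4) z - angle_of (r mod 4) z' \<noteq> 0"
  proof
    assume "angle_of (r mod 4) z - angle_of (r mod 4) z' = 0"
    then have "2 * real i - 2 * real i' = 8 * real_of_int n" using n(2) by simp
    then have "real_of_int (int i - int i') = real_of_int (4 * n)" by simp
    then have "int i - int i' = 4 * n" by (simp only: of_int_eq_iff)
    then show False using i by presburger
  qed
  then have ang: "12 * angle_of (r mod 4) z - 12 * angle_of (r mod 4) z' \<in> {-24, 24}"
    using angles_integral[OF n(2) bd(3,4,7,8)] by (elim disjE) simp_all
  have c: "0 \<le> Re z" "0 \<le> Im z" "Re z + Im z \<le> 12" "0 \<le> Re z'" "0 \<le> Im z'" "Re z' + Im z' \<le> 12"
    using z by (auto simp: cell_def)
  consider "r mod 4 = 0" | "r mod 4 = 1" | "r mod 4 = 2" | "r mod 4 = 3" using slab_cases[of r] by metis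
  then show ?thesis
  proof cases
    case 1
    have "2 * Re z + Im z - (2 * Re z' + Im z') \<in> {-24, 24}" using ang unfolding 1 angle_12 by simp
    then show ?thesis unfolding cell_corners_iff using c by (smt (verit) empty_iff insert_iff)
  next
    case 2
    have "12 - Re z + Im z - (12 - Re z' + Im z') \<in> {-24, 24}" using ang unfolding 2 angle_12 by simp
    then show ?thesis unfolding cell_corners_iff using c by (smt (verit) empty_iff insert_iff)
  next
    case 3
    have "Im z - Im z' \<in> {-24, 24}" using ang unfolding 3 angle_12 by simp
    then show ?thesis using c by (smt (verit) empty_iff insert_iff)
  next
    case 4
    have "12 + Re z + Im z - (12 + Re z' + Im z') \<in> {-24, 24}" using ang unfolding 4 angle_12 by simp
    then show ?thesis using c by (smt (verit) empty_iff insert_iff)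
  qed
qed

lemma blocks_meet_at_vertices:
  assumes b: "b \<in> blocks j" "c \<in> blocks j" "b \<noteq> c" and z: "z \<in> cell" "z' \<in> cell" and eq: "place b z = place c z'"
  shows "\<exists>w<3. \<exists>u<3. z = grid_point (gadget_points k) w \<and> z' = grid_point (gadget_points k) u \<and>
     corner 0 b w = corner 0 c u"
proof -
  obtain r i s i' where bc: "b = (r, i)" "c = (s, i')" "i < 4" "i' < 4" using b by (auto simp: blocks_def)
  have "z \<in> cell_corners \<and> z' \<in> cell_corners"
  proof -
    obtain n :: int where n: "real r + level (r mod 4) z = real s + level (s mod 4) z'"
      "2 * real i + angle_of (r mod 4) z - (2 * real i' + angle_of (s mod 4) z') = 8 * of_int n"
      using eq unfolding bc place_def prod.case by (rule polar_point_eq)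
    have "real r \<le> real s + 1" "real s \<le> real r + 1"
      using n(1) cell_bounds[OF z(1), of r] cell_bounds[OF z(2), of s] by linarith+
    then consider "r = s" | "s = Suc r" | "r = Suc s" by linarith
    then show ?thesis
    proof cases
      case 1 then show ?thesis using meet_same_slab[OF z bc(3,4)] eq b(3) unfolding bc by blast
    next
      case 2 then show ?thesis using meet_next_slab[OF z] eq unfolding bc by blast
    next
      case 3 then show ?thesis using meet_next_slab[OF z(2,1)] eq unfolding bc by metis
    qed
  qed
  then obtain w u where "w < 3" "z = grid_point (gadget_points k) w" "u < 3" "z' = grid_point (gadget_points k) u"
    using cell_corner_point[of z k] cell_corner_point[of z' k] by blast
  then show ?thesis using place_eq_at_corners[of w u b k c] eq by blast
qed

lemma gadget_planar_drawing:
  "k \<in> {2, 3, 4, 5} \<Longrightarrow> planar_drawing (gadget_verts k, gadget_graph_edges k) (grid_point (gadget_points k)) (segment_of (gadget_points k))"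
  unfolding gadget_verts_def gadget_graph_edges_def by (rule straight_drawing_planar[OF gadget_straight])

lemma length_gadget_points: "k \<in> {2, 3, 4, 5} \<Longrightarrow> length (gadget_points k) = (if k = 5 then 12 else if k = 4 then 6 else if k = 3 then 4 else 3)"
  by (auto simp: gadget_points_def)

lemma pattern_planar:
  assumes k: "k \<in> {2, 3, 4, 5}"
  shows "planar (glued_blocks.glued_verts (blocks j) (gadget_verts k) vertex,
    glued_blocks.glued_edges (blocks j) (gadget_graph_edges k) vertex)"
proof -
  interpret glued_blocks "blocks j" "gadget_verts k" "gadget_graph_edges k" vertex by (rule glued_pattern[OF k])
  let ?q = "grid_point (gadget_points k)"
  define pos where "pos = (\<lambda>(a, m, t). if t < 3 then polar_point (real a) (real m) else place (a, m) (?q t))"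
  have three: "{..<3} \<subseteq> gadget_verts k" using length_gadget_points[OF k] k by (auto simp: gadget_verts_def)
  have "planar (\<Union>b\<in>blocks j. vertex b ` gadget_verts k, \<Union>b\<in>blocks j. (`) (vertex b) ` gadget_graph_edges k)"
  proof (rule glued_planar_drawing[OF gadget_planar_drawing[OF k] D_sub, where S = cell and \<psi> = place and pos = pos])
    show "?q ` gadget_verts k \<subseteq> cell" using gadget_in_cell[OF k] by (auto simp: gadget_verts_def)
    show "path_image (segment_of (gadget_points k) d) \<subseteq> cell" if d: "d \<in> gadget_graph_edges k" for d
    proof -
      obtain a b where ab: "d = {a, b}" "a < b" "b < length (gadget_points k)" "(a, b) \<in> set (gadget_edges k)"
        by (rule gadget_edge[OF k d])
      then have "?q a \<in> cell" "?q b \<in> cell" using gadget_in_cell[OF k] by auto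
      then show ?thesis using closed_segment_subset[OF _ _ convex_cell] ab by (simp add: segment_pair)
    qed
    show "card d = 2" if "d \<in> gadget_graph_edges k" for d by (rule D_card[OF that])
    show "continuous_on cell (place b)" "inj_on (place b) cell" for b by (rule place_continuous, rule place_inj)
    show "inj_on (vertex b) (gadget_verts k)" if "b \<in> blocks j" for b by (rule \<nu>_inj[OF that])
    show "\<exists>w\<in>gadget_verts k. \<exists>w'\<in>gadget_verts k. z = ?q w \<and> z' = ?q w' \<and> vertex b w = vertex c w'"
      if h: "b \<in> blocks j" "c \<in> blocks j" "b \<noteq> c" "z \<in> cell" "z' \<in> cell" "place b z = place c z'" for b c z z'
    proof -
      obtain w u where wu: "w < 3" "u < 3" "z = ?q w" "z' = ?q u" "corner 0 b w = corner 0 c u"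
        using blocks_meet_at_vertices[OF h, of k] by blast
      then have "vertex b w = vertex c u" by (simp add: vertex_def)
      moreover have "w \<in> gadget_verts k" "u \<in> gadget_verts k" using wu(1,2) three by auto
      ultimately show ?thesis using wu(3,4) by blast
    qed
    show "pos (vertex b w) = place b (?q w)" if "b \<in> blocks j" "w \<in> gadget_verts k" for b w
      by (simp add: pos_def vertex_def place_corner case_prod_beta)
    show "w1 = w2" if "b \<in> blocks j" "c \<in> blocks j" "b \<noteq> c" "w1 \<in> gadget_verts k" "w2 \<in> gadget_verts k"
      "u1 \<in> gadget_verts k" "u2 \<in> gadget_verts k" "vertex b w1 = vertex c u1" "vertex b w2 = vertex c u2" for b c w1 w2 u1 u2
      by (rule once[OF that])
  qed
  then show ?thesis unfolding glued_verts_def glued_edges_def block_edges_def .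
qed

section \<open>The size of the extremal graphs\<close>

definition ring_positions :: "nat \<Rightarrow> nat set" where
  "ring_positions r = (if r mod 4 = 3 then {..<8} else if r mod 4 = 1 then {1, 3, 5, 7} else {0, 2, 4, 6})"

lemma four_cases: "i < (4::nat) \<Longrightarrow> i = 0 \<or> i = 1 \<or> i = 2 \<or> i = 3"
  by auto

lemma corner_in_ring:
  assumes "i < 4" "w < 3" shows "snd (corner 0 (r, i) w) \<in> ring_positions (fst (corner 0 (r, i) w))"
proof -
  have m: "Suc r mod 4 = (if r mod 4 = 3 then 0 else Suc (r mod 4))" by (simp add: mod_Suc)
  show ?thesis
    using slab_cases[of r] three_cases[OF assms(2)] four_cases[OF assms(1)]
    by (elim disjE) (simp_all add: corner_def ring_positions_def corner_table corner_table[unfolded One_nat_def] m)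
qed

text \<open>A position on ring r is a lower corner in the slab above the ring or an upper corner in the slab below it; the
  choice of the slab makes sure that it exists for the first and for the last ring.\<close>

lemma ring_is_corner:
  assumes "r < 4 * j + 3" "a \<in> ring_positions r"
  shows "\<exists>b\<in>blocks j. \<exists>w<3. corner 0 b w = (r, a)"
proof -
  have ex: ?thesis if "s < 4 * j + 2" "i < 4" "w < 3" "corner 0 (s, i) w = (r, a)" for s i w
    using that by (intro bexI[of _ "(s, i)"] exI[of _ w]) (simp_all add: blocks_def)
  have a8: "a < 8" using assms(2) by (auto simp: ring_positions_def split: if_splits)
  consider "r mod 4 = 0" | "r mod 4 = 1" | "r mod 4 = 2" | "r mod 4 = 3" using slab_cases[of r] by metis
  then show ?thesis
  proof cases
    case 1
    then have "a mod 8 = a" "2 * (a div 2) = a" using assms a8 by (auto simp: ring_positions_def)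
    moreover have "r < 4 * j + 2" using 1 assms(1) by presburger
    ultimately show ?thesis using 1 a8 by (intro ex[of r "a div 2" 0]) (auto simp: corner_def corner_table)
  next
    case 2
    then have "a mod 8 = a" "2 * (a div 2) + 1 = a" using assms a8 by (auto simp: ring_positions_def)
    moreover have "r < 4 * j + 2" using 2 assms(1) by presburger
    ultimately show ?thesis using 2 a8 by (intro ex[of r "a div 2" 0]) (auto simp: corner_def corner_table corner_table[unfolded One_nat_def])
  next
    case 3
    then obtain s where s: "r = Suc s" "s mod 4 = 1" by (cases r) (auto simp: mod_Suc split: if_splits)
    then have "a mod 8 = a" "2 * (a div 2) = a" "s < 4 * j + 2" using assms 3 a8 by (auto simp: ring_positions_def)
    then show ?thesis using s a8 by (intro ex[of s "a div 2" 1]) (auto simp: corner_def corner_table corner_table[unfolded One_nat_def])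
  next
    case 4
    then obtain s where s: "r = Suc s" "s mod 4 = 2" by (cases r) (auto simp: mod_Suc split: if_splits)
    have sj: "s < 4 * j + 2" "a mod 8 = a" using assms s a8 by auto
    show ?thesis
    proof (cases "even a")
      case True
      then have "2 * (a div 2) = a" by simp
      then show ?thesis using s sj a8 by (intro ex[of s "a div 2" 1]) (auto simp: corner_def corner_table corner_table[unfolded One_nat_def])
    next
      case False
      then have "2 * (a div 2) + 1 = a" by presburger
      then show ?thesis using s sj a8 by (intro ex[of s "a div 2" 2]) (auto simp: corner_def corner_table corner_table[unfolded One_nat_def])
    qed
  qed
qed

lemma card_rings: "(\<Sum>r<4 * j + 3. card (ring_positions r)) = 20 * j + 12"
proof (induction j)
  case 0
  have "{..<3::nat} = {0, 1, 2}" by auto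
  then show ?case by (simp add: ring_positions_def)
next
  case (Suc j)
  have eq: "4 * Suc j + 3 = Suc (Suc (Suc (Suc (4 * j + 3))))" by simp
  have "(4 * j + 3) mod 4 = 3" "Suc (4 * j + 3) mod 4 = 0" "Suc (Suc (4 * j + 3)) mod 4 = 1"
    "Suc (Suc (Suc (4 * j + 3))) mod 4 = 2" by presburger+
  then have c: "card (ring_positions (4 * j + 3)) = 8" "card (ring_positions (Suc (4 * j + 3))) = 4"
    "card (ring_positions (Suc (Suc (4 * j + 3)))) = 4" "card (ring_positions (Suc (Suc (Suc (4 * j + 3))))) = 4"
    unfolding ring_positions_def by simp_all
  show ?case unfolding eq sum.lessThan_Suc Suc c by simp
qed

lemma card_pattern_verts:
  assumes k: "k \<in> {2, 3, 4, 5}"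
  shows "card (glued_blocks.glued_verts (blocks j) (gadget_verts k) vertex)
    = 20 * j + 12 + (16 * j + 8) * (length (gadget_points k) - 3)"
proof -
  interpret glued_blocks "blocks j" "gadget_verts k" "gadget_graph_edges k" vertex by (rule glued_pattern[OF k])
  let ?N = "length (gadget_points k)"
  have N: "3 \<le> ?N" using length_gadget_points[OF k] by auto
  let ?R = "(\<lambda>(r, a). (r, a, 0)) ` (SIGMA r:{..<4 * j + 3}. ring_positions r)"
  let ?J = "(\<lambda>((r, i), w). (r, i, w)) ` (blocks j \<times> {3..<?N})"
  have eq: "glued_verts = ?R \<union> ?J"
  proof
    show "glued_verts \<subseteq> ?R \<union> ?J"
    proof
      fix x assume "x \<in> glued_verts"
      then obtain r i w where x: "(r, i) \<in> blocks j" "w < ?N" "x = vertex (r, i) w"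
        unfolding glued_verts_def by (auto simp: gadget_verts_def)
      have ri: "r < 4 * j + 2" "i < 4" using x(1) by (auto simp: blocks_def)
      show "x \<in> ?R \<union> ?J"
      proof (cases "w < 3")
        case True
        have "fst (corner 0 (r, i) w) \<le> r + 1" using corner_up_le[OF True, of r] by (simp add: corner_def)
        then have "corner 0 (r, i) w \<in> (SIGMA r:{..<4 * j + 3}. ring_positions r)"
          using corner_in_ring[OF ri(2) True, of r] ri by (cases "corner 0 (r, i) w") auto
        then have "(\<lambda>(r, a). (r, a, 0)) (corner 0 (r, i) w) \<in> ?R" by (rule imageI)
        then have "x \<in> ?R" using x True by (simp add: vertex_def case_prod_beta)
        then show ?thesis by (rule UnI1)
      next
        case False
        then have "(\<lambda>((r, i), w). (r, i, w)) ((r, i), w) \<in> ?J" using x by (intro imageI) auto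
        then have "x \<in> ?J" using x False by (simp add: vertex_def)
        then show ?thesis by (rule UnI2)
      qed
    qed
    show "?R \<union> ?J \<subseteq> glued_verts"
    proof
      fix x assume "x \<in> ?R \<union> ?J"
      then show "x \<in> glued_verts"
      proof
        assume "x \<in> ?R"
        then obtain r a where ra: "r < 4 * j + 3" "a \<in> ring_positions r" "x = (r, a, 0)" by auto
        then obtain b w where bw: "b \<in> blocks j" "w < 3" "corner 0 b w = (r, a)" using ring_is_corner by blast
        then have "x = vertex b w" "w \<in> gadget_verts k" using ra N by (simp_all add: vertex_def gadget_verts_def)
        then show ?thesis using bw(1) unfolding glued_verts_def by blast
      next
        assume "x \<in> ?J"
        then obtain r i w where w: "(r, i) \<in> blocks j" "3 \<le> w" "w < ?N" "x = (r, i, w)" by auto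
        then have "x = vertex (r, i) w" "w \<in> gadget_verts k" by (simp_all add: vertex_def gadget_verts_def)
        then show ?thesis using w(1) unfolding glued_verts_def by blast
      qed
    qed
  qed
  have disj: "?R \<inter> ?J = {}" by auto
  have cR: "card ?R = 20 * j + 12"
  proof -
    have "finite (ring_positions r)" for r by (simp add: ring_positions_def)
    then have "card (SIGMA r:{..<4 * j + 3}. ring_positions r) = 20 * j + 12" using card_rings[of j] by simp
    moreover have "card ?R = card (SIGMA r:{..<4 * j + 3}. ring_positions r)" by (rule card_image) (auto simp: inj_on_def)
    ultimately show ?thesis by simp
  qed
  have cJ: "card ?J = (16 * j + 8) * (?N - 3)"
  proof -
    have "card ?J = card (blocks j \<times> {3..<?N})" by (rule card_image) (auto simp: inj_on_def)
    then show ?thesis by (simp add: blocks_def card_cartesian_product)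
  qed
  have fin: "finite ?R" "finite ?J" by (auto simp: ring_positions_def blocks_def)
  show ?thesis unfolding eq card_Un_disjoint[OF fin disj] cR cJ ..
qed

lemma card_gadget_edges: "k \<in> {2, 3, 4, 5} \<Longrightarrow> card (gadget_graph_edges k) = length (gadget_edges k)"
proof -
  assume k: "k \<in> {2, 3, 4, 5}"
  have "inj_on pair_edge (set (gadget_edges k))"
  proof (rule inj_onI)
    fix e f assume e: "e \<in> set (gadget_edges k)" "f \<in> set (gadget_edges k)" "pair_edge e = pair_edge f"
    have "fst e < snd e" "fst f < snd f" using gadget_checked[OF k] e unfolding gadget_ok_def list_all_iff by auto
    then show "e = f" using e(3) by (auto simp: pair_edge_def case_prod_beta doubleton_eq_iff prod_eq_iff)
  qed
  moreover have "distinct (gadget_edges k)" using gadget_checked[OF k] by (simp add: gadget_ok_def)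
  ultimately show ?thesis by (simp add: gadget_graph_edges_def card_image distinct_card)
qed

lemma card_pattern_edges:
  assumes k: "k \<in> {2, 3, 4, 5}"
  shows "card (glued_blocks.glued_edges (blocks j) (gadget_graph_edges k) vertex) = (16 * j + 8) * length (gadget_edges k)"
proof -
  interpret glued_blocks "blocks j" "gadget_verts k" "gadget_graph_edges k" vertex by (rule glued_pattern[OF k])
  have "card (blocks j) = 16 * j + 8" by (simp add: blocks_def card_cartesian_product)
  then show ?thesis using card_glued_edges card_gadget_edges[OF k] by simp
qed

section \<open>The planar Turan number of fans\<close>

lemma planar_rename:
  assumes pl: "planar (V, E)" and h: "inj h" shows "planar (h ` V, (`) h ` E)"
proof -
  obtain p \<gamma> where dr: "planar_drawing (V, E) p \<gamma>" using pl by (auto simp: planar_def)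
  let ?g = "inv h"
  have g: "?g (h x) = x" "?g ` h ` S = S" for x S using h by (simp_all add: image_image)
  have pg: "(p \<circ> ?g) ` h ` S = p ` S" for S using g(2)[of S] by (metis image_comp)
  have loc: "arc (\<gamma> d)" "{pathstart (\<gamma> d), pathfinish (\<gamma> d)} = p ` d" "path_image (\<gamma> d) \<inter> p ` V = p ` d"
    if "d \<in> E" for d using dr that by (auto simp: planar_drawing_def)
  have "planar_drawing (h ` V, (`) h ` E) (p \<circ> ?g) (\<lambda>e. \<gamma> (?g ` e))"
    unfolding planar_drawing_def fst_conv snd_conv
  proof (intro conjI ballI impI)
    show "inj_on (p \<circ> ?g) (h ` V)" using dr g(1) by (auto simp: planar_drawing_def inj_on_def)
    fix e assume "e \<in> (`) h ` E"
    then obtain d where d: "d \<in> E" "e = h ` d" by blast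
    show "arc (\<gamma> (?g ` e))" unfolding d(2) g(2) by (rule loc(1)[OF d(1)])
    show "{pathstart (\<gamma> (?g ` e)), pathfinish (\<gamma> (?g ` e))} = (p \<circ> ?g) ` e"
      unfolding d(2) g(2) pg by (rule loc(2)[OF d(1)])
    show "path_image (\<gamma> (?g ` e)) \<inter> (p \<circ> ?g) ` h ` V = (p \<circ> ?g) ` e"
      unfolding d(2) g(2) pg by (rule loc(3)[OF d(1)])
    fix f assume "f \<in> (`) h ` E" and ef: "e \<noteq> f"
    then obtain d' where d': "d' \<in> E" "f = h ` d'" by blast
    have i: "h ` d \<inter> h ` d' = h ` (d \<inter> d')" using image_Int[OF h] by simp
    have "d \<noteq> d'" using ef d d' by blast
    then have "path_image (\<gamma> d) \<inter> path_image (\<gamma> d') = p ` (d \<inter> d')" using dr d(1) d'(1) by (simp add: planar_drawing_def)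
    then show "path_image (\<gamma> (?g ` e)) \<inter> path_image (\<gamma> (?g ` f)) = (p \<circ> ?g) ` (e \<inter> f)"
      unfolding d(2) d'(2) g(2) i pg .
  qed
  then show ?thesis unfolding planar_def by blast
qed

lemma contains_copy_rename:
  assumes copy: "contains_copy (h ` V, (`) h ` E) H" and h: "inj h"
  shows "contains_copy (V, E) H"
proof -
  obtain \<phi> where \<phi>: "inj_on \<phi> (verts H)" "\<phi> ` verts H \<subseteq> h ` V" "\<forall>e\<in>edges H. \<phi> ` e \<in> (`) h ` E"
    using copy by (auto simp: contains_copy_def)
  let ?g = "inv h"
  have g: "?g (h x) = x" "?g ` h ` S = S" for x S using h by (simp_all add: image_image)
  have a: "inj_on (?g \<circ> \<phi>) (verts H)"
  proof (rule comp_inj_on[OF \<phi>(1)])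
    show "inj_on ?g (\<phi> ` verts H)" by (rule inj_on_subset[OF inj_on_inv_into]) (use \<phi>(2) in auto)
  qed
  have b: "(?g \<circ> \<phi>) ` verts H \<subseteq> V" using image_mono[OF \<phi>(2), of ?g] g(2)[of V] by (simp add: image_comp)
  have c: "(?g \<circ> \<phi>) ` e \<in> E" if "e \<in> edges H" for e
  proof -
    have "\<phi> ` e \<in> (`) h ` E" using \<phi>(3) that by blast
    then obtain d where "d \<in> E" "\<phi> ` e = h ` d" by blast
    then have "(?g \<circ> \<phi>) ` e = d" using g(2)[of d] by (metis image_comp)
    then show ?thesis using \<open>d \<in> E\<close> by simp
  qed
  show ?thesis unfolding contains_copy_def fst_conv snd_conv
    by (intro exI[of _ "?g \<circ> \<phi>"] conjI ballI a b c)
qed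

text \<open>With j extra periods the pattern has 16 j + 8 triangles and 20 j + 12 corners.\<close>

lemma extremal_graph:
  assumes k: "k \<in> {2, 3, 4, 5}"
  shows "\<exists>G \<in> free_planar_graphs (20 * j + 12 + (16 * j + 8) * (length (gadget_points k) - 3)) (fan k).
    card (edges G) = (16 * j + 8) * length (gadget_edges k)"
proof -
  interpret glued_blocks "blocks j" "gadget_verts k" "gadget_graph_edges k" vertex by (rule glued_pattern[OF k])
  let ?h = "to_nat :: nat \<times> nat \<times> nat \<Rightarrow> nat"
  let ?G = "(?h ` glued_verts, (`) ?h ` glued_edges)"
  have inj: "inj ?h" by simp
  have "simple_graph ?G"
  proof -
    have "card (?h ` e) = card e" for e by (rule card_image) (rule inj_on_subset[OF inj], simp)
    then show ?thesis using simple_glued unfolding simple_graph_def by auto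
  qed
  moreover have "card (?h ` glued_verts) = 20 * j + 12 + (16 * j + 8) * (length (gadget_points k) - 3)"
    using card_pattern_verts[OF k] card_image[OF inj_on_subset[OF inj subset_UNIV], of glued_verts] by simp
  moreover have "planar ?G" by (rule planar_rename[OF pattern_planar[OF k] inj])
  moreover have "\<not> contains_copy ?G (fan k)"
    using contains_copy_rename[OF _ inj] glued_fan_free[OF gadget_degree[OF k]] by blast
  moreover have "card ((`) ?h ` glued_edges) = (16 * j + 8) * length (gadget_edges k)"
  proof -
    have "inj_on ((`) ?h) glued_edges" using inj by (intro inj_onI) (simp add: inj_image_eq_iff)
    then show ?thesis using card_pattern_edges[OF k] by (simp add: card_image)
  qed
  ultimately show ?thesis by (intro bexI[of _ ?G]) (simp_all add: free_planar_graphs_def)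
qed

theorem theorem3p4:
  fixes n k :: nat
  assumes "k \<in> {2, 3, 4, 5}"
    and "real n \<ge> 12 / (6 - real k) + 1"
  shows "real (ex_planar n (fan k)) \<le> 24 * real k / (7 * real k + 6) * (real n - 2)
    \<and> ([n = 12 * (k + 2) div (6 - k)] (mod ((28 * k + 24) div (6 - k))) \<longrightarrow>
        real (ex_planar n (fan k)) = 24 * real k / (7 * real k + 6) * (real n - 2))"
proof -
  let ?S = "(\<lambda>G. card (edges G)) ` free_planar_graphs n (fan k)"
  have k: "k \<in> {2, 3, 4, 5}" by (rule assms(1))
  have n: "18 - k \<le> (6 - k) * n"
  proof -
    have "18 - real k \<le> (6 - real k) * real n" using assms by (auto simp: field_simps)
    then show ?thesis using k by auto
  qed
  have ne: "free_planar_graphs n (fan k) \<noteq> {}"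
    by (rule free_planar_graphs_nonempty) (use k in \<open>auto simp: fan_def\<close>)
  have fin: "finite ?S" by (rule finite_edge_counts)
  have bound: "(7 * k + 6) * m + 48 * k \<le> 24 * k * n" if "m \<in> ?S" for m
    using that fan_free_planar_edge_bound[OF k n] by (auto simp: image_iff)
  have mx: "ex_planar n (fan k) \<in> ?S" unfolding ex_planar_def using fin ne by (intro Max_in) auto
  have upper: "(7 * k + 6) * ex_planar n (fan k) + 48 * k \<le> 24 * k * n" by (rule bound[OF mx])
  have real_iff: "(7 * k + 6) * m + 48 * k \<le> 24 * k * n \<longleftrightarrow> real m \<le> 24 * real k / (7 * real k + 6) * (real n - 2)" for m
  proof -
    have "(7 * k + 6) * m + 48 * k \<le> 24 * k * n \<longleftrightarrow> real ((7 * k + 6) * m + 48 * k) \<le> real (24 * k * n)"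
      by (simp only: of_nat_le_iff)
    also have "\<dots> \<longleftrightarrow> real m \<le> 24 * real k / (7 * real k + 6) * (real n - 2)" by (simp add: field_simps)
    finally show ?thesis .
  qed
  have "real (ex_planar n (fan k)) = 24 * real k / (7 * real k + 6) * (real n - 2)"
    if cong: "[n = 12 * (k + 2) div (6 - k)] (mod ((28 * k + 24) div (6 - k)))"
  proof -
    let ?n0 = "12 * (k + 2) div (6 - k)" and ?M = "(28 * k + 24) div (6 - k)"
    define j where "j = n div ?M"
    have "n mod ?M = ?n0" using cong k unfolding cong_def by auto
    then have nj: "n = ?n0 + ?M * j" unfolding j_def by (metis add.commute mult_div_mod_eq)
    have n': "n = 20 * j + 12 + (16 * j + 8) * (length (gadget_points k) - 3)"
      using k nj length_gadget_points[OF k] by auto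
    obtain G where G: "G \<in> free_planar_graphs n (fan k)" "card (edges G) = (16 * j + 8) * length (gadget_edges k)"
      using extremal_graph[OF k, of j] n' by metis
    have "card (edges G) \<le> ex_planar n (fan k)" unfolding ex_planar_def using fin G(1) by (intro Max_ge) auto
    moreover have "(7 * k + 6) * card (edges G) + 48 * k = 24 * k * n"
      unfolding G(2) using k nj by (auto simp: gadget_edges_def)
    ultimately have "24 * k * n \<le> (7 * k + 6) * ex_planar n (fan k) + 48 * k"
      by (metis add_le_mono1 mult_le_mono2)
    then have "real ((7 * k + 6) * ex_planar n (fan k) + 48 * k) = real (24 * k * n)" using upper by simp
    then show ?thesis by (simp add: field_simps)
  qed
  then show ?thesis using upper real_iff by blast
qed

end
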